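(* A Banach space $X$ is linearly isomorphic to $c_0(\mathbb N)$ if and only if $X$ is Lipschitz isomorphic to $c_0(\mathbb N)$ (i.e. there is a bijection $U:X\to c_0(\mathbb N)$ with $U$ and $U^{-1}$ Lipschitz).
   Context: $c_0(\mathbb N)$ is the Banach space of real null sequences with the supremum norm. *)

theory Defs
  imports "HOL-Analysis.Analysis"
begin

text \<open>The space c_0(N) of real null sequences with the supremum norm, realised as the
  (closed) subspace of null sequences inside the Banach space of bounded real sequences
  (bounded continuous functions on the discrete space nat), whose norm is the sup norm.\<close>

definition c0 :: "(nat, real) bcontfun set" where
  "c0 = {f. (\<lambda>n. apply_bcontfun f n) \<longlonglongrightarrow> 0}"

definition lin_iso_c0 :: "('a::real_normed_vector \<Rightarrow> (nat, real) bcontfun) \<Rightarrow> bool" where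
  "lin_iso_c0 T \<longleftrightarrow> bounded_linear T \<and> bij_betw T UNIV c0 \<and>
     (\<exists>K. \<forall>x. norm x \<le> K * norm (T x))"

definition lip_iso_c0 :: "('a::real_normed_vector \<Rightarrow> (nat, real) bcontfun) \<Rightarrow> bool" where
  "lip_iso_c0 U \<longleftrightarrow> bij_betw U UNIV c0 \<and>
     (\<exists>L. L-lipschitz_on UNIV U) \<and> (\<exists>L. L-lipschitz_on c0 (inv_into UNIV U))"

end

theory Submission
  imports Defs "HOL-Complex_Analysis.Great_Picard" "HOL-Library.Nat_Bijection"
begin

text \<open>Let U be a bi-Lipschitz bijection of X onto c0 with inverse V.

  First, X is a Lipschitz retract of the space of bounded sequences. Averaging the retraction over
  translations, first along a finite set of vectors of X and then along indicator functions, turns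
  it into linear maps, which gives uniformly bounded finite rank operators on X that factor through
  finite-dimensional sup-norm spaces and are close to the identity on prescribed vectors. Grouping
  coordinates and passing to a weak-star limit gives such operators whose adjoints are close to the
  identity on prescribed functionals; if T1 and T2 are of the two kinds, T1 + T2 - T1 T2 is of both.

  Second, give the dual of X the norm that sends f to the Lipschitz constant of f composed with V.
  By the Gorelik principle, a weak-star small perturbation g increases this norm of f by at least
  a fixed multiple of the norm of g (Godefroy, Kalton and Lancien). Dually, X is asymptotically
  flat: adding to x a small vector on which finitely many functionals nearly vanish barely
  increases the norm of x.

  Flatness makes the vectors occurring in suitable differences of the finite rank operators
  unconditionally bounded, so the identity of X factors through c0. Pelczynski's decomposition
  method then gives the linear isomorphism.\<close>

section \<open>The Banach space of null sequences\<close>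

text \<open>A bounded linear retraction cannot be expected: c0 itself is a Lipschitz retract of the
  bounded sequences but is not complemented there. So averaging linearises only finitely many
  directions at a time, up to errors, and yields finite rank operators.

  Approximation of the adjoints in norm is what lets flatness act. Flatness at a point x is tested
  by finitely many functionals f, and a vector (T n - T k) y passes the test because f o T n and f o
  T k are both close to f in norm. Pointwise convergence of the operators would not give this
  uniformly in y.

  The functionals depend on the base point x, so all base points that can occur must be known before
  the next operator is chosen. A block involves the stages from T i to T (i + 3), which is why the
  blocks are split into residue classes modulo 4. The errors 1/4, 1/8, ... granted to the successive
  blocks of a class keep its sums bounded.\<close>

lemma subspace_c0: "subspace c0"
  unfolding subspace_def c0_def
  by (auto intro!: tendsto_eq_intros)

lemma closed_c0: "closed c0"
proof -
  have "f \<in> c0" if f: "\<And>n. F n \<in> c0" "F \<longlonglongrightarrow> f" for F f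
  proof -
    have "(\<lambda>n. apply_bcontfun f n) \<longlonglongrightarrow> 0"
    proof (rule LIMSEQ_I)
      fix r :: real assume r: "0 < r"
      obtain N where N: "norm (F N - f) < r / 2"
        using LIMSEQ_D[OF f(2), of "r / 2"] r by auto
      have "(\<lambda>n. apply_bcontfun (F N) n) \<longlonglongrightarrow> 0" using f(1) by (simp add: c0_def)
      then obtain M where M: "\<And>n. n \<ge> M \<Longrightarrow> norm (apply_bcontfun (F N) n - 0) < r / 2"
        using LIMSEQ_D[of _ 0 "r / 2"] r by (metis half_gt_zero)
      have "norm (apply_bcontfun f n - 0) < r" if "n \<ge> M" for n
        using M[OF that] norm_bounded[of "F N - f" n] N by (auto simp: minus_bcontfun.rep_eq)
      then show "\<exists>no. \<forall>n\<ge>no. norm (apply_bcontfun f n - 0) < r" by blast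
    qed
    then show ?thesis by (simp add: c0_def)
  qed
  then show ?thesis by (auto simp: closed_sequential_limits)
qed

text \<open>A type of its own makes \<open>U\<close> and \<open>V\<close> below total maps between
  Banach spaces, with completeness carried by the class \<open>banach\<close>.\<close>

typedef czero = c0 morphisms to_bcf of_bcf
  using subspace_c0 subspace_0 by blast

instantiation czero :: real_normed_vector
begin

definition zero_czero :: czero where "0 = of_bcf 0"
definition plus_czero :: "czero \<Rightarrow> czero \<Rightarrow> czero" where "x + y = of_bcf (to_bcf x + to_bcf y)"
definition minus_czero :: "czero \<Rightarrow> czero \<Rightarrow> czero" where "x - y = of_bcf (to_bcf x - to_bcf y)"
definition uminus_czero :: "czero \<Rightarrow> czero" where "- x = of_bcf (- to_bcf x)"
definition scaleR_czero :: "real \<Rightarrow> czero \<Rightarrow> czero" where "c *\<^sub>R x = of_bcf (c *\<^sub>R to_bcf x)"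
definition norm_czero :: "czero \<Rightarrow> real" where "norm_czero x = norm (to_bcf x)"
definition dist_czero :: "czero \<Rightarrow> czero \<Rightarrow> real" where "dist_czero x y = norm (x - y)"
definition sgn_czero :: "czero \<Rightarrow> czero" where "sgn_czero x = inverse (norm x) *\<^sub>R x"
definition uniformity_czero :: "(czero \<times> czero) filter" where
  "uniformity_czero = (INF e\<in>{0 <..}. principal {(x :: czero, y). dist x y < e})"
definition open_czero :: "czero set \<Rightarrow> bool" where
  "open_czero S = (\<forall>x\<in>S. \<forall>\<^sub>F (x', y) in uniformity. x' = x \<longrightarrow> y \<in> S)"

lemma to_bcf_simps:
  "to_bcf 0 = 0" "to_bcf (x + y) = to_bcf x + to_bcf y" "to_bcf (x - y) = to_bcf x - to_bcf y"
  "to_bcf (- x) = - to_bcf x" "to_bcf (c *\<^sub>R x) = c *\<^sub>R to_bcf x"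
  using to_bcf[of x] to_bcf[of y] subspace_c0
  by (auto simp: zero_czero_def plus_czero_def minus_czero_def uminus_czero_def scaleR_czero_def
      of_bcf_inverse subspace_0 subspace_add subspace_diff subspace_neg subspace_scale)

instance
proof
  fix x y z :: czero and a b :: real
  show "x + y + z = x + (y + z)" "x + y = y + x" "0 + x = x" "- x + x = 0" "x - y = x + - y"
    by (simp_all add: to_bcf_inject[symmetric] to_bcf_simps algebra_simps)
  show "a *\<^sub>R (x + y) = a *\<^sub>R x + a *\<^sub>R y" "(a + b) *\<^sub>R x = a *\<^sub>R x + b *\<^sub>R x"
    "a *\<^sub>R b *\<^sub>R x = (a * b) *\<^sub>R x" "1 *\<^sub>R x = x"
    by (simp_all add: to_bcf_inject[symmetric] to_bcf_simps algebra_simps)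
  show "dist x y = norm (x - y)" by (rule dist_czero_def)
  show "sgn x = inverse (norm x) *\<^sub>R x" by (rule sgn_czero_def)
  show "(norm x = 0) = (x = 0)" "norm (x + y) \<le> norm x + norm y" "norm (a *\<^sub>R x) = \<bar>a\<bar> * norm x"
    by (simp_all add: norm_czero_def to_bcf_inject[symmetric] to_bcf_simps norm_triangle_ineq)
  show "(uniformity :: (czero \<times> czero) filter) = (INF e\<in>{0 <..}. principal {(x, y). dist x y < e})"
    by (rule uniformity_czero_def)
  show "open S = (\<forall>x\<in>S. \<forall>\<^sub>F (x', y) in uniformity. x' = x \<longrightarrow> y \<in> S)" for S :: "czero set"
    by (rule open_czero_def)
qed

end

instance czero :: banach
proof
  fix X :: "nat \<Rightarrow> czero" assume "Cauchy X"
  then have cau: "Cauchy (\<lambda>n. to_bcf (X n))"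
    by (simp only: Cauchy_def dist_norm norm_czero_def to_bcf_simps)
  obtain f where f: "(\<lambda>n. to_bcf (X n)) \<longlonglongrightarrow> f"
  proof -
    from cau obtain g where "uniform_limit UNIV (\<lambda>n. apply_bcontfun (to_bcf (X n))) g sequentially"
      using uniformly_convergent_eq_cauchy[of "\<lambda>_. True" "\<lambda>n. apply_bcontfun (to_bcf (X n))"]
      unfolding Cauchy_def uniform_limit_sequentially_iff
      by (metis dist_fun_lt_imp_dist_val_lt)
    from uniform_limit_bcontfunE[OF this sequentially_bot] that show ?thesis by metis
  qed
  have "f \<in> c0"
    by (rule closed_sequentially[OF closed_c0 _ f]) (rule to_bcf)
  with f have "X \<longlonglongrightarrow> of_bcf f"
    unfolding tendsto_iff dist_norm norm_czero_def to_bcf_simps by (simp only: of_bcf_inverse)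
  then show "convergent X" by (auto simp: convergent_def)
qed

definition cz :: "czero \<Rightarrow> nat \<Rightarrow> real" where
  "cz z n = apply_bcontfun (to_bcf z) n"

text \<open>The value is unspecified unless \<open>g\<close> is a null sequence, so each use comes
  with a limit proof that feeds \<open>cz_czs\<close>.\<close>

definition czs :: "(nat \<Rightarrow> real) \<Rightarrow> czero" where
  "czs g = of_bcf (Bcontfun g)"

lemma cz_tendsto: "cz z \<longlonglongrightarrow> 0"
  using to_bcf[of z] by (simp add: cz_def[abs_def] c0_def)

lemma cz_simps [simp]:
  "cz 0 n = 0" "cz (x + y) n = cz x n + cz y n" "cz (x - y) n = cz x n - cz y n"
  "cz (- x) n = - cz x n" "cz (c *\<^sub>R x) n = c * cz x n"
  by (simp_all add: cz_def to_bcf_simps)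

lemma cz_sum: "cz (\<Sum>i\<in>A. f i) n = (\<Sum>i\<in>A. cz (f i) n)"
  by (induction A rule: infinite_finite_induct) auto

lemma cz_eqI: "(\<And>n. cz x n = cz y n) \<Longrightarrow> x = y"
  by (auto simp: cz_def to_bcf_inject[symmetric] intro: bcontfun_eqI)

lemma cz_le_norm: "\<bar>cz z n\<bar> \<le> norm z"
  using norm_bounded[of "to_bcf z" n] by (simp add: cz_def norm_czero_def)

lemma norm_cz_le: "(\<And>n. \<bar>cz z n\<bar> \<le> C) \<Longrightarrow> norm z \<le> C"
  unfolding norm_czero_def by (rule norm_bound) (simp add: cz_def)

lemma apply_Bcontfun_nat:
  fixes g :: "nat \<Rightarrow> real"
  assumes "\<And>n. \<bar>g n\<bar> \<le> C"
  shows "apply_bcontfun (Bcontfun g) = g"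
  using assms by (intro Bcontfun_inverse bcontfun_normI) (auto simp: continuous_on_discrete)

lemma cz_czs:
  assumes "g \<longlonglongrightarrow> 0"
  shows "cz (czs g) n = g n"
proof -
  obtain C where "\<And>n. \<bar>g n\<bar> \<le> C"
    using convergent_imp_Bseq[of g] assms by (auto simp: convergent_def Bseq_def)
  then have "apply_bcontfun (Bcontfun g) = g" by (rule apply_Bcontfun_nat)
  moreover from this have "Bcontfun g \<in> c0" using assms by (simp add: c0_def)
  ultimately show ?thesis by (simp add: cz_def czs_def of_bcf_inverse)
qed

lemma bounded_linear_cz: "bounded_linear (\<lambda>z. cz z n)"
  by (rule bounded_linear_intro[where K=1]) (auto simp: cz_le_norm)

lemma finite_support_tendsto_0: "(\<lambda>i. if i < n then f i else (0::real)) \<longlonglongrightarrow> 0" for n :: nat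
  by (rule tendsto_eventually) (auto simp: eventually_sequentially intro!: exI[of _ n])

text \<open>Finitely supported rational sequences, coded by lists, are dense. Through
  \<open>V\<close> this makes the space X separable.\<close>

lemma czero_separable:
  obtains D :: "czero set" where "countable D" "closure D = UNIV"
proof
  define q where "q l = czs (\<lambda>n. if n < length l then of_rat (l ! n) else 0)" for l :: "rat list"
  have cq: "cz (q l) n = (if n < length l then of_rat (l ! n) else 0)" for l n
    unfolding q_def by (rule cz_czs[OF finite_support_tendsto_0])
  show "countable (range q)" by simp
  show "closure (range q) = UNIV"
  proof (intro set_eqI iffI UNIV_I)
    fix z
    have "\<exists>y\<in>range q. dist y z < e" if e: "e > 0" for e
    proof -
      obtain N where N: "\<And>n. n \<ge> N \<Longrightarrow> \<bar>cz z n\<bar> < e / 2"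
        using LIMSEQ_D[OF cz_tendsto[of z], of "e / 2"] e by auto
      have "\<exists>r. \<bar>of_rat r - cz z n\<bar> < e / 2" for n
      proof -
        have "cz z n - e / 2 < cz z n + e / 2" using e by simp
        then obtain r where "cz z n - e / 2 < of_rat r" "of_rat r < cz z n + e / 2"
          using of_rat_dense by blast
        then have "\<bar>of_rat r - cz z n\<bar> < e / 2" by linarith
        then show ?thesis by blast
      qed
      then obtain r where r: "\<And>n. \<bar>of_rat (r n) - cz z n\<bar> < e / 2" by metis
      have "norm (q (map r [0..<N]) - z) \<le> e / 2"
        by (rule norm_cz_le) (use r N in \<open>auto simp: cq less_imp_le not_less\<close>)
      then have "dist (q (map r [0..<N])) z < e" using e by (simp add: dist_norm)
      then show ?thesis by blast
    qed
    then show "z \<in> closure (range q)" by (simp add: closure_approachable)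
  qed
qed

section \<open>Norming functionals and small perturbations of the identity\<close>

definition sublin :: "('a::real_vector \<Rightarrow> real) \<Rightarrow> bool" where
  "sublin p \<longleftrightarrow> (\<forall>x y. p (x + y) \<le> p x + p y) \<and> (\<forall>c x. 0 \<le> c \<longrightarrow> p (c *\<^sub>R x) = c * p x)"

lemma sublin_add: "sublin p \<Longrightarrow> p (x + y) \<le> p x + p y"
  and sublin_scale: "sublin p \<Longrightarrow> 0 \<le> c \<Longrightarrow> p (c *\<^sub>R x) = c * p x"
  by (auto simp: sublin_def)

lemma sublin_zero: "sublin p \<Longrightarrow> p 0 = 0"
  using sublin_scale[of p 0 0] by simp

lemma sublin_minus: "sublin p \<Longrightarrow> - p (- x) \<le> p x"
  using sublin_add[of p x "- x"] by (simp add: sublin_zero)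

text \<open>Pushing a sublinear functional down along a fixed direction; a functional on which this has no
  effect is additive, which is why minimal sublinear functionals are linear.\<close>

lemma sublin_push:
  assumes p: "sublin p"
  obtains q where "sublin q" "\<And>y. q y \<le> p y" "q (- x) \<le> - p x"
proof
  \<comment> \<open>The parameter t = 0 gives q <= p, and t = 1 at the point - x gives the value - p
    x because p 0 = 0.\<close>
  define Q where "Q y = (\<lambda>t. p (y + t *\<^sub>R x) - t * p x) ` {0..}" for y
  define q where "q y = Inf (Q y)" for y
  have lb: "- p (- y) \<le> p (y + t *\<^sub>R x) - t * p x" if "t \<ge> 0" for y t
    using sublin_add[OF p, of "y + t *\<^sub>R x" "- y"] sublin_scale[OF p that, of x] by simp
  have bdd: "bdd_below (Q y)" for y
    using lb[of _ y] by (auto simp: Q_def intro!: bdd_belowI[of _ "- p (- y)"])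
  have ne: "Q y \<noteq> {}" for y by (auto simp: Q_def)
  have le: "q y \<le> p (y + t *\<^sub>R x) - t * p x" if "t \<ge> 0" for y t
    unfolding q_def using that by (intro cInf_lower bdd) (auto simp: Q_def)
  have ge: "b \<le> q y" if "\<And>t. t \<ge> 0 \<Longrightarrow> b \<le> p (y + t *\<^sub>R x) - t * p x" for b y
    unfolding q_def using that by (intro cInf_greatest ne) (auto simp: Q_def)
  show "q y \<le> p y" for y using le[of 0 y] by simp
  show "q (- x) \<le> - p x" using le[of 1 "- x"] by (simp add: sublin_zero[OF p])
  have add: "q (y + z) \<le> q y + q z" for y z
  proof -
    have "q (y + z) - (p (y + t *\<^sub>R x) - t * p x) \<le> q z" if t: "t \<ge> 0" for t
    proof (rule ge)
      fix s :: real assume s: "s \<ge> 0"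
      have "q (y + z) \<le> p ((y + z) + (t + s) *\<^sub>R x) - (t + s) * p x"
        using s t by (intro le) simp
      also have "p ((y + z) + (t + s) *\<^sub>R x) \<le> p (y + t *\<^sub>R x) + p (z + s *\<^sub>R x)"
        using sublin_add[OF p, of "y + t *\<^sub>R x" "z + s *\<^sub>R x"] by (simp add: algebra_simps)
      finally show "q (y + z) - (p (y + t *\<^sub>R x) - t * p x) \<le> p (z + s *\<^sub>R x) - s * p x"
        by (simp add: algebra_simps)
    qed
    then have "q (y + z) - q z \<le> p (y + t *\<^sub>R x) - t * p x" if "t \<ge> 0" for t
      using that by (simp add: algebra_simps)
    from ge[OF this] show ?thesis by simp
  qed
  have half: "c * q y \<le> q (c *\<^sub>R y)" if c: "c > 0" for c y
  proof (rule ge)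
    fix t :: real assume t: "t \<ge> 0"
    have "c * q y \<le> c * (p (y + (t / c) *\<^sub>R x) - t / c * p x)"
      using c t by (intro mult_left_mono le) auto
    also have "\<dots> = p (c *\<^sub>R y + t *\<^sub>R x) - t * p x"
      using sublin_scale[OF p, of c "y + (t / c) *\<^sub>R x"] c by (simp add: algebra_simps)
    finally show "c * q y \<le> p (c *\<^sub>R y + t *\<^sub>R x) - t * p x" .
  qed
  have "q (c *\<^sub>R y) = c * q y" if c: "c \<ge> 0" for c y
  proof (cases "c = 0")
    case True
    have "q 0 = 0"
    proof (rule antisym)
      show "q 0 \<le> 0" using le[of 0 0] by (simp add: sublin_zero[OF p])
      show "0 \<le> q 0" by (rule ge) (use sublin_scale[OF p] in auto)
    qed
    with True show ?thesis by simp
  next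
    case False
    with c have c: "c > 0" by simp
    have "q (c *\<^sub>R y) \<le> c * q y"
      using half[of "1 / c" "c *\<^sub>R y"] c by (simp add: field_simps)
    with half[OF c] show ?thesis by (rule antisym[rotated])
  qed
  with add show "sublin q" by (auto simp: sublin_def)
qed

text \<open>Zorn's lemma applies because the infimum of a chain stays finite, all members being at
  least - p (- x) at x, and stays subadditive, as of two members the smaller one may be used for
  both summands.\<close>

lemma sublin_dominates_linear:
  fixes p :: "'a::real_vector \<Rightarrow> real"
  assumes p: "sublin p"
  obtains f where "linear f" "\<And>x. f x \<le> p x"
proof -
  define A where "A = {q. sublin q \<and> (\<forall>x. q x \<le> p x)}"
  have pA: "p \<in> A" using p by (simp add: A_def)
  have lbA: "- p (- x) \<le> q x" if "q \<in> A" for q x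
  proof -
    have q: "sublin q" "q (- x) \<le> p (- x)" using that by (auto simp: A_def)
    from sublin_minus[OF q(1), of x] q(2) show ?thesis by linarith
  qed
  have "\<exists>m\<in>A. \<forall>q\<in>A. m \<ge> q \<longrightarrow> q = m"
  proof (rule predicate_Zorn)
    show "partial_order_on A (relation_of (\<lambda>q r. q \<ge> r) A)"
      by (rule partial_order_on_relation_ofI) auto
    fix C assume C: "C \<in> Chains (relation_of (\<lambda>q r. q \<ge> r) A)"
    then have CA: "C \<subseteq> A" by (rule Chains_relation_of)
    have tot: "q \<le> r \<or> r \<le> q" if "q \<in> C" "r \<in> C" for q r
      using C that by (auto simp: Chains_def relation_of_def)
    show "\<exists>u\<in>A. \<forall>a\<in>C. u \<le> a"
    proof (cases "C = {}")
      case True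
      with pA show ?thesis by auto
    next
      case ne: False
      define u where "u x = (INF q\<in>C. q x)" for x
      have bdd: "bdd_below ((\<lambda>q. q x) ` C)" for x
        using CA lbA by (auto intro!: bdd_belowI[of _ "- p (- x)"])
      have le: "u x \<le> q x" if "q \<in> C" for q x
        unfolding u_def using that by (intro cINF_lower bdd)
      have ge: "b \<le> u x" if "\<And>q. q \<in> C \<Longrightarrow> b \<le> q x" for b x
        unfolding u_def using that by (intro cINF_greatest ne)
      have sub: "sublin q" if "q \<in> C" for q using CA that by (auto simp: A_def)
      have add: "u (x + y) \<le> u x + u y" for x y
      proof -
        have *: "u (x + y) \<le> q x + r y" if "q \<in> C" "r \<in> C" for q r
          using tot[OF that]
        proof
          assume "q \<le> r"
          then have "q y \<le> r y" by (simp add: le_fun_def)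
          with le[OF that(1), of "x + y"] sublin_add[OF sub[OF that(1)], of x y] show ?thesis by linarith
        next
          assume "r \<le> q"
          then have "r x \<le> q x" by (simp add: le_fun_def)
          with le[OF that(2), of "x + y"] sublin_add[OF sub[OF that(2)], of x y] show ?thesis by linarith
        qed
        have "u (x + y) - q x \<le> u y" if "q \<in> C" for q
          by (rule ge) (use *[OF that] in \<open>auto simp: algebra_simps\<close>)
        then have "u (x + y) - u y \<le> u x" by (intro ge) (simp add: algebra_simps)
        then show ?thesis by simp
      qed
      have half: "c * u x \<le> u (c *\<^sub>R x)" if c: "c \<ge> 0" for c x
        by (rule ge) (simp add: sublin_scale[OF sub c] mult_left_mono[OF le c])
      have "u (c *\<^sub>R x) = c * u x" if c: "c \<ge> 0" for c x
      proof (cases "c = 0")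
        case True
        obtain q where "q \<in> C" using ne by auto
        then have "u 0 \<le> 0" using le sublin_zero[OF sub] by metis
        moreover have "0 \<le> u 0" by (rule ge) (simp add: sublin_zero[OF sub])
        ultimately show ?thesis using True by simp
      next
        case False
        with c have "c > 0" by simp
        then have "u (c *\<^sub>R x) \<le> c * u x"
          using half[of "1 / c" "c *\<^sub>R x"] by (simp add: field_simps)
        with half[OF c] show ?thesis by (rule antisym[rotated])
      qed
      with add have "sublin u" by (auto simp: sublin_def)
      moreover have "u x \<le> p x" for x
      proof -
        obtain q where q: "q \<in> C" using ne by auto
        then have "q x \<le> p x" using CA by (auto simp: A_def)
        with le[OF q, of x] show ?thesis by linarith
      qed
      ultimately have "u \<in> A" by (simp add: A_def)
      with le show ?thesis by (auto simp: le_fun_def)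
    qed
  qed
  then obtain m where mA: "m \<in> A" and min: "\<And>q. q \<in> A \<Longrightarrow> q \<le> m \<Longrightarrow> q = m" by blast
  have m: "sublin m" "\<And>x. m x \<le> p x" using mA by (auto simp: A_def)
  \<comment> \<open>Minimality forces the push of \<open>m\<close> along x to be \<open>m\<close>
    itself, so m (- x) <= - m x; the reverse inequality is subadditivity.\<close>
  have neg: "m (- x) = - m x" for x
  proof -
    obtain q where q: "sublin q" "\<And>y. q y \<le> m y" "q (- x) \<le> - m x"
      using sublin_push[OF m(1), of x] by blast
    have "q \<in> A" using q m(2) by (auto simp: A_def intro: order_trans)
    then have "q = m" using q(2) by (intro min) (auto simp: le_fun_def)
    with q(3) sublin_minus[OF m(1), of x] show ?thesis by simp
  qed
  have "linear m"
  proof (rule linearI)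
    fix x y c
    show "m (x + y) = m x + m y"
      using sublin_add[OF m(1), of x y] sublin_add[OF m(1), of "x + y" "- y"] by (simp add: neg)
    show "m (c *\<^sub>R x) = c *\<^sub>R m x"
    proof (cases "c \<ge> 0")
      case False
      then have "m ((- c) *\<^sub>R x) = - c * m x" by (intro sublin_scale[OF m(1)]) simp
      with neg[of "c *\<^sub>R x"] show ?thesis by simp
    qed (simp add: sublin_scale[OF m(1)])
  qed
  with m(2) that show ?thesis by blast
qed

text \<open>Pushing the norm down along \<open>x\<close> first forces every dominated linear
  functional to be at most - norm x at - x, so the norm is attained at \<open>x\<close>.\<close>

lemma norming_functional:
  fixes x :: "'a::real_normed_vector"
  obtains f :: "'a \<Rightarrow>\<^sub>L real" where "norm f \<le> 1" "blinfun_apply f x = norm x"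
proof -
  have "sublin (norm :: 'a \<Rightarrow> real)" by (auto simp: sublin_def norm_triangle_ineq)
  then obtain q where q: "sublin q" "\<And>y. q y \<le> norm y" "q (- x) \<le> - norm x"
    using sublin_push[of norm x] by blast
  obtain g where g: "linear g" "\<And>y. g y \<le> q y" using sublin_dominates_linear[OF q(1)] by blast
  have le: "g y \<le> norm y" for y using g(2)[of y] q(2)[of y] by linarith
  have abs: "\<bar>g y\<bar> \<le> norm y" for y
    using le[of y] le[of "- y"] by (simp add: linear_neg[OF g(1)])
  have bl: "bounded_linear g"
    using g(1) abs by (auto intro!: bounded_linear_intro[where K=1] simp: linear_add linear_cmul)
  have "g x = norm x"
    using g(2)[of "- x"] q(3) le[of x] by (simp add: linear_neg[OF g(1)])
  then show ?thesis
    using that[of "Blinfun g"] abs by (simp add: bounded_linear_Blinfun_apply[OF bl] norm_blinfun_bound)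
qed

text \<open>The cube of coefficients is the convex hull of its sign vertices and the norm is convex;
  one coordinate at a time is moved to the vertices.\<close>

lemma norm_sum_scaleR_le_of_signs:
  fixes v :: "'i \<Rightarrow> 'a::real_normed_vector"
  assumes "finite I"
    and "\<And>e. (\<And>i. i \<in> I \<Longrightarrow> e i = 1 \<or> e i = -1) \<Longrightarrow> norm (\<Sum>i\<in>I. e i *\<^sub>R v i) \<le> C"
    and "\<And>i. i \<in> I \<Longrightarrow> \<bar>t i\<bar> \<le> (1::real)"
  shows "norm (\<Sum>i\<in>I. t i *\<^sub>R v i) \<le> C"
proof -
  have "norm (w + (\<Sum>i\<in>I. t i *\<^sub>R v i)) \<le> C"
    if "\<And>e. (\<And>i. i \<in> I \<Longrightarrow> e i = 1 \<or> e i = -1) \<Longrightarrow> norm (w + (\<Sum>i\<in>I. e i *\<^sub>R v i)) \<le> C" for w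
    using assms(1) assms(3) that
  proof (induction I arbitrary: w rule: finite_induct)
    case empty
    then show ?case by simp
  next
    case (insert j J)
    have step: "norm ((w + s *\<^sub>R v j) + (\<Sum>i\<in>J. t i *\<^sub>R v i)) \<le> C" if s: "s = 1 \<or> s = -1" for s
    proof (rule insert.IH)
      fix e :: "'i \<Rightarrow> real" assume e: "\<And>i. i \<in> J \<Longrightarrow> e i = 1 \<or> e i = -1"
      have "(\<Sum>i\<in>insert j J. (e(j := s)) i *\<^sub>R v i) = s *\<^sub>R v j + (\<Sum>i\<in>J. e i *\<^sub>R v i)"
        using insert.hyps by (auto intro!: sum.cong)
      moreover have "norm (w + (\<Sum>i\<in>insert j J. (e(j := s)) i *\<^sub>R v i)) \<le> C"
        by (rule insert.prems(2)) (use e s in auto)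
      ultimately show "norm ((w + s *\<^sub>R v j) + (\<Sum>i\<in>J. e i *\<^sub>R v i)) \<le> C" by (simp add: add.assoc)
    qed (use insert.prems in auto)
    define y where "y = w + (\<Sum>i\<in>J. t i *\<^sub>R v i)"
    define l where "l = (1 + t j) / 2"
    have l: "0 \<le> l" "0 \<le> 1 - l" using insert.prems(1)[of j] by (auto simp: l_def abs_le_iff)
    have "w + (\<Sum>i\<in>insert j J. t i *\<^sub>R v i) = l *\<^sub>R (y + v j) + (1 - l) *\<^sub>R (y - v j)"
    proof -
      have "l *\<^sub>R (y + v j) + (1 - l) *\<^sub>R (y - v j) = y + (2 * l - 1) *\<^sub>R v j"
        by (simp add: algebra_simps) (simp flip: scaleR_add_left add: scaleR_2[symmetric])
      also have "2 * l - 1 = t j" by (simp add: l_def field_simps)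
      finally show ?thesis using insert.hyps by (simp add: y_def algebra_simps)
    qed
    also have "norm \<dots> \<le> l * norm (y + v j) + (1 - l) * norm (y - v j)"
      using norm_triangle_ineq[of "l *\<^sub>R (y + v j)" "(1 - l) *\<^sub>R (y - v j)"] l by simp
    also have "\<dots> \<le> l * C + (1 - l) * C"
      using step[of 1] step[of "-1"] l
      by (intro add_mono mult_left_mono) (auto simp: y_def algebra_simps)
    finally show ?case by (simp add: algebra_simps)
  qed
  from this[of 0] assms(2) show ?thesis by simp
qed

text \<open>M x = y is solved as a fixed point of the contraction sending x to y - (M x - x); the
  lower bound norm x <= 2 * norm (M x) gives injectivity and bounds the inverse.\<close>

lemma near_identity_inverse:
  fixes M :: "'a::banach \<Rightarrow> 'a"
  assumes bl: "bounded_linear M" and near: "\<And>x. norm (M x - x) \<le> norm x / 2"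
  obtains M' where "bounded_linear M'" "\<And>x. M (M' x) = x" "\<And>x. M' (M x) = x"
proof -
  interpret M: bounded_linear M by (rule bl)
  have low: "norm x \<le> 2 * norm (M x)" for x
    using near[of x] norm_triangle_ineq3[of "M x" x] by linarith
  have inj: "inj M"
  proof (rule injI)
    fix x y assume "M x = M y"
    then show "x = y" using low[of "x - y"] by (simp add: M.diff)
  qed
  have "\<exists>x. M x = y" for y
  proof -
    have "\<exists>!x. y - (M x - x) = x"
    proof (rule banach_fix_type[where c="1/2"])
      show "\<forall>x x'. dist (y - (M x - x)) (y - (M x' - x')) \<le> 1/2 * dist x x'"
      proof (intro allI)
        fix x x' :: 'a
        have "(y - (M x - x)) - (y - (M x' - x')) = - (M (x - x') - (x - x'))"
          by (simp add: M.diff)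
        then have "dist (y - (M x - x)) (y - (M x' - x')) = norm (M (x - x') - (x - x'))"
          by (simp only: dist_norm norm_minus_cancel)
        then show "dist (y - (M x - x)) (y - (M x' - x')) \<le> 1/2 * dist x x'"
          using near[of "x - x'"] by (simp add: dist_norm)
      qed
    qed auto
    then obtain x where "y - (M x - x) = x" by blast
    then have "M x = y" by (simp add: algebra_simps)
    then show ?thesis by blast
  qed
  then have surj: "surj M" unfolding surj_def by metis
  have r: "M (inv M x) = x" for x using surj by (rule surj_f_inv_f)
  have l: "inv M (M x) = x" for x using inj by (rule inv_f_f)
  have "bounded_linear (inv M)"
  proof (rule bounded_linear_intro[where K=2])
    fix x y c
    show "inv M (x + y) = inv M x + inv M y" using l[of "inv M x + inv M y"] by (simp add: M.add r)
    show "inv M (c *\<^sub>R x) = c *\<^sub>R inv M x" using l[of "c *\<^sub>R inv M x"] by (simp add: M.scaleR r)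
    show "norm (inv M x) \<le> norm x * 2" using low[of "inv M x"] by (simp add: r)
  qed
  with l r that show ?thesis by blast
qed

section \<open>Averaging Lipschitz maps\<close>

definition avg :: "nat \<Rightarrow> 'b::real_normed_vector \<Rightarrow> ('b \<Rightarrow> 'a::real_normed_vector) \<Rightarrow> 'b \<Rightarrow> 'a" where
  "avg M h \<phi> y = (1 / real M) *\<^sub>R (\<Sum>k<M. \<phi> (y + real k *\<^sub>R h))"

fun avgs :: "nat \<Rightarrow> 'b::real_normed_vector list \<Rightarrow> ('b \<Rightarrow> 'a::real_normed_vector) \<Rightarrow> 'b \<Rightarrow> 'a" where
  "avgs M [] \<phi> = \<phi>"
| "avgs M (h # hs) \<phi> = avg M h (avgs M hs \<phi>)"

lemma avg_norm:
  assumes "M > 0" and "\<And>k. k < M \<Longrightarrow> norm (\<phi> (y + real k *\<^sub>R h) - c) \<le> C"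
  shows "norm (avg M h \<phi> y - c) \<le> C"
proof -
  have eq: "avg M h \<phi> y - c = (1 / real M) *\<^sub>R (\<Sum>k<M. \<phi> (y + real k *\<^sub>R h) - c)"
    using assms(1) by (simp add: avg_def sum_subtractf algebra_simps sum_constant_scaleR)
  have "norm (\<Sum>k<M. \<phi> (y + real k *\<^sub>R h) - c) \<le> real (card {..<M}) * C"
    using assms(2) by (intro sum_norm_bound) auto
  then show ?thesis unfolding eq using assms(1) by (simp add: field_simps)
qed

lemma avg_diff: "avg M h \<phi> (y + g) - avg M h \<phi> y = avg M h (\<lambda>y. \<phi> (y + g) - \<phi> y) y"
  by (simp add: avg_def sum_subtractf algebra_simps)

text \<open>Averaging commutes with translations, so increments of the averaged map are averages of
  increments of the original one.\<close>

lemma avgs_diff: "avgs M hs \<phi> (y + g) - avgs M hs \<phi> y = avgs M hs (\<lambda>y. \<phi> (y + g) - \<phi> y) y"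
proof (induction hs arbitrary: y)
  case (Cons h hs)
  have "avgs M (h # hs) \<phi> (y + g) - avgs M (h # hs) \<phi> y
      = avg M h (\<lambda>y. avgs M hs \<phi> (y + g) - avgs M hs \<phi> y) y" by (simp add: avg_diff)
  then show ?case by (simp add: Cons)
qed simp

text \<open>\<open>P\<close> only has to be stable under the translations: below it is the whole
  space or a neighbourhood of the embedded copy of X.\<close>

lemma avgs_norm:
  assumes "M > 0" and "\<And>y h k. y \<in> P \<Longrightarrow> h \<in> set hs \<Longrightarrow> y + real k *\<^sub>R h \<in> P"
    and "\<And>y. y \<in> P \<Longrightarrow> norm (\<phi> y - c) \<le> C" and "y \<in> P"
  shows "norm (avgs M hs \<phi> y - c) \<le> C"
  using assms(2-4)
proof (induction hs arbitrary: y)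
  case (Cons h hs)
  show ?case
    unfolding avgs.simps
    by (rule avg_norm[OF assms(1)], rule Cons.IH) (use Cons.prems in auto)
qed simp

text \<open>Without a stable set the sample points still remain in a ball, enlarged by the total
  length of the translations.\<close>

lemma avgs_norm_ball:
  assumes "M > 0" and "\<And>y. norm y \<le> D + real M * (\<Sum>h\<leftarrow>hs. norm h) \<Longrightarrow> norm (\<phi> y - c) \<le> C"
    and "norm y \<le> D"
  shows "norm (avgs M hs \<phi> y - c) \<le> C"
  using assms(2,3)
proof (induction hs arbitrary: y D)
  case (Cons h hs)
  show ?case
    unfolding avgs.simps
  proof (rule avg_norm[OF assms(1)], rule Cons.IH)
    fix k assume k: "k < M"
    have "norm (y + real k *\<^sub>R h) \<le> norm y + real k * norm h"
      using norm_triangle_ineq[of y "real k *\<^sub>R h"] by simp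
    also have "\<dots> \<le> D + real M * norm h"
      using Cons.prems(2) k by (intro add_mono mult_right_mono) auto
    finally show "norm (y + real k *\<^sub>R h) \<le> D + real M * norm h" .
  qed (use Cons.prems in \<open>auto simp: algebra_simps\<close>)
qed simp

lemma avg_telescope:
  assumes "M > 0"
  shows "avg M h (\<lambda>y. \<omega> (y + h) - \<omega> y) y = (1 / real M) *\<^sub>R (\<omega> (y + real M *\<^sub>R h) - \<omega> y)"
proof -
  have "(\<Sum>k<n. \<omega> (y + real k *\<^sub>R h + h) - \<omega> (y + real k *\<^sub>R h)) = \<omega> (y + real n *\<^sub>R h) - \<omega> y" for n
    by (induction n) (auto simp: algebra_simps)
  then show ?thesis by (simp add: avg_def)
qed

text \<open>The factor belonging to \<open>h\<close> telescopes its increments into one increment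
  over \<open>M\<close> steps, whose error \<open>C\<close> is thereby divided by \<open>M\<close>.
  The other factors merely take means and preserve the bound.\<close>

lemma avgs_telescope:
  assumes M: "M > 0" and P: "\<And>y h k. y \<in> P \<Longrightarrow> h \<in> set hs \<Longrightarrow> y + real k *\<^sub>R h \<in> P"
    and h: "h \<in> set hs"
    and C: "\<And>y. y \<in> P \<Longrightarrow> norm (\<psi> (y + real M *\<^sub>R h) - \<psi> y - real M *\<^sub>R c) \<le> C" and y: "y \<in> P"
  shows "norm (avgs M hs (\<lambda>y. \<psi> (y + h) - \<psi> y) y - c) \<le> C / real M"
  using P h y
proof (induction hs arbitrary: y)
  case (Cons a hs)
  show ?case
  proof (cases "a = h")
    case True
    have "avgs M (a # hs) (\<lambda>y. \<psi> (y + h) - \<psi> y) y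
        = avg M h (\<lambda>y. avgs M hs \<psi> (y + h) - avgs M hs \<psi> y) y"
      by (simp add: True avgs_diff)
    also have "\<dots> = (1 / real M) *\<^sub>R avgs M hs (\<lambda>y. \<psi> (y + real M *\<^sub>R h) - \<psi> y) y"
      unfolding avg_telescope[OF M, of h "avgs M hs \<psi>" y] by (simp add: avgs_diff)
    finally have eq: "avgs M (a # hs) (\<lambda>y. \<psi> (y + h) - \<psi> y) y - c
        = (1 / real M) *\<^sub>R (avgs M hs (\<lambda>y. \<psi> (y + real M *\<^sub>R h) - \<psi> y) y - real M *\<^sub>R c)"
      using M by (simp add: algebra_simps)
    have "norm (avgs M hs (\<lambda>y. \<psi> (y + real M *\<^sub>R h) - \<psi> y) y - real M *\<^sub>R c) \<le> C"
      by (rule avgs_norm[OF M, where P=P]) (use Cons.prems C in auto)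
    then show ?thesis unfolding eq using M by (simp add: divide_right_mono)
  next
    case False
    then show ?thesis
      unfolding avgs.simps by (intro avg_norm[OF M] Cons.IH) (use Cons.prems in auto)
  qed
qed simp

lemma avgs_lipschitz:
  assumes M: "M > 0" and lip: "\<And>y y'. norm (\<phi> y - \<phi> y') \<le> K * norm (y - y')"
  shows "norm (avgs M hs \<phi> y - avgs M hs \<phi> y') \<le> K * norm (y - y')"
proof -
  have "norm (avgs M hs (\<lambda>z. \<phi> (z + (y - y')) - \<phi> z) y' - 0) \<le> K * norm (y - y')"
  proof (rule avgs_norm[OF M, where P=UNIV])
    show "norm (\<phi> (z + (y - y')) - \<phi> z - 0) \<le> K * norm (y - y')" for z
      using lip[of "z + (y - y')" z] by simp
  qed auto
  then show ?thesis using avgs_diff[of M hs \<phi> y' "y - y'"] by simp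
qed

text \<open>The increment along \<open>g\<close> is bounded by the Lipschitz constant, so
  telescoping its change along \<open>h\<close> leaves O(1/M): the averaged map is almost additive
  in the direction \<open>h\<close>.\<close>

lemma avgs_second_difference:
  assumes M: "M > 0" and lip: "\<And>y y'. norm (\<phi> y - \<phi> y') \<le> K * norm (y - y')" and h: "h \<in> set hs"
  shows "norm (avgs M hs \<phi> (y + h + g) - avgs M hs \<phi> (y + h) - (avgs M hs \<phi> (y + g) - avgs M hs \<phi> y))
    \<le> 2 * K * norm g / real M"
proof -
  have b: "norm (\<phi> (z + g) - \<phi> z) \<le> K * norm g" for z using lip[of "z + g" z] by simp
  have "norm (avgs M hs (\<lambda>y. (\<phi> (y + h + g) - \<phi> (y + h)) - (\<phi> (y + g) - \<phi> y)) y - 0) \<le> 2 * K * norm g / real M"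
  proof (rule avgs_telescope[OF M, where P=UNIV and \<psi>="\<lambda>y. \<phi> (y + g) - \<phi> y"])
    show "norm (\<phi> (y + real M *\<^sub>R h + g) - \<phi> (y + real M *\<^sub>R h) - (\<phi> (y + g) - \<phi> y) - real M *\<^sub>R 0)
        \<le> 2 * K * norm g" for y
      using norm_triangle_le_diff[OF add_mono[OF b b], of "y + real M *\<^sub>R h" y] by simp
  qed (use h in auto)
  then show ?thesis
    using avgs_diff[of M hs "\<lambda>y. \<phi> (y + g) - \<phi> y" y h] avgs_diff[of M hs \<phi> "y + h" g]
      avgs_diff[of M hs \<phi> y g] by (simp add: algebra_simps)
qed

text \<open>The lattice point is reached from 0 by single steps along the \<open>g i\<close>. All
  intermediate points have norm at most \<open>S\<close>, and each step costs one
  \<open>\<theta>\<close>.\<close>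

lemma lattice_path:
  fixes \<phi> :: "'b::real_normed_vector \<Rightarrow> 'a::real_normed_vector" and p :: "'i \<Rightarrow> nat"
  assumes "finite I" and "\<And>s i. norm s \<le> S \<Longrightarrow> i \<in> I \<Longrightarrow> norm (\<phi> (s + g i) - \<phi> s - w i) \<le> \<theta>"
    and "(\<Sum>i\<in>I. real (p i) * norm (g i)) \<le> S"
  shows "norm (\<phi> (\<Sum>i\<in>I. real (p i) *\<^sub>R g i) - \<phi> 0 - (\<Sum>i\<in>I. real (p i) *\<^sub>R w i)) \<le> real (\<Sum>i\<in>I. p i) * \<theta>"
  using assms(3)
proof (induction "\<Sum>i\<in>I. p i" arbitrary: p)
  case 0
  then have "\<And>i. i \<in> I \<Longrightarrow> p i = 0" using assms(1) by simp
  then show ?case by simp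
next
  case (Suc n)
  then obtain i where i: "i \<in> I" "p i \<noteq> 0" by (metis sum.neutral nat.distinct(1))
  define q where "q = p(i := p i - 1)"
  have split: "(\<Sum>j\<in>I. F (p j) j) = (\<Sum>j\<in>I. F (q j) j) + (F (p i) i - F (p i - 1) i)"
    for F :: "nat \<Rightarrow> 'i \<Rightarrow> 'c::ab_group_add"
  proof -
    have "(\<Sum>j\<in>I-{i}. F (p j) j) = (\<Sum>j\<in>I-{i}. F (q j) j)" by (rule sum.cong) (auto simp: q_def)
    then show ?thesis
      using sum.remove[OF assms(1) i(1), of "\<lambda>j. F (p j) j"] sum.remove[OF assms(1) i(1), of "\<lambda>j. F (q j) j"]
      by (simp add: q_def algebra_simps)
  qed
  have pi: "real (p i) - real (p i - 1) = 1" using i(2) by (simp add: of_nat_diff)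
  have "int (\<Sum>j\<in>I. p j) = int (\<Sum>j\<in>I. q j) + 1"
    using split[of "\<lambda>k j. int k"] i(2) by (simp add: of_nat_diff)
  then have n: "n = (\<Sum>j\<in>I. q j)" using Suc.hyps(2) by linarith
  have sg: "(\<Sum>j\<in>I. real (p j) *\<^sub>R v j) = (\<Sum>j\<in>I. real (q j) *\<^sub>R v j) + v i" for v :: "'i \<Rightarrow> 'c::real_normed_vector"
    using split[of "\<lambda>k j. real k *\<^sub>R v j"] pi by (simp flip: scaleR_left_diff_distrib)
  have "(\<Sum>j\<in>I. real (p j) * norm (g j)) = (\<Sum>j\<in>I. real (q j) * norm (g j)) + norm (g i)"
    using sg[of "\<lambda>j. norm (g j)"] by simp
  then have qS: "(\<Sum>j\<in>I. real (q j) * norm (g j)) \<le> S" using Suc.prems norm_ge_zero[of "g i"] by linarith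
  define s where "s = (\<Sum>j\<in>I. real (q j) *\<^sub>R g j)"
  have "norm s \<le> S" unfolding s_def
    by (rule order_trans[OF norm_sum order_trans[OF _ qS]]) (auto intro: sum_mono)
  then have st: "norm (\<phi> (s + g i) - \<phi> s - w i) \<le> \<theta>" using assms(2) i(1) by blast
  have IH: "norm (\<phi> s - \<phi> 0 - (\<Sum>j\<in>I. real (q j) *\<^sub>R w j)) \<le> real n * \<theta>"
    using Suc.hyps(1)[OF n qS] by (simp add: s_def n)
  have "\<phi> (\<Sum>j\<in>I. real (p j) *\<^sub>R g j) - \<phi> 0 - (\<Sum>j\<in>I. real (p j) *\<^sub>R w j)
      = (\<phi> s - \<phi> 0 - (\<Sum>j\<in>I. real (q j) *\<^sub>R w j)) + (\<phi> (s + g i) - \<phi> s - w i)"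
    by (simp only: sg s_def) (simp add: algebra_simps)
  also have "norm \<dots> \<le> real n * \<theta> + \<theta>" by (rule norm_triangle_mono[OF IH st])
  also have "\<dots> = real (\<Sum>j\<in>I. p j) * \<theta>" by (simp flip: Suc.hyps(2) add: algebra_simps)
  finally show ?case .
qed

text \<open>Soft thresholding at level \<open>d\<close>.\<close>

definition soft :: "real \<Rightarrow> real \<Rightarrow> real" where
  "soft d t = t - max (- d) (min d t)"

lemma soft_lipschitz: "0 \<le> d \<Longrightarrow> 0 \<le> d' \<Longrightarrow> \<bar>soft d t - soft d' t'\<bar> \<le> \<bar>d - d'\<bar> + \<bar>t - t'\<bar>"
  unfolding soft_def max_def min_def by (simp split: if_splits) linarith

lemma abs_soft: "0 \<le> d \<Longrightarrow> \<bar>soft d t\<bar> = max 0 (\<bar>t\<bar> - d)"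
  unfolding soft_def max_def min_def by (simp split: if_splits) linarith

text \<open>The distance of a bounded sequence from c0 is the limit superior of its absolute values,
  so thresholding at that level leaves a null sequence. Level and entry are both 1-Lipschitz in the
  sequence, whence the constant 2.\<close>

lemma bcontfun_lipschitz_retraction:
  obtains \<rho> :: "(nat, real) bcontfun \<Rightarrow> czero"
  where "\<And>w w'. norm (\<rho> w - \<rho> w') \<le> 2 * norm (w - w')" "\<And>z. \<rho> (to_bcf z) = z"
proof
  define \<rho> where "\<rho> w = czs (\<lambda>i. soft (infdist w c0) (apply_bcontfun w i))" for w
  have ne: "c0 \<noteq> {}" using subspace_c0 subspace_0 by blast
  have lim: "(\<lambda>i. soft (infdist w c0) (apply_bcontfun w i)) \<longlonglongrightarrow> 0" for w
  proof (rule LIMSEQ_I)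
    fix e :: real assume e: "0 < e"
    have "infdist w c0 < infdist w c0 + e / 2" using e by simp
    then obtain z where z: "z \<in> c0" "dist w z < infdist w c0 + e / 2"
      using infdist_notempty[OF ne] cINF_less_iff[of c0 "dist w"] ne
      by (metis bdd_below_image_dist)
    from z(1) obtain N where N: "\<And>n. n \<ge> N \<Longrightarrow> \<bar>apply_bcontfun z n\<bar> < e / 2"
      using LIMSEQ_D[of "apply_bcontfun z" 0 "e / 2"] e by (auto simp: c0_def)
    have "norm (soft (infdist w c0) (apply_bcontfun w n) - 0) < e" if "n \<ge> N" for n
      using N[OF that] z(2) norm_bounded[of "w - z" n] e
      by (simp add: abs_soft infdist_nonneg dist_norm)
    then show "\<exists>no. \<forall>n\<ge>no. norm (soft (infdist w c0) (apply_bcontfun w n) - 0) < e" by blast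
  qed
  have c: "cz (\<rho> w) i = soft (infdist w c0) (apply_bcontfun w i)" for w i
    unfolding \<rho>_def by (rule cz_czs[OF lim])
  show "norm (\<rho> w - \<rho> w') \<le> 2 * norm (w - w')" for w w'
  proof (rule norm_cz_le)
    fix i
    have "\<bar>infdist w c0 - infdist w' c0\<bar> \<le> norm (w - w')"
      using infdist_triangle_abs[of w c0 w'] by (simp add: dist_norm)
    then show "\<bar>cz (\<rho> w - \<rho> w') i\<bar> \<le> 2 * norm (w - w')"
      using soft_lipschitz[OF infdist_nonneg[of w c0] infdist_nonneg[of w' c0], of "apply_bcontfun w i" "apply_bcontfun w' i"]
        norm_bounded[of "w - w'" i] by (simp add: c)
  qed
  show "\<rho> (to_bcf z) = z" for z
    by (rule cz_eqI, simp only: c infdist_zero[OF to_bcf] soft_def) (simp add: cz_def)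
qed

text \<open>McShane's infimum formula, applied to a function given on the image of \<open>j\<close>.
  The point \<open>undefined\<close> serves as an arbitrary base point that bounds the infimum from
  below.\<close>

lemma lipschitz_extension:
  fixes g :: "'c \<Rightarrow> real" and j :: "'c \<Rightarrow> 'b::metric_space"
  assumes L: "0 \<le> L" and g: "\<And>x x'. \<bar>g x - g x'\<bar> \<le> L * dist (j x) (j x')"
  obtains h where "\<And>x. h (j x) = g x" "\<And>y y'. \<bar>h y - h y'\<bar> \<le> L * dist y y'"
proof
  define h where "h y = (INF x. g x + L * dist y (j x))" for y
  have bdd: "bdd_below (range (\<lambda>x. g x + L * dist y (j x)))" for y
  proof (rule bdd_belowI2)
    fix x
    have "L * dist (j undefined) (j x) \<le> L * (dist y (j undefined) + dist y (j x))"
      using L dist_triangle2[of "j undefined" "j x" y] by (intro mult_left_mono) (auto simp: dist_commute)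
    then show "g undefined - L * dist y (j undefined) \<le> g x + L * dist y (j x)"
      using g[of undefined x] by (simp add: algebra_simps)
  qed
  have le: "h y \<le> g x + L * dist y (j x)" for x y
    unfolding h_def by (rule cINF_lower[OF bdd]) simp
  have ge: "b \<le> h y" if "\<And>x. b \<le> g x + L * dist y (j x)" for b y
    unfolding h_def by (rule cINF_greatest) (use that in auto)
  have "h y - h y' \<le> L * dist y y'" for y y'
  proof -
    have "h y - L * dist y y' \<le> h y'"
    proof (rule ge)
      fix x
      have "L * dist y (j x) \<le> L * (dist y y' + dist y' (j x))"
        using L by (intro mult_left_mono dist_triangle)
      then show "h y - L * dist y y' \<le> g x + L * dist y' (j x)"
        using le[of y x] by (simp add: algebra_simps)
    qed
    then show ?thesis by simp
  qed
  from this[of y y' for y y'] this[of y' y for y y'] show "\<bar>h y - h y'\<bar> \<le> L * dist y y'" for y y'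
    by (metis abs_le_iff dist_commute minus_diff_eq)
  show "h (j x) = g x" for x
    using le[of "j x" x] ge[of "g x" "j x"] g[of x] by (auto simp: abs_le_iff algebra_simps intro!: antisym)
qed

section \<open>Approximating the identity through finite-dimensional sup-norm spaces\<close>

text \<open>The operator T factors through the space of bounded functions on I with the supremum norm:
  x goes to the family of the a i x, and t goes to the sum of the t i b i; both factors have norm
  at most K.\<close>

definition fac :: "real \<Rightarrow> nat set \<Rightarrow> (nat \<Rightarrow> 'a::real_normed_vector \<Rightarrow>\<^sub>L real) \<Rightarrow> (nat \<Rightarrow> 'a) \<Rightarrow> ('a \<Rightarrow>\<^sub>L 'a) \<Rightarrow> bool"
  where "fac K I a b T \<longleftrightarrow> finite I \<and> (\<forall>i\<in>I. norm (a i) \<le> K) \<and>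
    (\<forall>t. (\<forall>i\<in>I. \<bar>t i\<bar> \<le> 1) \<longrightarrow> norm (\<Sum>i\<in>I. t i *\<^sub>R b i) \<le> K) \<and>
    (\<forall>x. blinfun_apply T x = (\<Sum>i\<in>I. blinfun_apply (a i) x *\<^sub>R b i))"

definition rank_one :: "('a::real_normed_vector \<Rightarrow>\<^sub>L real) \<Rightarrow> 'b::real_normed_vector \<Rightarrow> 'a \<Rightarrow>\<^sub>L 'b" where
  "rank_one f v = Blinfun (\<lambda>x. blinfun_apply f x *\<^sub>R v)"

lemma rank_one_apply [simp]: "blinfun_apply (rank_one f v) x = blinfun_apply f x *\<^sub>R v"
  unfolding rank_one_def
  by (rule bounded_linear_Blinfun_apply[THEN fun_cong])
     (intro bounded_linear_scaleR_const blinfun.bounded_linear_right)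

lemma blinfun_sum_apply: "blinfun_apply (\<Sum>i\<in>I. F i) x = (\<Sum>i\<in>I. blinfun_apply (F i) x)"
  by (induction I rule: infinite_finite_induct) (auto simp: blinfun.add_left)

lemma facD:
  assumes "fac K I a b T"
  shows "finite I" "\<And>i. i \<in> I \<Longrightarrow> norm (a i) \<le> K"
    "\<And>t. (\<And>i. i \<in> I \<Longrightarrow> \<bar>t i\<bar> \<le> 1) \<Longrightarrow> norm (\<Sum>i\<in>I. t i *\<^sub>R b i) \<le> K"
    "\<And>x. blinfun_apply T x = (\<Sum>i\<in>I. blinfun_apply (a i) x *\<^sub>R b i)"
  using assms by (auto simp: fac_def)

lemma fac_nonneg: "fac K I a b T \<Longrightarrow> 0 \<le> K"
  using facD(3)[of K I a b T "\<lambda>_. 0"] by simp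

lemma fac_sum_bound:
  assumes "fac K I a b T" and C: "0 \<le> C" and "\<And>i. i \<in> I \<Longrightarrow> \<bar>t i\<bar> \<le> C"
  shows "norm (\<Sum>i\<in>I. t i *\<^sub>R b i) \<le> K * C"
proof (cases "C = 0")
  case False
  with C have C: "C > 0" by simp
  have "norm (\<Sum>i\<in>I. (t i / C) *\<^sub>R b i) \<le> K"
    using assms C by (intro facD(3)[OF assms(1)]) (auto simp: field_simps)
  moreover have "(\<Sum>i\<in>I. t i *\<^sub>R b i) = C *\<^sub>R (\<Sum>i\<in>I. (t i / C) *\<^sub>R b i)"
    using C by (simp add: scaleR_sum_right)
  ultimately show ?thesis using C by (simp add: mult.commute mult_left_mono)
next
  case True
  then have "\<And>i. i \<in> I \<Longrightarrow> t i = 0" using assms(3) by fastforce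
  with True show ?thesis by simp
qed

lemma fac_norm:
  assumes "fac K I a b T"
  shows "norm T \<le> K * K"
proof (rule norm_blinfun_bound)
  show "0 \<le> K * K" by simp
  fix x
  have "\<bar>blinfun_apply (a i) x\<bar> \<le> K * norm x" if "i \<in> I" for i
    using norm_blinfun[of "a i" x] facD(2)[OF assms that]
    by (metis mult_right_mono norm_ge_zero order_trans real_norm_def)
  then have "norm (blinfun_apply T x) \<le> K * (K * norm x)"
    unfolding facD(4)[OF assms] by (intro fac_sum_bound[OF assms]) (use fac_nonneg[OF assms] in auto)
  then show "norm (blinfun_apply T x) \<le> K * K * norm x" by (simp add: mult.assoc)
qed

lemma facI:
  assumes "finite I" "\<And>i. i \<in> I \<Longrightarrow> norm (a i) \<le> K"
    and "\<And>t. (\<And>i. i \<in> I \<Longrightarrow> \<bar>t i\<bar> \<le> 1) \<Longrightarrow> norm (\<Sum>i\<in>I. t i *\<^sub>R b i) \<le> K"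
  shows "fac K I a b (\<Sum>i\<in>I. rank_one (a i) (b i))"
  using assms by (auto simp: fac_def blinfun_sum_apply)

text \<open>A single constant that is at least 1 for both directions keeps divisions by
  \<open>L\<close> harmless.\<close>

locale lip_c0 =
  fixes U :: "'a::banach \<Rightarrow> czero" and V :: "czero \<Rightarrow> 'a" and L :: real
  assumes UV: "U (V z) = z" and VU: "V (U x) = x" and L1: "1 \<le> L"
    and lipU: "norm (U x - U y) \<le> L * norm (x - y)"
    and lipV: "norm (V z - V w) \<le> L * norm (z - w)"
begin

lemma dense_sequence:
  obtains d :: "nat \<Rightarrow> 'a" where "\<And>x e. e > 0 \<Longrightarrow> \<exists>n. norm (d n - x) < e"
proof -
  obtain D :: "czero set" where D: "countable D" "closure D = UNIV" by (rule czero_separable)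
  then have "D \<noteq> {}" by auto
  then obtain q :: "nat \<Rightarrow> czero" where q: "range q = D"
    using D(1) by (metis range_from_nat_into)
  show ?thesis
  proof
    fix x and e :: real assume e: "e > 0"
    have "U x \<in> closure D" using D by simp
    then obtain y where y: "y \<in> D" "dist y (U x) < e / L"
      unfolding closure_approachable using e L1 by (metis divide_pos_pos less_le_trans zero_less_one)
    then obtain n where n: "y = q n" using q by auto
    have "norm (V (q n) - x) \<le> L * norm (q n - U x)" using lipV[of "q n" "U x"] by (simp add: VU)
    also have "\<dots> < L * (e / L)" using y n L1 by (intro mult_strict_left_mono) (auto simp: dist_norm)
    also have "\<dots> = e" using L1 by simp
    finally show "\<exists>n. norm (V (q n) - x) < e" by blast
  qed
qed

text \<open>Functionals norming a dense sequence embed X isometrically into the bounded sequences.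
  The coordinates of \<open>U\<close> extend from the image by McShane's formula, thresholding leads
  back into c0 and \<open>V\<close> back to X; the constants multiply to L * 2 * L.\<close>

lemma lipschitz_retraction:
  obtains f :: "nat \<Rightarrow> 'a \<Rightarrow>\<^sub>L real" and r :: "(nat, real) bcontfun \<Rightarrow> 'a" and K
  where "\<And>n. norm (f n) \<le> 1" "0 \<le> K" "\<And>y y'. norm (r y - r y') \<le> K * norm (y - y')"
    "\<And>x. r (Bcontfun (\<lambda>n. blinfun_apply (f n) x)) = x"
proof -
  obtain d :: "nat \<Rightarrow> 'a" where d: "\<And>x e. e > 0 \<Longrightarrow> \<exists>n. norm (d n - x) < e"
    using dense_sequence by blast
  have "\<exists>g :: 'a \<Rightarrow>\<^sub>L real. norm g \<le> 1 \<and> blinfun_apply g (d n) = norm (d n)" for n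
    by (rule norming_functional[of "d n"]) blast
  then obtain f :: "nat \<Rightarrow> 'a \<Rightarrow>\<^sub>L real"
    where f: "\<And>n. norm (f n) \<le> 1" "\<And>n. blinfun_apply (f n) (d n) = norm (d n)" by metis
  have fx: "\<bar>blinfun_apply (f n) x\<bar> \<le> norm x" for n x
    using norm_blinfun[of "f n" x] mult_right_mono[OF f(1)[of n] norm_ge_zero[of x]] by simp
  define j where "j x = Bcontfun (\<lambda>n. blinfun_apply (f n) x)" for x
  have j: "apply_bcontfun (j x) n = blinfun_apply (f n) x" for x n
    unfolding j_def using apply_Bcontfun_nat[OF fx] by simp
  have jdiff: "j x - j y = j (x - y)" for x y
    by (rule bcontfun_eqI) (simp add: j blinfun.diff_right)
  have jnorm: "norm x \<le> norm (j x)" for x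
  proof (rule field_le_epsilon)
    fix e :: real assume "e > 0"
    then obtain n where n: "norm (d n - x) < e / 2" using d[of "e / 2" x] by auto
    have "norm (d n) - blinfun_apply (f n) x \<le> norm (d n - x)"
      using fx[of n "d n - x"] by (simp add: f(2) blinfun.diff_right)
    then show "norm x \<le> norm (j x) + e"
      using norm_bounded[of "j x" n] n norm_triangle_ineq2[of x "d n"] by (simp add: j norm_minus_commute)
  qed
  have Ui: "\<bar>cz (U x) i - cz (U x') i\<bar> \<le> L * dist (j x) (j x')" for x x' i
  proof -
    have "\<bar>cz (U x - U x') i\<bar> \<le> L * norm (x - x')" using cz_le_norm lipU order_trans by blast
    also have "\<dots> \<le> L * dist (j x) (j x')"
      using jnorm[of "x - x'"] L1 by (intro mult_left_mono) (auto simp: dist_norm jdiff)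
    finally show ?thesis by simp
  qed
  have "\<exists>h. (\<forall>x. h (j x) = cz (U x) i) \<and> (\<forall>y y'. \<bar>h y - h y'\<bar> \<le> L * dist y y')" for i
    using lipschitz_extension[of L "\<lambda>x. cz (U x) i" j, OF _ Ui] L1 by (metis order_trans zero_le_one)
  then obtain h where h: "\<And>i x. h i (j x) = cz (U x) i" "\<And>i y y'. \<bar>h i y - h i y'\<bar> \<le> L * dist y y'"
    by metis
  \<comment> \<open>Off the image of \<open>j\<close> the extended coordinates form a bounded
    sequence that need not tend to 0; hence the retraction onto c0 afterwards.\<close>
  define E where "E y = Bcontfun (\<lambda>i. h i y)" for y
  have hb: "\<bar>h i y\<bar> \<le> norm (U 0) + L * dist y (j 0)" for i y
    using h(2)[of i y "j 0"] cz_le_norm[of "U 0" i] by (simp add: h(1))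
  have E: "apply_bcontfun (E y) i = h i y" for y i
    unfolding E_def using apply_Bcontfun_nat[of "\<lambda>i. h i y", OF hb] by simp
  have Elip: "norm (E y - E y') \<le> L * norm (y - y')" for y y'
    by (rule norm_bound) (use h(2)[of _ y y'] in \<open>simp add: E dist_norm\<close>)
  have Ej: "E (j x) = to_bcf (U x)" for x
    by (rule bcontfun_eqI) (simp add: E h(1) cz_def)
  obtain \<rho> :: "(nat, real) bcontfun \<Rightarrow> czero"
    where \<rho>: "\<And>w w'. norm (\<rho> w - \<rho> w') \<le> 2 * norm (w - w')" "\<And>z. \<rho> (to_bcf z) = z"
    by (rule bcontfun_lipschitz_retraction) blast
  have "norm (V (\<rho> (E y)) - V (\<rho> (E y'))) \<le> (L * (2 * L)) * norm (y - y')" for y y'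
  proof -
    have "norm (V (\<rho> (E y)) - V (\<rho> (E y'))) \<le> L * norm (\<rho> (E y) - \<rho> (E y'))" by (rule lipV)
    also have "\<dots> \<le> L * (2 * (L * norm (y - y')))"
      using L1 \<rho>(1)[of "E y" "E y'"] Elip[of y y'] by (intro mult_left_mono) auto
    finally show ?thesis by (simp add: mult_ac)
  qed
  moreover have "V (\<rho> (E (j x))) = x" for x by (simp add: Ej \<rho>(2) VU)
  ultimately show ?thesis
    using L1 by (intro that[of f "L * (2 * L)" "\<lambda>y. V (\<rho> (E y))"]) (auto simp: f j_def)
qed

end

section \<open>Linearising the retraction in finitely many directions\<close>

context lip_c0
begin

text \<open>Averaging along the \<open>j e\<close> makes the retraction almost equivariant under
  these translations; averaging along scaled indicators \<open>g i\<close> makes it almost additive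
  in them. The increments \<open>w i\<close> along the \<open>g i\<close> then define the operator.
  The parameters are chosen in the order \<open>N\<close>, \<open>Q\<close>, \<open>M2\<close>,
  \<open>D\<close>, \<open>M\<close>, each depending on the earlier ones.\<close>

lemma local_approximation:
  obtains K where "1 \<le> K"
    "\<And>(E :: 'a set) \<epsilon>. finite E \<Longrightarrow> 0 < \<epsilon> \<Longrightarrow> \<exists>I a b T. fac K I a b T \<and> (\<forall>e\<in>E. norm (blinfun_apply T e - e) \<le> \<epsilon>)"
proof -
  obtain f :: "nat \<Rightarrow> 'a \<Rightarrow>\<^sub>L real" and r :: "(nat, real) bcontfun \<Rightarrow> 'a" and K where
    f: "\<And>n. norm (f n) \<le> 1" and K: "0 \<le> K" and lip: "\<And>y y'. norm (r y - r y') \<le> K * norm (y - y')"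
    and rj: "\<And>x. r (Bcontfun (\<lambda>n. blinfun_apply (f n) x)) = x"
    by (rule lipschitz_retraction, rule that)
  have fx: "\<bar>blinfun_apply (f n) x\<bar> \<le> norm x" for n x
    using norm_blinfun[of "f n" x] mult_right_mono[OF f[of n] norm_ge_zero[of x]] by simp
  define j where "j x = Bcontfun (\<lambda>n. blinfun_apply (f n) x)" for x
  have j: "apply_bcontfun (j x) n = blinfun_apply (f n) x" for x n
    unfolding j_def using apply_Bcontfun_nat[OF fx] by simp
  have rj: "r (j x) = x" for x by (simp add: j_def rj)
  have jadd: "j x + j y = j (x + y)" and jscale: "c *\<^sub>R j x = j (c *\<^sub>R x)" for x y c
    by (rule bcontfun_eqI, simp add: j blinfun.add_right blinfun.scaleR_right)+
  have main: "\<exists>I a b T. fac (2 * (K + 1)) I a b T \<and> (\<forall>e\<in>E. norm (blinfun_apply T e - e) \<le> \<epsilon>)"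
    if E: "finite E" and \<epsilon>: "0 < \<epsilon>" for E :: "'a set" and \<epsilon> :: real
  proof -
    obtain N :: nat where N': "real N \<ge> 1 + (3 * K + 2) * 2 / \<epsilon>" using real_arch_simple by blast
    have N1: "real N \<ge> 1" using N' K \<epsilon> by (smt (verit) divide_nonneg_pos mult_nonneg_nonneg)
    have N0: "real N > 0" using N1 by simp
    have "real N \<ge> (3 * K + 2) * 2 / \<epsilon>" using N' by linarith
    then have N: "(3 * K + 2) / real N \<le> \<epsilon> / 2" using N0 \<epsilon> by (simp add: field_simps)
    \<comment> \<open>Functionals with equal keys agree on \<open>E\<close> up to 1/N. Only finitely
      many keys occur, and the least index of a class represents it.\<close>
    define key where "key n = (\<lambda>e\<in>E. \<lfloor>real N * blinfun_apply (f n) e\<rfloor>)" for n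
    have "range key \<subseteq> (\<Pi>\<^sub>E e\<in>E. {\<lfloor>- (real N * norm e)\<rfloor>..\<lfloor>real N * norm e\<rfloor>})"
    proof (clarsimp simp: key_def)
      fix n e assume "e \<in> E"
      show "\<lfloor>- (real N * norm e)\<rfloor> \<le> \<lfloor>real N * blinfun_apply (f n) e\<rfloor> \<and>
          \<lfloor>real N * blinfun_apply (f n) e\<rfloor> \<le> \<lfloor>real N * norm e\<rfloor>"
        using fx[of n e] N0 by (auto simp: abs_le_iff intro!: floor_mono)
          (metis N0 minus_le_iff mult_minus_right mult_left_mono less_imp_le)
    qed
    then have finkey: "finite (range key)" by (rule finite_subset) (auto intro: finite_PiE E)
    define rep where "rep n = (LEAST n'. key n' = key n)" for n
    have keyrep: "key (rep n) = key n" for n unfolding rep_def by (rule LeastI[of _ n]) simp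
    define I where "I = range rep"
    have "I = (\<lambda>k. LEAST n'. key n' = k) ` range key" by (auto simp: I_def rep_def image_image)
    then have finI: "finite I" using finkey by simp
    \<comment> \<open>The height 1/N fits the rounding: suitable integer combinations of the
      \<open>g i\<close> come within 1/N of each \<open>j e\<close>.\<close>
    define g where "g i = Bcontfun (\<lambda>n. if rep n = i then 1 / real N else 0)" for i
    have g: "apply_bcontfun (g i) n = (if rep n = i then 1 / real N else 0)" for i n
      unfolding g_def by (subst apply_Bcontfun_nat[where C="1 / real N"]) auto
    have gsum: "apply_bcontfun (\<Sum>i\<in>I. q i *\<^sub>R g i) n = q (rep n) / real N" for q n
    proof -
      have "apply_bcontfun (\<Sum>i\<in>J. q i *\<^sub>R g i) n = (\<Sum>i\<in>J. q i * apply_bcontfun (g i) n)" for J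
        by (induction J rule: infinite_finite_induct) auto
      then have "apply_bcontfun (\<Sum>i\<in>I. q i *\<^sub>R g i) n = (\<Sum>i\<in>I. if i = rep n then q i / real N else 0)"
        by (simp add: g) (rule sum.cong, auto)
      then show ?thesis using finI by (simp add: I_def)
    qed
    have gn: "norm (g i) \<le> 1" for i
      by (rule norm_bound) (use N1 in \<open>auto simp: g field_simps\<close>)
    define p where "p e i = \<lfloor>real N * blinfun_apply (f i) e\<rfloor>" for e i
    have prep: "p e (rep n) = p e n" if "e \<in> E" for e n
      using fun_cong[OF keyrep[of n], of e] that by (simp add: key_def p_def)
    \<comment> \<open>\<open>Q\<close> bounds the number of steps of every lattice path used: each
      element of \<open>I\<close> at most once, or the positive or the negative part of
      \<open>p e\<close>.\<close>
    define Q :: real where "Q = 1 + real (card I) + (\<Sum>e\<in>E. \<Sum>i\<in>I. real_of_int \<bar>p e i\<bar>)"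
    have Q1: "1 \<le> Q" and QI: "real (card I) \<le> Q"
      by (auto simp: Q_def intro!: sum_nonneg add_nonneg_nonneg)
    have Qp: "(\<Sum>i\<in>I. real_of_int \<bar>p e i\<bar>) \<le> Q" if "e \<in> E" for e
    proof -
      have "(\<Sum>i\<in>I. real_of_int \<bar>p e i\<bar>) \<le> (\<Sum>e\<in>E. \<Sum>i\<in>I. real_of_int \<bar>p e i\<bar>)"
        using E that by (intro member_le_sum[where f="\<lambda>e. \<Sum>i\<in>I. real_of_int \<bar>p e i\<bar>"]) (auto intro: sum_nonneg)
      then show ?thesis by (simp add: Q_def)
    qed
    \<comment> \<open>\<open>M2\<close> makes the path error Q * \<open>\<theta>\<close> small even
      after multiplication by \<open>N\<close>: at most 1 for the norm bound and
      \<open>\<epsilon>\<close> / 8 for the approximation.\<close>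
    obtain M2 :: nat where M2': "real M2 \<ge> 1 + real N * Q * (2 * K * Q) * (1 + 8 / \<epsilon>)" using real_arch_simple by blast
    have pos: "0 \<le> real N * Q * (2 * K * Q)" using N0 Q1 K by auto
    have M20: "real M2 > 0" using M2' pos \<epsilon> by (smt (verit) divide_nonneg_pos mult_nonneg_nonneg)
    define \<theta> where "\<theta> = 2 * K * Q / real M2"
    have \<theta>0: "0 \<le> \<theta>" using K Q1 by (simp add: \<theta>_def)
    have NQ: "real N * Q * \<theta> * (1 + 8 / \<epsilon>) \<le> 1"
      using M2' M20 by (simp add: \<theta>_def field_simps)
    have NQ0: "0 \<le> real N * Q * \<theta>" using N0 Q1 \<theta>0 by auto
    have NQ1: "real N * Q * \<theta> \<le> 1" and NQ2: "real N * Q * \<theta> \<le> \<epsilon> / 8"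
    proof -
      have "real N * Q * \<theta> * (1 + 8 / \<epsilon>) = real N * Q * \<theta> + real N * Q * \<theta> * 8 / \<epsilon>"
        by (simp add: algebra_simps)
      moreover have "0 \<le> real N * Q * \<theta> * 8 / \<epsilon>" using NQ0 \<epsilon> by simp
      ultimately have "real N * Q * \<theta> \<le> 1" "real N * Q * \<theta> * 8 / \<epsilon> \<le> 1" using NQ NQ0 by linarith+
      then show "real N * Q * \<theta> \<le> 1" "real N * Q * \<theta> \<le> \<epsilon> / 8" using \<epsilon> by (auto simp: field_simps)
    qed
    have QT: "Q * \<theta> \<le> \<epsilon> / 8"
    proof -
      have "1 * (Q * \<theta>) \<le> real N * (Q * \<theta>)" using N1 Q1 \<theta>0 by (intro mult_right_mono) auto
      with NQ2 show ?thesis by (simp add: mult.assoc)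
    qed
    obtain gs where gs: "set gs = g ` I" using finite_list[of "g ` I"] finI by auto
    obtain vs where vs: "set vs = E" using finite_list[OF E] by auto
    \<comment> \<open>Averaging along the \<open>g i\<close> from a point of the ball of radius
      \<open>Q\<close> samples points of norm at most \<open>D\<close>. \<open>M\<close> is chosen
      last, to outweigh \<open>D\<close>.\<close>
    define D where "D = Q + real M2 * (\<Sum>h\<leftarrow>gs. norm h)"
    have D0: "0 \<le> D" using Q1 by (auto simp: D_def intro!: add_nonneg_nonneg mult_nonneg_nonneg sum_list_nonneg)
    obtain M :: nat where M': "real M \<ge> 1 + 2 * K * D * 8 / \<epsilon>" using real_arch_simple by blast
    have M0: "real M > 0" using M' K D0 \<epsilon> by (smt (verit) divide_nonneg_pos mult_nonneg_nonneg)
    have M: "2 * K * D / real M \<le> \<epsilon> / 8"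
    proof -
      have "2 * K * D * 8 / \<epsilon> \<le> real M" using M' by linarith
      then show ?thesis using M0 \<epsilon> by (simp add: field_simps)
    qed
    \<comment> \<open>The equivariance obtained by this inner average holds on the whole ball of
      radius \<open>D\<close>, and therefore survives the outer average.\<close>
    define r1 where "r1 = avgs M (map j vs) r"
    define \<phi> where "\<phi> = avgs M2 gs r1"
    have lip1: "norm (r1 y - r1 y') \<le> K * norm (y - y')" for y y'
      unfolding r1_def using M0 lip by (intro avgs_lipschitz) auto
    have lip2: "norm (\<phi> y - \<phi> y') \<le> K * norm (y - y')" for y y'
      unfolding \<phi>_def using M20 lip1 by (intro avgs_lipschitz) auto
    have equi1: "norm (r1 (y + j e) - r1 y - e) \<le> \<epsilon> / 8" if e: "e \<in> E" and y: "norm y \<le> D" for e y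
    proof -
      \<comment> \<open>Points within \<open>D\<close> of the image of \<open>j\<close> stay so
        under translation by \<open>j e\<close>; near the image \<open>r\<close> differs by at most
        K * D from its exactly equivariant values there.\<close>
      have "norm (avgs M (map j vs) (\<lambda>y. r (y + j e) - r y) y - e) \<le> (2 * K * D) / real M"
      proof (rule avgs_telescope[where P="{y. \<exists>x. norm (y - j x) \<le> D}"])
        fix y assume "y \<in> {y. \<exists>x. norm (y - j x) \<le> D}"
        then obtain x where x: "norm (y - j x) \<le> D" by auto
        have 1: "norm (r (y + real M *\<^sub>R j e) - (x + real M *\<^sub>R e)) \<le> K * D"
        proof -
          have "r (j x + real M *\<^sub>R j e) = x + real M *\<^sub>R e" by (simp add: jadd jscale rj)
          then have "norm (r (y + real M *\<^sub>R j e) - (x + real M *\<^sub>R e)) \<le> K * norm (y - j x)"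
            using lip[of "y + real M *\<^sub>R j e" "j x + real M *\<^sub>R j e"] by simp
          then show ?thesis using mult_left_mono[OF x K] by linarith
        qed
        have 2: "norm (r y - x) \<le> K * D"
          using lip[of y "j x"] mult_left_mono[OF x K] by (simp add: rj)
        have eq: "r (y + real M *\<^sub>R j e) - r y - real M *\<^sub>R e = (r (y + real M *\<^sub>R j e) - (x + real M *\<^sub>R e)) - (r y - x)"
          by simp
        show "norm (r (y + real M *\<^sub>R j e) - r y - real M *\<^sub>R e) \<le> 2 * K * D"
          unfolding eq using norm_triangle_ineq4[of "r (y + real M *\<^sub>R j e) - (x + real M *\<^sub>R e)" "r y - x"] 1 2 by linarith
      next
        fix y h and k :: nat assume y: "y \<in> {y. \<exists>x. norm (y - j x) \<le> D}" and h: "h \<in> set (map j vs)"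
        then obtain x v where "norm (y - j x) \<le> D" "h = j v" by auto
        then have "norm (y + real k *\<^sub>R h - j (x + real k *\<^sub>R v)) \<le> D" by (simp flip: jadd jscale)
        then show "y + real k *\<^sub>R h \<in> {y. \<exists>x. norm (y - j x) \<le> D}" by blast
      next
        have "j 0 = 0" using jscale[of 0 0] by simp
        then show "y \<in> {y. \<exists>x. norm (y - j x) \<le> D}" using y by (auto intro!: exI[of _ 0])
      qed (use M0 e vs in auto)
      then show ?thesis using M by (simp add: r1_def avgs_diff)
    qed
    have equi: "norm (\<phi> (y + j e) - \<phi> y - e) \<le> \<epsilon> / 8" if e: "e \<in> E" and y: "norm y \<le> Q" for e y
    proof -
      have "norm (avgs M2 gs (\<lambda>y. r1 (y + j e) - r1 y) y - e) \<le> \<epsilon> / 8"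
        by (rule avgs_norm_ball[where D=Q]) (use M20 y equi1[OF e] in \<open>auto simp: D_def\<close>)
      then show ?thesis by (simp add: \<phi>_def avgs_diff)
    qed
    define w where "w i = \<phi> (g i) - \<phi> 0" for i
    \<comment> \<open>The second difference is used with \<open>g i\<close> as the averaged
      direction and the base point \<open>s\<close> as the other increment.\<close>
    have step: "norm (\<phi> (s + g i) - \<phi> s - w i) \<le> \<theta>" if "norm s \<le> Q" "i \<in> I" for s i
    proof -
      have "norm (\<phi> (0 + g i + s) - \<phi> (0 + g i) - (\<phi> (0 + s) - \<phi> 0)) \<le> 2 * K * norm s / real M2"
        unfolding \<phi>_def using M20 lip1 gs that(2) by (intro avgs_second_difference) auto
      also have "\<dots> \<le> \<theta>" unfolding \<theta>_def using that(1) K M20 by (intro divide_right_mono mult_left_mono) auto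
      also have "\<phi> (0 + g i + s) - \<phi> (0 + g i) - (\<phi> (0 + s) - \<phi> 0) = \<phi> (s + g i) - \<phi> s - w i"
        by (simp add: w_def algebra_simps)
      finally show ?thesis .
    qed
    have path: "norm (\<phi> (\<Sum>i\<in>I. real (q i) *\<^sub>R g i) - \<phi> 0 - (\<Sum>i\<in>I. real (q i) *\<^sub>R w i)) \<le> Q * \<theta>"
      "norm (\<Sum>i\<in>I. real (q i) *\<^sub>R g i) \<le> Q"
      if q: "real (\<Sum>i\<in>I. q i) \<le> Q" for q :: "nat \<Rightarrow> nat"
    proof -
      have le: "(\<Sum>i\<in>I. real (q i) * norm (g i)) \<le> Q"
      proof -
        have "(\<Sum>i\<in>I. real (q i) * norm (g i)) \<le> (\<Sum>i\<in>I. real (q i) * 1)"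
          using gn by (intro sum_mono mult_left_mono) auto
        with q show ?thesis by simp
      qed
      have "norm (\<phi> (\<Sum>i\<in>I. real (q i) *\<^sub>R g i) - \<phi> 0 - (\<Sum>i\<in>I. real (q i) *\<^sub>R w i)) \<le> real (\<Sum>i\<in>I. q i) * \<theta>"
        by (rule lattice_path[OF finI step le])
      also have "\<dots> \<le> Q * \<theta>" by (rule mult_right_mono[OF q \<theta>0])
      finally show "norm (\<phi> (\<Sum>i\<in>I. real (q i) *\<^sub>R g i) - \<phi> 0 - (\<Sum>i\<in>I. real (q i) *\<^sub>R w i)) \<le> Q * \<theta>" .
      show "norm (\<Sum>i\<in>I. real (q i) *\<^sub>R g i) \<le> Q"
        by (rule order_trans[OF norm_sum]) (use le in simp)
    qed
    \<comment> \<open>The indicators have disjoint supports, so a sum of distinct \<open>g i\<close>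
      has norm at most 1/N and moves \<open>\<phi>\<close> by at most K / N; multiplying by
      \<open>N\<close> restores a bound free of \<open>N\<close>.\<close>
    have subset_bound: "norm (\<Sum>i\<in>J. real N *\<^sub>R w i) \<le> K + 1" if J: "J \<subseteq> I" for J
    proof -
      define q :: "nat \<Rightarrow> nat" where "q i = (if i \<in> J then 1 else 0)" for i
      have s: "(\<Sum>i\<in>I. real (q i) *\<^sub>R v i) = (\<Sum>i\<in>J. v i)" for v :: "nat \<Rightarrow> 'c::real_vector"
        using J finI by (simp add: q_def if_distrib[of real] if_distrib[of "\<lambda>c. c *\<^sub>R _"] sum.If_cases Int_absorb1 cong: if_cong)
      have "real (\<Sum>i\<in>I. q i) \<le> real (card I)"
        using finI by (simp add: q_def sum.If_cases card_mono Int_lower1)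
      then have qQ: "real (\<Sum>i\<in>I. q i) \<le> Q" using QI by linarith
      define y where "y = (\<Sum>i\<in>I. real (q i) *\<^sub>R g i)"
      have "norm y \<le> 1 / real N" unfolding y_def
        by (rule norm_bound) (use N0 in \<open>auto simp: gsum q_def\<close>)
      then have "norm (\<phi> y - \<phi> 0) \<le> K / real N"
        using lip2[of y 0] mult_left_mono[of "norm y" "1 / real N" K] K by simp
      moreover have "norm (\<phi> y - \<phi> 0 - (\<Sum>i\<in>J. w i)) \<le> Q * \<theta>"
        using path(1)[OF qQ] by (simp only: y_def s)
      ultimately have "norm (\<Sum>i\<in>J. w i) \<le> K / real N + Q * \<theta>"
        using norm_triangle_ineq4[of "\<phi> y - \<phi> 0" "\<phi> y - \<phi> 0 - (\<Sum>i\<in>J. w i)"] by simp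
      then have "real N * norm (\<Sum>i\<in>J. w i) \<le> real N * (K / real N + Q * \<theta>)"
        using N0 by (intro mult_left_mono) auto
      also have "\<dots> = K + real N * Q * \<theta>" using N0 by (simp add: algebra_simps)
      finally show ?thesis using NQ1 by (simp flip: scaleR_sum_right)
    qed
    define b where "b i = real N *\<^sub>R w i" for i
    define T where "T = (\<Sum>i\<in>I. rank_one (f i) (b i))"
    have F: "fac (2 * (K + 1)) I f b T"
      unfolding T_def
    proof (rule facI[OF finI])
      show "norm (f i) \<le> 2 * (K + 1)" for i using f[of i] K by simp
      fix t :: "nat \<Rightarrow> real" assume t: "\<And>i. i \<in> I \<Longrightarrow> \<bar>t i\<bar> \<le> 1"
      show "norm (\<Sum>i\<in>I. t i *\<^sub>R b i) \<le> 2 * (K + 1)"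
      proof (rule norm_sum_scaleR_le_of_signs[OF finI _ t])
        fix e :: "nat \<Rightarrow> real" assume e: "\<And>i. i \<in> I \<Longrightarrow> e i = 1 \<or> e i = -1"
        \<comment> \<open>Splitting by sign uses the subset bound twice, which gives the factor
          2.\<close>
        define J where "J = {i\<in>I. e i = 1}"
        have "(\<Sum>i\<in>I. e i *\<^sub>R b i) = (\<Sum>i\<in>J. e i *\<^sub>R b i) + (\<Sum>i\<in>I-J. e i *\<^sub>R b i)"
          using finI by (simp add: J_def sum.subset_diff[of "{i\<in>I. e i = 1}" I] add.commute)
        also have "(\<Sum>i\<in>J. e i *\<^sub>R b i) = (\<Sum>i\<in>J. b i)" by (rule sum.cong) (auto simp: J_def)
        also have "(\<Sum>i\<in>I-J. e i *\<^sub>R b i) = (\<Sum>i\<in>I-J. - b i)"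
          by (rule sum.cong) (use e in \<open>force simp: J_def\<close>)+
        finally have eq: "(\<Sum>i\<in>I. e i *\<^sub>R b i) = (\<Sum>i\<in>J. b i) - (\<Sum>i\<in>I-J. b i)"
          by (simp add: sum_negf)
        have 12: "norm (\<Sum>i\<in>J. b i) \<le> K + 1" "norm (\<Sum>i\<in>I-J. b i) \<le> K + 1"
          unfolding b_def by (rule subset_bound, auto simp: J_def)+
        show "norm (\<Sum>i\<in>I. e i *\<^sub>R b i) \<le> 2 * (K + 1)"
          unfolding eq using norm_triangle_le_diff[OF add_mono[OF 12]] by simp
      qed
    qed
    have "norm (blinfun_apply T e - e) \<le> \<epsilon>" if e: "e \<in> E" for e
    proof -
      have 1: "norm (blinfun_apply T e - (\<Sum>i\<in>I. real_of_int (p e i) *\<^sub>R w i)) \<le> 2 * (K + 1) / real N"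
      proof -
        have "blinfun_apply T e - (\<Sum>i\<in>I. real_of_int (p e i) *\<^sub>R w i)
          = (\<Sum>i\<in>I. (blinfun_apply (f i) e - real_of_int (p e i) / real N) *\<^sub>R b i)"
          unfolding facD(4)[OF F] using N0 by (simp add: b_def sum_subtractf algebra_simps)
        also have "norm \<dots> \<le> 2 * (K + 1) * (1 / real N)"
        proof (rule fac_sum_bound[OF F])
          fix i
          have "\<bar>real N * blinfun_apply (f i) e - real_of_int (p e i)\<bar> \<le> 1"
            unfolding p_def by linarith
          moreover have "blinfun_apply (f i) e - real_of_int (p e i) / real N
            = (real N * blinfun_apply (f i) e - real_of_int (p e i)) / real N"
            using N0 by (simp add: field_simps)
          ultimately show "\<bar>blinfun_apply (f i) e - real_of_int (p e i) / real N\<bar> \<le> 1 / real N"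
            using N0 by (simp add: divide_right_mono)
        qed (use N0 in simp)
        finally show ?thesis by simp
      qed
      \<comment> \<open>Lattice paths need nonnegative multiplicities; the positive and negative
        parts of \<open>p e\<close> give two paths from 0.\<close>
      define qp where "qp i = nat (p e i)" for i
      define qm where "qm i = nat (- p e i)" for i
      have pq: "real_of_int (p e i) = real (qp i) - real (qm i)" for i by (simp add: qp_def qm_def)
      have qQ: "real (\<Sum>i\<in>I. qp i) \<le> Q" "real (\<Sum>i\<in>I. qm i) \<le> Q"
        by (rule order_trans[OF _ Qp[OF e]], simp add: qp_def qm_def, rule sum_mono, simp)+
      define sp where "sp = (\<Sum>i\<in>I. real (qp i) *\<^sub>R g i)"
      define sm where "sm = (\<Sum>i\<in>I. real (qm i) *\<^sub>R g i)"
      have 2: "norm (\<phi> sp - \<phi> sm - (\<Sum>i\<in>I. real_of_int (p e i) *\<^sub>R w i)) \<le> 2 * (Q * \<theta>)"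
      proof -
        have "\<phi> sp - \<phi> sm - (\<Sum>i\<in>I. real_of_int (p e i) *\<^sub>R w i)
          = (\<phi> sp - \<phi> 0 - (\<Sum>i\<in>I. real (qp i) *\<^sub>R w i)) - (\<phi> sm - \<phi> 0 - (\<Sum>i\<in>I. real (qm i) *\<^sub>R w i))"
          by (simp add: pq sum_subtractf algebra_simps)
        also have "norm \<dots> \<le> Q * \<theta> + Q * \<theta>"
          unfolding sp_def sm_def by (intro norm_triangle_le_diff add_mono path(1) qQ)
        finally show ?thesis by simp
      qed
      have "norm (sp - (sm + j e)) \<le> 1 / real N"
      proof (rule norm_bound)
        fix n
        have "apply_bcontfun sp n - apply_bcontfun sm n = real_of_int (p e (rep n)) / real N"
          by (simp add: sp_def sm_def gsum pq diff_divide_distrib)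
        then have "apply_bcontfun (sp - (sm + j e)) n = (real_of_int (p e n) - real N * blinfun_apply (f n) e) / real N"
          using N0 by (simp add: prep[OF e] j diff_divide_distrib)
        moreover have "\<bar>real_of_int (p e n) - real N * blinfun_apply (f n) e\<bar> \<le> 1"
          unfolding p_def by linarith
        ultimately show "norm (apply_bcontfun (sp - (sm + j e)) n) \<le> 1 / real N"
          using N0 by (simp add: divide_right_mono)
      qed
      then have 3: "norm (\<phi> sp - \<phi> (sm + j e)) \<le> K / real N"
        using lip2[of sp "sm + j e"] mult_left_mono[of "norm (sp - (sm + j e))" "1 / real N" K] K by simp
      have 4: "norm (\<phi> (sm + j e) - \<phi> sm - e) \<le> \<epsilon> / 8"
        by (rule equi[OF e]) (use path(2)[OF qQ(2)] in \<open>simp add: sm_def\<close>)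
      \<comment> \<open>\<open>T e\<close> is compared in turn with the integer combination of the
        \<open>w i\<close>, the increment of \<open>\<phi>\<close> from \<open>sm\<close> to
        \<open>sp\<close>, the one from \<open>sm\<close> to \<open>sm + j e\<close>, and
        \<open>e\<close>.\<close>
      have "blinfun_apply T e - e = (blinfun_apply T e - (\<Sum>i\<in>I. real_of_int (p e i) *\<^sub>R w i))
         - (\<phi> sp - \<phi> sm - (\<Sum>i\<in>I. real_of_int (p e i) *\<^sub>R w i)) + (\<phi> sp - \<phi> (sm + j e)) + (\<phi> (sm + j e) - \<phi> sm - e)"
        by simp
      also have "norm \<dots> \<le> 2 * (K + 1) / real N + 2 * (Q * \<theta>) + K / real N + \<epsilon> / 8"
        by (intro norm_triangle_mono[OF _ 4] norm_triangle_mono[OF _ 3] norm_triangle_le_diff add_mono 1 2)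
      also have "\<dots> = (3 * K + 2) / real N + 2 * (Q * \<theta>) + \<epsilon> / 8"
        by (simp add: add_divide_distrib[symmetric] algebra_simps)
      also have "\<dots> \<le> \<epsilon>" using N QT \<epsilon> by linarith
      finally show ?thesis .
    qed
    with F show ?thesis by blast
  qed
  show ?thesis by (rule that[OF _ main]) (use K in auto)
qed

end

text \<open>Grouping the indices by the direction of the vector of values of the functionals makes the
  number of terms depend on the functionals only.\<close>

lemma fac_group:
  fixes F :: "('a::real_normed_vector \<Rightarrow>\<^sub>L real) set"
  assumes F: "finite F" and \<epsilon>: "0 < \<epsilon>" and K: "0 \<le> K"
  obtains M :: nat where "\<And>I a b T. fac K I a b (T :: 'a \<Rightarrow>\<^sub>L 'a) \<Longrightarrow>
    \<exists>a' b' T'. fac K {..<M} a' b' T' \<and> (\<forall>f\<in>F. norm ((f o\<^sub>L T') - (f o\<^sub>L T)) \<le> \<epsilon>)"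
proof -
  define C where "C = (\<Sum>f\<in>F. norm f * K)"
  have C0: "0 \<le> C" unfolding C_def using K by (intro sum_nonneg) auto
  obtain R :: nat where R': "real R \<ge> 1 + 2 * K * C / \<epsilon>" using real_arch_simple by blast
  have R0: "real R > 0" using R' K C0 \<epsilon> by (smt (verit) divide_nonneg_pos mult_nonneg_nonneg)
  have "2 * K * C / \<epsilon> \<le> real R" using R' by linarith
  then have RC: "2 * K * C / real R \<le> \<epsilon>" using R0 \<epsilon> by (simp add: field_simps)
  \<comment> \<open>The number of quantised directions depends on \<open>F\<close> and
    \<open>R\<close> only, not on the factorisation to be grouped.\<close>
  define \<K> where "\<K> = (\<Pi>\<^sub>E f\<in>F. {- int R..int R})"
  have fin\<K>: "finite \<K>" unfolding \<K>_def by (auto intro: finite_PiE F)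
  obtain enc where enc: "bij_betw enc \<K> {..<card \<K>}"
    using ex_bij_betw_finite_nat[OF fin\<K>] by (auto simp: atLeast0LessThan)
  have Rq: "- int R \<le> \<lfloor>real R * q\<rfloor> \<and> \<lfloor>real R * q\<rfloor> \<le> int R" if "\<bar>q\<bar> \<le> 1" for q
  proof -
    have "\<bar>real R * q\<bar> \<le> real R" using mult_left_mono[OF that, of "real R"] by (simp add: abs_mult)
    then show ?thesis by (simp add: abs_le_iff le_floor_iff floor_le_iff)
  qed
  have main: "\<exists>a' b' T'. fac K {..<card \<K>} a' b' T' \<and> (\<forall>f\<in>F. norm ((f o\<^sub>L T') - (f o\<^sub>L T)) \<le> \<epsilon>)"
    if fac: "fac K I a b T" for I a b and T :: "'a \<Rightarrow>\<^sub>L 'a"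
  proof -
    have finI: "finite I" by (rule facD(1)[OF fac])
    define w where "w i = (\<Sum>f\<in>F. \<bar>blinfun_apply f (b i)\<bar>)" for i
    have w0: "0 \<le> w i" for i unfolding w_def by (intro sum_nonneg) auto
    have fw: "\<bar>blinfun_apply f (b i)\<bar> \<le> w i" if "f \<in> F" for f i
      unfolding w_def using F that by (intro member_le_sum) auto
    define key where "key i = (\<lambda>f\<in>F. \<lfloor>real R * (blinfun_apply f (b i) / w i)\<rfloor>)" for i
    have key: "key i \<in> \<K>" for i
      unfolding \<K>_def
    proof (rule PiE_I)
      fix f assume f: "f \<in> F"
      have "\<bar>blinfun_apply f (b i) / w i\<bar> \<le> 1"
        using fw[OF f, of i] w0[of i] by (cases "w i = 0") (auto simp: divide_le_eq_1)
      from Rq[OF this] show "key i f \<in> {- int R..int R}" using f by (simp add: key_def)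
    qed (simp add: key_def)
    define \<kappa> where "\<kappa> i = enc (key i)" for i
    have \<kappa>: "\<kappa> ` I \<subseteq> {..<card \<K>}" using key enc by (auto simp: \<kappa>_def bij_betw_def)
    have \<kappa>key: "key i = key i'" if "\<kappa> i = \<kappa> i'" for i i'
      using that key enc by (auto simp: \<kappa>_def bij_betw_def inj_on_def)
    define G where "G k = {i\<in>I. \<kappa> i = k}" for k
    have finG: "finite (G k)" for k using finI by (simp add: G_def)
    have group: "(\<Sum>k<card \<K>. \<Sum>i\<in>G k. h i) = (\<Sum>i\<in>I. h i)" for h :: "nat \<Rightarrow> 'c::comm_monoid_add"
      unfolding G_def by (rule sum.group[OF finI _ \<kappa>]) simp
    define W where "W k = (\<Sum>i\<in>G k. w i)" for k
    have W0: "0 \<le> W k" for k unfolding W_def by (intro sum_nonneg w0)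
    \<comment> \<open>With the mean weighted by \<open>w i\<close>, replacing each
      \<open>a i\<close> by \<open>a' k\<close> is exact on the common rounded direction of the
      group; only the rounding errors contribute.\<close>
    define a' where "a' k = (1 / W k) *\<^sub>R (\<Sum>i\<in>G k. w i *\<^sub>R a i)" for k
    define b' where "b' k = (\<Sum>i\<in>G k. b i)" for k
    have a': "norm (a' k) \<le> K" for k
    proof -
      have "norm (\<Sum>i\<in>G k. w i *\<^sub>R a i) \<le> (\<Sum>i\<in>G k. w i * K)"
        by (rule sum_norm_le) (use facD(2)[OF fac] w0 in \<open>auto simp: G_def intro!: mult_left_mono\<close>)
      also have "\<dots> = W k * K" by (simp add: W_def sum_distrib_right)
      finally show ?thesis using W0[of k] K by (cases "W k = 0") (auto simp: a'_def field_simps)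
    qed
    define T' where "T' = (\<Sum>k\<in>{..<card \<K>}. rank_one (a' k) (b' k))"
    have F': "fac K {..<card \<K>} a' b' T'"
      unfolding T'_def
    proof (rule facI)
      fix t :: "nat \<Rightarrow> real" assume t: "\<And>i. i \<in> {..<card \<K>} \<Longrightarrow> \<bar>t i\<bar> \<le> 1"
      have "(\<Sum>k<card \<K>. t k *\<^sub>R b' k) = (\<Sum>k<card \<K>. \<Sum>i\<in>G k. t (\<kappa> i) *\<^sub>R b i)"
        by (simp add: b'_def scaleR_sum_right G_def)
      also have "norm \<dots> \<le> K" unfolding group using t \<kappa> by (intro facD(3)[OF fac]) auto
      finally show "norm (\<Sum>k<card \<K>. t k *\<^sub>R b' k) \<le> K" .
    qed (auto simp: a')
    have "norm ((f o\<^sub>L T') - (f o\<^sub>L T)) \<le> \<epsilon>" if f: "f \<in> F" for f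
    proof (rule norm_blinfun_bound)
      fix x
      have ax: "\<bar>blinfun_apply (a i) x\<bar> \<le> K * norm x" if "i \<in> I" for i
        using norm_blinfun[of "a i" x] mult_right_mono[OF facD(2)[OF fac that] norm_ge_zero[of x]] by simp
      have ax': "\<bar>blinfun_apply (a' k) x\<bar> \<le> K * norm x" for k
        using norm_blinfun[of "a' k" x] mult_right_mono[OF a'[of k] norm_ge_zero[of x]] by simp
      have part: "\<bar>blinfun_apply (a' k) x * blinfun_apply f (b' k) - (\<Sum>i\<in>G k. blinfun_apply (a i) x * blinfun_apply f (b i))\<bar>
          \<le> (\<Sum>i\<in>G k. w i * (2 * K * norm x / real R))" for k
      proof (cases "G k = {}")
        case True
        then show ?thesis by (simp add: b'_def)
      next
        case False
        then obtain i0 where i0: "i0 \<in> G k" by auto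
        define \<theta> where "\<theta> = real_of_int (key i0 f) / real R"
        define s where "s i = blinfun_apply f (b i) - w i * \<theta>" for i
        have s: "\<bar>s i\<bar> \<le> w i / real R" if "i \<in> G k" for i
        proof (cases "w i = 0")
          case True
          then show ?thesis using fw[OF f, of i] by (simp add: s_def)
        next
          case False
          with w0[of i] have wi: "w i > 0" by simp
          have "key i0 = key i" using that i0 by (intro \<kappa>key) (simp add: G_def)
          then have k: "key i0 f = \<lfloor>real R * (blinfun_apply f (b i) / w i)\<rfloor>" using f by (simp add: key_def)
          have 1: "\<bar>real R * (blinfun_apply f (b i) / w i) - real_of_int (key i0 f)\<bar> \<le> 1" unfolding k by linarith
          have "s i = (real R * (blinfun_apply f (b i) / w i) - real_of_int (key i0 f)) * (w i / real R)"
            using R0 wi by (simp add: s_def \<theta>_def field_simps)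
          then have "\<bar>s i\<bar> = \<bar>real R * (blinfun_apply f (b i) / w i) - real_of_int (key i0 f)\<bar> * (w i / real R)"
            using wi R0 by (simp add: abs_mult)
          also have "\<dots> \<le> 1 * (w i / real R)" using wi R0 by (intro mult_right_mono 1) simp
          finally show ?thesis by simp
        qed
        have Wa: "W k * blinfun_apply (a' k) x = (\<Sum>i\<in>G k. w i * blinfun_apply (a i) x)"
        proof (cases "W k = 0")
          case True
          then have "\<forall>i\<in>G k. w i = 0" unfolding W_def using finG w0 by (subst (asm) sum_nonneg_eq_0_iff) auto
          with True show ?thesis by simp
        next
          case False
          then show ?thesis by (simp add: a'_def blinfun.scaleR_left blinfun_sum_apply)
        qed
        have fb: "blinfun_apply f (b i) = w i * \<theta> + s i" for i by (simp add: s_def)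
        have "blinfun_apply (a' k) x * blinfun_apply f (b' k) - (\<Sum>i\<in>G k. blinfun_apply (a i) x * blinfun_apply f (b i))
          = blinfun_apply (a' k) x * (\<Sum>i\<in>G k. blinfun_apply f (b i)) - (\<Sum>i\<in>G k. blinfun_apply (a i) x * blinfun_apply f (b i))"
          by (simp add: b'_def blinfun.sum_right)
        also have "\<dots> = \<theta> * (W k * blinfun_apply (a' k) x) - \<theta> * (\<Sum>i\<in>G k. w i * blinfun_apply (a i) x)
            + (\<Sum>i\<in>G k. s i * (blinfun_apply (a' k) x - blinfun_apply (a i) x))"
          unfolding fb by (simp add: W_def sum.distrib sum_distrib_left sum_distrib_right sum_subtractf algebra_simps)
        also have "\<dots> = (\<Sum>i\<in>G k. s i * (blinfun_apply (a' k) x - blinfun_apply (a i) x))" by (simp add: Wa)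
        also have "\<bar>\<dots>\<bar> \<le> (\<Sum>i\<in>G k. w i * (2 * K * norm x / real R))"
        proof (rule order_trans[OF sum_abs sum_mono])
          fix i assume i: "i \<in> G k"
          have "\<bar>blinfun_apply (a' k) x - blinfun_apply (a i) x\<bar> \<le> 2 * K * norm x"
            using ax'[of k] ax[of i] i by (simp add: G_def)
          then have "\<bar>s i * (blinfun_apply (a' k) x - blinfun_apply (a i) x)\<bar> \<le> (w i / real R) * (2 * K * norm x)"
            unfolding abs_mult using s[OF i] w0[of i] R0 by (intro mult_mono) auto
          then show "\<bar>s i * (blinfun_apply (a' k) x - blinfun_apply (a i) x)\<bar> \<le> w i * (2 * K * norm x / real R)" by simp
        qed
        finally show ?thesis .
      qed
      \<comment> \<open>With the signs of f (b i) as coefficients, the sum of absolute values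
        becomes one value of f on an admissible combination of the \<open>b i\<close>.\<close>
      have wC: "(\<Sum>i\<in>I. w i) \<le> C"
      proof -
        have "(\<Sum>i\<in>I. w i) = (\<Sum>f\<in>F. \<Sum>i\<in>I. \<bar>blinfun_apply f (b i)\<bar>)"
          unfolding w_def by (rule sum.swap)
        also have "\<dots> \<le> C" unfolding C_def
        proof (rule sum_mono)
          fix f assume "f \<in> F"
          have "(\<Sum>i\<in>I. \<bar>blinfun_apply f (b i)\<bar>) = blinfun_apply f (\<Sum>i\<in>I. sgn (blinfun_apply f (b i)) *\<^sub>R b i)"
            by (simp add: blinfun.sum_right blinfun.scaleR_right abs_sgn mult.commute)
          also have "\<dots> \<le> norm f * norm (\<Sum>i\<in>I. sgn (blinfun_apply f (b i)) *\<^sub>R b i)"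
            using norm_blinfun[of f "\<Sum>i\<in>I. sgn (blinfun_apply f (b i)) *\<^sub>R b i"] by simp
          also have "\<dots> \<le> norm f * K"
            by (intro mult_left_mono facD(3)[OF fac]) (auto simp: abs_sgn_eq)
          finally show "(\<Sum>i\<in>I. \<bar>blinfun_apply f (b i)\<bar>) \<le> norm f * K" .
        qed
        finally show ?thesis .
      qed
      have "blinfun_apply ((f o\<^sub>L T') - (f o\<^sub>L T)) x = (\<Sum>k<card \<K>. blinfun_apply (a' k) x * blinfun_apply f (b' k))
          - (\<Sum>i\<in>I. blinfun_apply (a i) x * blinfun_apply f (b i))"
        by (simp add: blinfun.diff_left facD(4)[OF F'] facD(4)[OF fac] blinfun.sum_right blinfun.scaleR_right)
      also have "\<dots> = (\<Sum>k<card \<K>. blinfun_apply (a' k) x * blinfun_apply f (b' k) - (\<Sum>i\<in>G k. blinfun_apply (a i) x * blinfun_apply f (b i)))"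
        by (simp add: sum_subtractf group)
      finally have "\<bar>blinfun_apply ((f o\<^sub>L T') - (f o\<^sub>L T)) x\<bar> \<le> (\<Sum>k<card \<K>. \<Sum>i\<in>G k. w i * (2 * K * norm x / real R))"
        by (simp only:) (rule order_trans[OF sum_abs sum_mono[OF part]])
      also have "\<dots> = (\<Sum>i\<in>I. w i) * (2 * K * norm x / real R)" by (simp only: group sum_distrib_right)
      also have "\<dots> \<le> C * (2 * K * norm x / real R)"
        using wC K R0 by (intro mult_right_mono) auto
      also have "\<dots> = (2 * K * C / real R) * norm x" by simp
      also have "\<dots> \<le> \<epsilon> * norm x" using RC by (intro mult_right_mono) auto
      finally show "norm (blinfun_apply ((f o\<^sub>L T') - (f o\<^sub>L T)) x) \<le> \<epsilon> * norm x" by simp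
    qed (use \<epsilon> in simp)
    with F' show ?thesis by blast
  qed
  show ?thesis by (rule that[OF main])
qed

section \<open>Pointwise limits of bounded operators and functionals\<close>

lemma tendsto_identity_of_dense:
  fixes T :: "nat \<Rightarrow> 'a::real_normed_vector \<Rightarrow>\<^sub>L 'a" and d :: "nat \<Rightarrow> 'a"
  assumes dense: "\<And>x e. e > 0 \<Longrightarrow> \<exists>n. norm (d n - x) < e"
    and bnd: "\<And>n. norm (T n) \<le> C"
    and conv: "\<And>m. (\<lambda>n. blinfun_apply (T n) (d m) - d m) \<longlonglongrightarrow> 0"
  shows "(\<lambda>n. blinfun_apply (T n) x) \<longlonglongrightarrow> x"
proof (rule LIMSEQ_I)
  fix e :: real assume e: "e > 0"
  have C1: "0 < C + 1" using bnd[of 0] norm_ge_zero[of "T 0"] by linarith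
  define e' where "e' = e / 2 / (C + 1)"
  have e': "e' > 0" "(C + 1) * e' = e / 2" using e C1 by (auto simp: e'_def field_simps)
  obtain m where m: "norm (d m - x) < e'" using dense[OF e'(1)] by blast
  obtain N where N: "\<And>n. n \<ge> N \<Longrightarrow> norm (blinfun_apply (T n) (d m) - d m) < e / 2"
    using LIMSEQ_D[OF conv[of m], of "e / 2"] e by auto
  have "norm (blinfun_apply (T n) x - x) < e" if n: "n \<ge> N" for n
  proof -
    have "norm (blinfun_apply (T n) (x - d m)) \<le> C * norm (x - d m)"
      using norm_blinfun[of "T n" "x - d m"] mult_right_mono[OF bnd[of n] norm_ge_zero[of "x - d m"]] by linarith
    then have "norm (blinfun_apply (T n) (x - d m) + (blinfun_apply (T n) (d m) - d m) + (d m - x))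
        \<le> C * norm (x - d m) + norm (blinfun_apply (T n) (d m) - d m) + norm (d m - x)"
      by (intro norm_triangle_mono) auto
    moreover have "blinfun_apply (T n) x - x = blinfun_apply (T n) (x - d m) + (blinfun_apply (T n) (d m) - d m) + (d m - x)"
      by (simp add: blinfun.diff_right)
    ultimately have "norm (blinfun_apply (T n) x - x) \<le> C * norm (x - d m) + norm (blinfun_apply (T n) (d m) - d m) + norm (d m - x)"
      by (simp only:)
    also have "\<dots> = (C + 1) * norm (d m - x) + norm (blinfun_apply (T n) (d m) - d m)"
      by (simp add: norm_minus_commute algebra_simps)
    also have "\<dots> < (C + 1) * e' + e / 2"
      using m C1 N[OF n] by (intro add_strict_mono mult_strict_left_mono)
    finally show ?thesis using e'(2) by simp
  qed
  then show "\<exists>no. \<forall>n\<ge>no. norm (blinfun_apply (T n) x - x) < e" by blast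
qed

lemma dense_pointwise_limit:
  fixes \<phi> :: "nat \<Rightarrow> 'a::real_normed_vector \<Rightarrow>\<^sub>L real" and d :: "nat \<Rightarrow> 'a"
  assumes dense: "\<And>x e. e > 0 \<Longrightarrow> \<exists>n. norm (d n - x) < e"
    and bnd: "\<And>n. norm (\<phi> n) \<le> K"
    and conv: "\<And>m. convergent (\<lambda>n. blinfun_apply (\<phi> n) (d m))"
  obtains \<psi> :: "'a \<Rightarrow>\<^sub>L real" where "norm \<psi> \<le> K" "\<And>x. (\<lambda>n. blinfun_apply (\<phi> n) x) \<longlonglongrightarrow> blinfun_apply \<psi> x"
proof -
  have K0: "0 \<le> K" using bnd[of 0] norm_ge_zero order_trans by blast
  have b: "\<bar>blinfun_apply (\<phi> n) x\<bar> \<le> K * norm x" for n x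
    using norm_blinfun[of "\<phi> n" x] mult_right_mono[OF bnd[of n] norm_ge_zero[of x]] by simp
  have "Cauchy (\<lambda>n. blinfun_apply (\<phi> n) x)" for x
  proof (rule CauchyI)
    fix e :: real assume e: "e > 0"
    define e' where "e' = e / (4 * (K + 1))"
    have e': "e' > 0" "K * e' \<le> e / 4" using e K0 by (auto simp: e'_def field_simps)
    obtain m where m: "norm (d m - x) < e'" using dense[OF e'(1)] by blast
    obtain N where N: "\<And>n n'. n \<ge> N \<Longrightarrow> n' \<ge> N \<Longrightarrow> \<bar>blinfun_apply (\<phi> n) (d m) - blinfun_apply (\<phi> n') (d m)\<bar> < e / 4"
      using CauchyD[OF convergent_Cauchy[OF conv[of m]], of "e / 4"] e by auto
    have c: "\<bar>blinfun_apply (\<phi> n) (d m) - blinfun_apply (\<phi> n) x\<bar> \<le> e / 4" for n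
    proof -
      have "\<bar>blinfun_apply (\<phi> n) (d m - x)\<bar> \<le> K * norm (d m - x)" by (rule b)
      also have "\<dots> \<le> K * e'" using m K0 by (intro mult_left_mono) auto
      finally show ?thesis using e'(2) by (simp add: blinfun.diff_right)
    qed
    have "\<bar>blinfun_apply (\<phi> n) x - blinfun_apply (\<phi> n') x\<bar> < e" if "n \<ge> N" "n' \<ge> N" for n n'
      using c[of n] c[of n'] N[OF that] by linarith
    then show "\<exists>M. \<forall>m\<ge>M. \<forall>n\<ge>M. norm (blinfun_apply (\<phi> m) x - blinfun_apply (\<phi> n) x) < e" by auto
  qed
  then have "\<exists>l. (\<lambda>n. blinfun_apply (\<phi> n) x) \<longlonglongrightarrow> l" for x
    using Cauchy_convergent by (auto simp: convergent_def)
  then obtain l where l: "\<And>x. (\<lambda>n. blinfun_apply (\<phi> n) x) \<longlonglongrightarrow> l x" by metis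
  have lb: "\<bar>l x\<bar> \<le> norm x * K" for x
    using LIMSEQ_le_const2[OF tendsto_rabs[OF l[of x]], of "norm x * K"] b by (auto simp: mult.commute)
  have bl: "bounded_linear l"
  proof (rule bounded_linear_intro[where K=K])
    show "l (x + y) = l x + l y" for x y
      using tendsto_add[OF l[of x] l[of y]] l[of "x + y"] LIMSEQ_unique by (auto simp: blinfun.add_right)
    show "l (c *\<^sub>R x) = c *\<^sub>R l x" for c x
      using tendsto_scaleR[OF tendsto_const[of c] l[of x]] l[of "c *\<^sub>R x"] LIMSEQ_unique
      by (auto simp: blinfun.scaleR_right)
  qed (use lb in auto)
  show ?thesis
    by (rule that[of "Blinfun l"])
       (use l lb K0 in \<open>auto simp: bounded_linear_Blinfun_apply[OF bl] mult.commute intro!: norm_blinfun_bound\<close>)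
qed

context lip_c0
begin

text \<open>After grouping, all operators have the same number \<open>M\<close> of terms. Along a
  subsequence the functionals converge weak-star and the numbers f (b' k) converge. Pairing the
  limit functionals with the vectors of one late index turns pointwise convergence into smallness in
  norm, since only finitely many scalars remain to be approximated.\<close>

lemma adjoint_approximation:
  obtains K where "1 \<le> K"
    "\<And>(E :: 'a set) \<epsilon>. finite E \<Longrightarrow> 0 < \<epsilon> \<Longrightarrow> \<exists>I a b T. fac K I a b T \<and> (\<forall>e\<in>E. norm (blinfun_apply T e - e) \<le> \<epsilon>)"
    "\<And>(F :: ('a \<Rightarrow>\<^sub>L real) set) \<epsilon>. finite F \<Longrightarrow> 0 < \<epsilon> \<Longrightarrow> \<exists>I a b T. fac K I a b T \<and> (\<forall>f\<in>F. norm ((f o\<^sub>L T) - f) \<le> \<epsilon>)"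
proof -
  obtain K where K: "1 \<le> K"
    and loc: "\<And>(E :: 'a set) \<epsilon>. finite E \<Longrightarrow> 0 < \<epsilon> \<Longrightarrow> \<exists>I a b T. fac K I a b T \<and> (\<forall>e\<in>E. norm (blinfun_apply T e - e) \<le> \<epsilon>)"
    by (rule local_approximation, rule that)
  obtain d :: "nat \<Rightarrow> 'a" where d: "\<And>x e. e > 0 \<Longrightarrow> \<exists>n. norm (d n - x) < e"
    using dense_sequence by blast
  have "\<exists>I a b T. fac K I a b T \<and> (\<forall>e\<in>d ` {..n}. norm (blinfun_apply T e - e) \<le> 1 / real (Suc n))" for n
    by (rule loc) auto
  then obtain I a b and T :: "nat \<Rightarrow> 'a \<Rightarrow>\<^sub>L 'a" where fac: "\<And>n. fac K (I n) (a n) (b n) (T n)"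
    and Td: "\<And>n m. m \<le> n \<Longrightarrow> norm (blinfun_apply (T n) (d m) - d m) \<le> 1 / real (Suc n)"
    by (metis atMost_iff image_eqI)
  have Tx: "(\<lambda>n. blinfun_apply (T n) x) \<longlonglongrightarrow> x" for x
  proof (rule tendsto_identity_of_dense[OF d fac_norm[OF fac]])
    fix m
    show "(\<lambda>n. blinfun_apply (T n) (d m) - d m) \<longlonglongrightarrow> 0"
    proof (rule Lim_null_comparison)
      show "\<forall>\<^sub>F n in sequentially. norm (blinfun_apply (T n) (d m) - d m) \<le> 1 / real (Suc n)"
        using Td by (auto simp: eventually_sequentially)
      show "(\<lambda>n. 1 / real (Suc n)) \<longlonglongrightarrow> 0" by (rule LIMSEQ_Suc[OF lim_1_over_n])
    qed
  qed
  have "\<exists>I a b T. fac K I a b T \<and> (\<forall>f\<in>F. norm ((f o\<^sub>L T) - f) \<le> \<epsilon>)"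
    if F: "finite F" and \<epsilon>: "0 < \<epsilon>" for F :: "('a \<Rightarrow>\<^sub>L real) set" and \<epsilon> :: real
  proof -
    have "0 < \<epsilon> / 2" "0 \<le> K" using \<epsilon> K by auto
    then obtain M :: nat where "\<And>I a b T. fac K I a b (T :: 'a \<Rightarrow>\<^sub>L 'a) \<Longrightarrow>
        \<exists>a' b' T'. fac K {..<M} a' b' T' \<and> (\<forall>f\<in>F. norm ((f o\<^sub>L T') - (f o\<^sub>L T)) \<le> \<epsilon> / 2)"
      using fac_group[OF F, of "\<epsilon> / 2" K] by metis
    then have "\<exists>a' b' T'. fac K {..<M} a' b' T' \<and> (\<forall>f\<in>F. norm ((f o\<^sub>L T') - (f o\<^sub>L T n)) \<le> \<epsilon> / 2)" for n
      using fac by blast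
    then obtain a' b' T' where fac': "\<And>n. fac K {..<M} (a' n) (b' n) (T' n)"
      and fT': "\<And>n f. f \<in> F \<Longrightarrow> norm ((f o\<^sub>L T' n) - (f o\<^sub>L T n)) \<le> \<epsilon> / 2" by metis
    \<comment> \<open>All scalars whose limits are wanted: the \<open>a'\<close> on a dense sequence
      and \<open>F\<close> on the \<open>b'\<close>. The denominators give them one common bound, as
      the diagonal argument requires.\<close>
    define h where "h n = case_sum (\<lambda>(k, p). blinfun_apply (a' n k) (d p) / (norm (d p) + 1)) (\<lambda>(f, k). blinfun_apply f (b' n k) / (norm f + 1))"
      for n :: nat
    define S where "S = Inl ` ({..<M} \<times> (UNIV :: nat set)) \<union> Inr ` (F \<times> {..<M})"
    have hb: "norm (h n x) \<le> K" if "x \<in> S" for n x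
    proof -
      have div: "\<bar>u / (v + 1)\<bar> \<le> K" if "\<bar>u\<bar> \<le> K * v" "0 \<le> v" for u v :: real
        using that K by (simp add: field_simps)
      from that show ?thesis unfolding S_def
      proof
        assume "x \<in> Inl ` ({..<M} \<times> UNIV)"
        then obtain k p where x: "x = Inl (k, p)" "k < M" by auto
        have "\<bar>blinfun_apply (a' n k) (d p)\<bar> \<le> K * norm (d p)"
          using norm_blinfun[of "a' n k" "d p"] mult_right_mono[OF facD(2)[OF fac'[of n], of k] norm_ge_zero[of "d p"]] x by simp
        then show ?thesis using div[of _ "norm (d p)"] by (simp add: h_def x)
      next
        assume "x \<in> Inr ` (F \<times> {..<M})"
        then obtain f k where x: "x = Inr (f, k)" "f \<in> F" "k < M" by auto
        have "(\<Sum>i<M. (if i = k then 1 else 0) *\<^sub>R b' n i) = b' n k"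
          using x by (simp add: if_distrib[of "\<lambda>c. c *\<^sub>R _"] cong: if_cong)
        then have "norm (b' n k) \<le> K" using facD(3)[OF fac'[of n], of "\<lambda>i. if i = k then 1 else 0"] by simp
        then have "\<bar>blinfun_apply f (b' n k)\<bar> \<le> K * norm f"
          using norm_blinfun[of f "b' n k"] mult_left_mono[of "norm (b' n k)" K "norm f"] by (simp add: mult.commute)
        then show ?thesis using div[of _ "norm f"] by (simp add: h_def x)
      qed
    qed
    have cS: "countable S" unfolding S_def using F by (auto simp: countable_finite intro!: countable_image)
    obtain r :: "nat \<Rightarrow> nat" where r: "strict_mono r" and conv: "\<And>x. x \<in> S \<Longrightarrow> \<exists>l. (\<lambda>n. h (r n) x) \<longlonglongrightarrow> l"
      by (rule function_convergent_subsequence[OF cS hb], assumption, rule that)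
    have np: "norm y + 1 \<noteq> 0" for y :: "'c::real_normed_vector" by (smt (verit) norm_ge_zero)
    have "\<exists>\<psi> :: 'a \<Rightarrow>\<^sub>L real. norm \<psi> \<le> K \<and> (\<forall>x. (\<lambda>n. blinfun_apply (a' (r n) k) x) \<longlonglongrightarrow> blinfun_apply \<psi> x)" if k: "k < M" for k
    proof -
      have "norm (a' (r n) k) \<le> K" for n using k by (intro facD(2)[OF fac']) auto
      moreover have "convergent (\<lambda>n. blinfun_apply (a' (r n) k) (d m))" for m
      proof -
        have "Inl (k, m) \<in> S" using k by (auto simp: S_def)
        from conv[OF this] obtain l where "(\<lambda>n. blinfun_apply (a' (r n) k) (d m) / (norm (d m) + 1)) \<longlonglongrightarrow> l"
          by (auto simp: h_def)
        from tendsto_mult[OF this tendsto_const[of "norm (d m) + 1"]] show ?thesis using np[of "d m"] by (auto simp: convergent_def)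
      qed
      ultimately obtain \<psi> :: "'a \<Rightarrow>\<^sub>L real" where "norm \<psi> \<le> K" "\<And>x. (\<lambda>n. blinfun_apply (a' (r n) k) x) \<longlonglongrightarrow> blinfun_apply \<psi> x"
        using dense_pointwise_limit[OF d, of "\<lambda>n. a' (r n) k" K] by blast
      then show ?thesis by blast
    qed
    then obtain A :: "nat \<Rightarrow> 'a \<Rightarrow>\<^sub>L real" where A: "\<And>k. k < M \<Longrightarrow> norm (A k) \<le> K"
      and Alim: "\<And>k x. k < M \<Longrightarrow> (\<lambda>n. blinfun_apply (a' (r n) k) x) \<longlonglongrightarrow> blinfun_apply (A k) x" by metis
    have "\<exists>l. (\<lambda>n. blinfun_apply f (b' (r n) k)) \<longlonglongrightarrow> l" if "f \<in> F" "k < M" for f k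
    proof -
      have "Inr (f, k) \<in> S" using that by (auto simp: S_def)
      from conv[OF this] obtain l where "(\<lambda>n. blinfun_apply f (b' (r n) k) / (norm f + 1)) \<longlonglongrightarrow> l"
        by (auto simp: h_def)
      from tendsto_mult[OF this tendsto_const[of "norm f + 1"]] show ?thesis using np[of f] by auto
    qed
    then obtain c where c: "\<And>f k. f \<in> F \<Longrightarrow> k < M \<Longrightarrow> (\<lambda>n. blinfun_apply f (b' (r n) k)) \<longlonglongrightarrow> c f k" by metis
    define \<delta> where "\<delta> = \<epsilon> / (2 * (real M * K + 1))"
    have MK: "0 < real M * K + 1" using K by (simp add: add_nonneg_pos)
    have \<delta>: "\<delta> > 0" "real M * K * \<delta> \<le> \<epsilon> / 2"
      using \<epsilon> MK by (auto simp: \<delta>_def field_simps)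
    have "\<forall>\<^sub>F n in sequentially. \<forall>(f, k)\<in>F \<times> {..<M}. \<bar>blinfun_apply f (b' (r n) k) - c f k\<bar> < \<delta>"
    proof (rule eventually_ball_finite)
      show "finite (F \<times> {..<M})" using F by simp
      show "\<forall>p\<in>F \<times> {..<M}. \<forall>\<^sub>F n in sequentially. case p of (f, k) \<Rightarrow> \<bar>blinfun_apply f (b' (r n) k) - c f k\<bar> < \<delta>"
        using c \<delta>(1) by (auto simp: tendsto_iff dist_real_def)
    qed
    then obtain n where n: "\<And>f k. f \<in> F \<Longrightarrow> k < M \<Longrightarrow> \<bar>blinfun_apply f (b' (r n) k) - c f k\<bar> < \<delta>"
      by (auto simp: eventually_sequentially)
    \<comment> \<open>The vectors \<open>b'\<close> need not converge in X, so they are frozen at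
      one late index.\<close>
    define B where "B = b' (r n)"
    define T0 where "T0 = (\<Sum>k\<in>{..<M}. rank_one (A k) (B k))"
    have F0: "fac K {..<M} A B T0" unfolding T0_def
      by (rule facI) (use A facD(3)[OF fac'[of "r n"]] in \<open>auto simp: B_def\<close>)
    have "norm ((f o\<^sub>L T0) - f) \<le> \<epsilon>" if f: "f \<in> F" for f
    proof (rule norm_blinfun_bound)
      fix x
      have lim1: "(\<lambda>m. \<Sum>k<M. blinfun_apply (a' (r m) k) x * blinfun_apply f (b' (r m) k)) \<longlonglongrightarrow> (\<Sum>k<M. blinfun_apply (A k) x * c f k)"
        by (intro tendsto_sum tendsto_mult Alim c f) auto
      have eq1: "(\<Sum>k<M. blinfun_apply (a' (r m) k) x * blinfun_apply f (b' (r m) k)) = blinfun_apply f (blinfun_apply (T' (r m)) x)" for m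
        by (simp add: facD(4)[OF fac'] blinfun.sum_right blinfun.scaleR_right)
      have lim2: "(\<lambda>m. blinfun_apply f (blinfun_apply (T (r m)) x)) \<longlonglongrightarrow> blinfun_apply f x"
        by (intro blinfun.tendsto tendsto_const LIMSEQ_subseq_LIMSEQ[OF Tx r, unfolded o_def])
      \<comment> \<open>In the limit f o T' becomes the sum of the A k x * c f k while f o T tends
        to f pointwise; the bound, uniform on the unit ball, survives.\<close>
      have "\<bar>blinfun_apply f (blinfun_apply (T' (r m)) x) - blinfun_apply f (blinfun_apply (T (r m)) x)\<bar> \<le> \<epsilon> / 2 * norm x" for m
        using norm_blinfun[of "(f o\<^sub>L T' (r m)) - (f o\<^sub>L T (r m))" x] mult_right_mono[OF fT'[OF f, of "r m"] norm_ge_zero[of x]]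
        by (simp add: blinfun.diff_left)
      then have 1: "\<bar>(\<Sum>k<M. blinfun_apply (A k) x * c f k) - blinfun_apply f x\<bar> \<le> \<epsilon> / 2 * norm x"
        using LIMSEQ_le_const2[OF tendsto_rabs[OF tendsto_diff[OF lim1 lim2]], of "\<epsilon> / 2 * norm x"] by (auto simp: eq1)
      have Ax: "\<bar>blinfun_apply (A k) x\<bar> \<le> K * norm x" if "k < M" for k
        using norm_blinfun[of "A k" x] mult_right_mono[OF A[OF that] norm_ge_zero[of x]] by simp
      have "\<bar>\<Sum>k<M. blinfun_apply (A k) x * (blinfun_apply f (B k) - c f k)\<bar> \<le> (\<Sum>k<M. (K * norm x) * \<delta>)"
        by (rule order_trans[OF sum_abs sum_mono])
           (use n[OF f] Ax K in \<open>auto simp: abs_mult B_def less_imp_le intro!: mult_mono\<close>)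
      also have "\<dots> = (real M * K * \<delta>) * norm x" by simp
      also have "\<dots> \<le> \<epsilon> / 2 * norm x" using \<delta>(2) by (intro mult_right_mono) auto
      finally have 2: "\<bar>\<Sum>k<M. blinfun_apply (A k) x * (blinfun_apply f (B k) - c f k)\<bar> \<le> \<epsilon> / 2 * norm x" .
      have "blinfun_apply ((f o\<^sub>L T0) - f) x = (\<Sum>k<M. blinfun_apply (A k) x * (blinfun_apply f (B k) - c f k))
          + ((\<Sum>k<M. blinfun_apply (A k) x * c f k) - blinfun_apply f x)"
        by (simp add: blinfun.diff_left facD(4)[OF F0] blinfun.sum_right blinfun.scaleR_right algebra_simps sum_subtractf)
      also have "\<bar>\<dots>\<bar> \<le> \<epsilon> / 2 * norm x + \<epsilon> / 2 * norm x"
        by (rule order_trans[OF abs_triangle_ineq add_mono[OF 2 1]])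
      finally show "norm (blinfun_apply ((f o\<^sub>L T0) - f) x) \<le> \<epsilon> * norm x" by simp
    qed (use \<epsilon> in simp)
    with F0 show ?thesis by blast
  qed
  then show ?thesis using K loc by (intro that[of K]) blast+
qed

text \<open>T - 1 = (T1 - 1)(1 - T2) is small on \<open>E\<close> because of the right factor, and
  its adjoint is small on \<open>F\<close> because of the left one.\<close>

lemma two_sided_approximation:
  obtains K where "1 \<le> K"
    "\<And>(E :: 'a set) (F :: ('a \<Rightarrow>\<^sub>L real) set) \<epsilon>. finite E \<Longrightarrow> finite F \<Longrightarrow> 0 < \<epsilon> \<Longrightarrow>
      \<exists>I a b T. fac K I a b T \<and> (\<forall>e\<in>E. norm (blinfun_apply T e - e) \<le> \<epsilon>) \<and> (\<forall>f\<in>F. norm ((f o\<^sub>L T) - f) \<le> \<epsilon>)"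
proof -
  obtain K where K: "1 \<le> K"
    and loc: "\<And>(E :: 'a set) \<epsilon>. finite E \<Longrightarrow> 0 < \<epsilon> \<Longrightarrow> \<exists>I a b T. fac K I a b T \<and> (\<forall>e\<in>E. norm (blinfun_apply T e - e) \<le> \<epsilon>)"
    and adj: "\<And>(F :: ('a \<Rightarrow>\<^sub>L real) set) \<epsilon>. finite F \<Longrightarrow> 0 < \<epsilon> \<Longrightarrow> \<exists>I a b T. fac K I a b T \<and> (\<forall>f\<in>F. norm ((f o\<^sub>L T) - f) \<le> \<epsilon>)"
    by (rule adjoint_approximation, rule that)
  define K' where "K' = 2 * K * (1 + K * K)"
  have KK: "0 \<le> K * K" by simp
  have K': "2 * K \<le> K'" "K * (1 + K * K) \<le> K'" "K \<le> K'" "1 \<le> K'"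
  proof -
    have "2 * K * 1 \<le> 2 * K * (1 + K * K)" using K KK by (intro mult_left_mono) auto
    then show *: "2 * K \<le> K'" by (simp add: K'_def)
    then show "K \<le> K'" "1 \<le> K'" using K by auto
    have "0 \<le> K * (1 + K * K)" using K KK by auto
    then show "K * (1 + K * K) \<le> K'" by (simp add: K'_def)
  qed
  have "\<exists>I a b T. fac K' I a b T \<and> (\<forall>e\<in>E. norm (blinfun_apply T e - e) \<le> \<epsilon>) \<and> (\<forall>f\<in>F. norm ((f o\<^sub>L T) - f) \<le> \<epsilon>)"
    if E: "finite E" and F: "finite F" and \<epsilon>: "0 < \<epsilon>" for E :: "'a set" and F :: "('a \<Rightarrow>\<^sub>L real) set" and \<epsilon> :: real
  proof -
    \<comment> \<open>\<open>1 + K * K\<close> bounds the norms of both 1 - T2 and T1 - 1.\<close>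
    define \<epsilon>' where "\<epsilon>' = \<epsilon> / (1 + K * K)"
    have KK1: "0 < 1 + K * K" using KK by linarith
    have \<epsilon>': "\<epsilon>' > 0" "(1 + K * K) * \<epsilon>' = \<epsilon>" using \<epsilon> KK1 by (auto simp: \<epsilon>'_def)
    obtain I2 a2 b2 and T2 :: "'a \<Rightarrow>\<^sub>L 'a" where T2: "fac K I2 a2 b2 T2" "\<And>e. e \<in> E \<Longrightarrow> norm (blinfun_apply T2 e - e) \<le> \<epsilon>'"
      using loc[OF E \<epsilon>'(1)] by blast
    obtain I1 a1 b1 and T1 :: "'a \<Rightarrow>\<^sub>L 'a" where T1: "fac K I1 a1 b1 T1" "\<And>f. f \<in> F \<Longrightarrow> norm ((f o\<^sub>L T1) - f) \<le> \<epsilon>'"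
      using adj[OF F \<epsilon>'(1)] by blast
    define R where "R = id_blinfun - T2"
    have R: "blinfun_apply R x = x - blinfun_apply T2 x" for x by (simp add: R_def blinfun.diff_left)
    have Rn: "norm (blinfun_apply R x) \<le> (1 + K * K) * norm x" for x
      using norm_triangle_ineq4[of x "blinfun_apply T2 x"] norm_blinfun[of T2 x]
        mult_right_mono[OF fac_norm[OF T2(1)] norm_ge_zero[of x]] by (simp add: R algebra_simps)
    have T1n: "norm (blinfun_apply T1 x) \<le> K * K * norm x" for x
      using norm_blinfun[of T1 x] mult_right_mono[OF fac_norm[OF T1(1)] norm_ge_zero[of x]] by simp
    define T where "T = T2 + (T1 o\<^sub>L R)"
    have Tx: "blinfun_apply T x = blinfun_apply T2 x + blinfun_apply T1 (blinfun_apply R x)" for x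
      by (simp add: T_def blinfun.add_left)
    define I where "I = (\<lambda>i. 2 * i) ` I2 \<union> (\<lambda>i. Suc (2 * i)) ` I1"
    define a where "a i = (if even i then a2 (i div 2) else a1 (i div 2) o\<^sub>L R)" for i
    define b where "b i = (if even i then b2 (i div 2) else b1 (i div 2))" for i
    have fin: "finite I1" "finite I2" using facD(1)[OF T1(1)] facD(1)[OF T2(1)] .
    have sumI: "(\<Sum>i\<in>I. h i) = (\<Sum>i\<in>I2. h (2 * i)) + (\<Sum>i\<in>I1. h (Suc (2 * i)))" for h :: "nat \<Rightarrow> 'a"
    proof -
      have "(\<Sum>i\<in>I. h i) = (\<Sum>i\<in>(\<lambda>i. 2 * i) ` I2. h i) + (\<Sum>i\<in>(\<lambda>i. Suc (2 * i)) ` I1. h i)"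
        unfolding I_def by (rule sum.union_disjoint) (use fin in \<open>auto, presburger\<close>)
      then show ?thesis by (simp add: sum.reindex inj_on_def)
    qed
    have "fac K' I a b T"
      unfolding fac_def
    proof (intro conjI allI impI ballI)
      show "finite I" using fin by (simp add: I_def)
      fix i assume "i \<in> I"
      then consider j where "j \<in> I2" "i = 2 * j" | j where "j \<in> I1" "i = Suc (2 * j)" by (auto simp: I_def)
      then show "norm (a i) \<le> K'"
      proof cases
        case 1
        then show ?thesis using facD(2)[OF T2(1), of j] K' by (simp add: a_def)
      next
        case 2
        have "norm (a1 j o\<^sub>L R) \<le> norm (a1 j) * norm R" by (rule norm_blinfun_compose)
        also have "\<dots> \<le> K * (1 + K * K)"
          using facD(2)[OF T1(1) 2(1)] norm_blinfun_bound[OF less_imp_le[OF KK1] Rn] K by (intro mult_mono) auto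
        finally show ?thesis using K' 2 by (simp add: a_def)
      qed
    next
      fix t :: "nat \<Rightarrow> real" assume t: "\<forall>i\<in>I. \<bar>t i\<bar> \<le> 1"
      have "norm (\<Sum>i\<in>I2. t (2 * i) *\<^sub>R b2 i) \<le> K" "norm (\<Sum>i\<in>I1. t (Suc (2 * i)) *\<^sub>R b1 i) \<le> K"
        by (rule facD(3)[OF T2(1)] facD(3)[OF T1(1)], use t in \<open>auto simp: I_def\<close>)+
      then have "norm (\<Sum>i\<in>I. t i *\<^sub>R b i) \<le> K + K"
        unfolding sumI by (intro norm_triangle_mono) (simp_all add: b_def)
      then show "norm (\<Sum>i\<in>I. t i *\<^sub>R b i) \<le> K'" using K' by simp
    next
      fix x
      show "blinfun_apply T x = (\<Sum>i\<in>I. blinfun_apply (a i) x *\<^sub>R b i)"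
        unfolding sumI by (simp add: Tx a_def b_def facD(4)[OF T1(1)] facD(4)[OF T2(1)])
    qed
    moreover have "norm (blinfun_apply T e - e) \<le> \<epsilon>" if "e \<in> E" for e
    proof -
      have "blinfun_apply T e - e = blinfun_apply T1 (blinfun_apply R e) - blinfun_apply R e" by (simp add: Tx R)
      also have "norm \<dots> \<le> (1 + K * K) * norm (blinfun_apply R e)"
        using norm_triangle_ineq4[of "blinfun_apply T1 (blinfun_apply R e)" "blinfun_apply R e"] T1n[of "blinfun_apply R e"]
        by (simp add: algebra_simps)
      also have "\<dots> \<le> (1 + K * K) * \<epsilon>'"
        using T2(2)[OF that] KK1 by (intro mult_left_mono) (auto simp: R norm_minus_commute)
      finally show ?thesis using \<epsilon>'(2) by simp
    qed
    moreover have "norm ((f o\<^sub>L T) - f) \<le> \<epsilon>" if "f \<in> F" for f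
    proof (rule norm_blinfun_bound)
      fix x
      have "blinfun_apply ((f o\<^sub>L T) - f) x = blinfun_apply ((f o\<^sub>L T1) - f) (blinfun_apply R x)"
        by (simp add: blinfun.diff_left Tx blinfun.add_right R blinfun.diff_right)
      also have "norm \<dots> \<le> norm ((f o\<^sub>L T1) - f) * norm (blinfun_apply R x)" by (rule norm_blinfun)
      also have "\<dots> \<le> \<epsilon>' * ((1 + K * K) * norm x)"
        using T1(2)[OF that] Rn[of x] \<epsilon>'(1) by (intro mult_mono) auto
      also have "\<dots> = \<epsilon> * norm x" using \<epsilon>'(2) by (metis mult.assoc mult.commute)
      finally show "norm (blinfun_apply ((f o\<^sub>L T) - f) x) \<le> \<epsilon> * norm x" .
    qed (use \<epsilon> in simp)
    ultimately show ?thesis by blast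
  qed
  then show ?thesis using K'(4) by (intro that[of K']) blast+
qed

end

section \<open>Asymptotic flatness\<close>

lemma blinfun_almost_norming:
  fixes g :: "'a::real_normed_vector \<Rightarrow>\<^sub>L real"
  assumes "0 < \<tau>"
  obtains x where "norm x \<le> 1" "norm g - \<tau> \<le> blinfun_apply g x"
proof -
  have "\<exists>x. norm x \<le> 1 \<and> norm g - \<tau> \<le> blinfun_apply g x"
  proof (rule ccontr)
    assume "\<not> ?thesis"
    then have *: "blinfun_apply g x < norm g - \<tau>" if "norm x \<le> 1" for x using that by force
    have pos: "0 \<le> norm g - \<tau>" using *[of 0] by simp
    have "norm g \<le> norm g - \<tau>"
    proof (rule norm_blinfun_bound[OF pos])
      fix x :: 'a
      show "norm (blinfun_apply g x) \<le> (norm g - \<tau>) * norm x"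
      proof (cases "x = 0")
        case False
        then have n: "0 < norm x" by simp
        have "blinfun_apply g ((1 / norm x) *\<^sub>R x) < norm g - \<tau>" "blinfun_apply g ((- 1 / norm x) *\<^sub>R x) < norm g - \<tau>"
          using False by (intro *; simp)+
        then have "blinfun_apply g x < (norm g - \<tau>) * norm x" "- blinfun_apply g x < (norm g - \<tau>) * norm x"
          using n by (auto simp: blinfun.scaleR_right blinfun.minus_right field_simps)
        then show ?thesis by (simp add: abs_le_iff)
      qed simp
    qed
    with assms show False by simp
  qed
  then show ?thesis using that by blast
qed

section \<open>The Gorelik principle and perturbations in the dual norm\<close>

context lip_c0
begin

text \<open>Gorelik's principle for the tail subspaces of c0; Kuhn's lemma replaces Brouwer's fixed
  point theorem, and an approximate solution on the grid is all that is needed.\<close>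

lemma gorelik:
  assumes d: "0 < d" and \<eta>: "0 < \<eta>"
  obtains G :: "'a set" where "finite G"
    "\<And>u. L * norm u \<le> d \<Longrightarrow> \<exists>z g. g \<in> G \<and> V (m + z) = u + g \<and> norm z \<le> 2 * d \<and> (\<forall>i<n. \<bar>cz z i\<bar> \<le> \<eta>)"
proof -
  \<comment> \<open>L * L * (2 * d / p) bounds the oscillation of \<open>Z\<close> below over one
    cell of the grid.\<close>
  obtain p :: nat where p': "real p \<ge> 1 + L * L * (2 * d) / \<eta>" using real_arch_simple by blast
  have LL: "0 \<le> L * L * (2 * d)" using d by simp
  have p0: "real p > 0" using p' LL \<eta> by (smt (verit) divide_nonneg_pos)
  have "L * L * (2 * d) / \<eta> \<le> real p" using p' by linarith
  then have p: "L * L * (2 * d / real p) \<le> \<eta>" using p0 \<eta> by (simp add: field_simps)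
  define pt where "pt x = czs (\<lambda>i. if i < n then - d + 2 * d * real (x i) / real p else 0)" for x :: "nat \<Rightarrow> nat"
  have pt: "cz (pt x) i = (if i < n then - d + 2 * d * real (x i) / real p else 0)" for x i
    unfolding pt_def by (rule cz_czs[OF finite_support_tendsto_0])
  \<comment> \<open>\<open>G\<close> is independent of \<open>u\<close>: a functional that is small
    on this finite set is small at every \<open>g\<close> that can occur.\<close>
  define G where "G = (\<lambda>x. V (m + pt x)) ` (\<Pi>\<^sub>E i\<in>{..<n}. {..p})"
  have "finite G" unfolding G_def by (intro finite_imageI finite_PiE) auto
  moreover have "\<exists>z g. g \<in> G \<and> V (m + z) = u + g \<and> norm z \<le> 2 * d \<and> (\<forall>i<n. \<bar>cz z i\<bar> \<le> \<eta>)"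
    if u: "L * norm u \<le> d" for u
  proof -
    \<comment> \<open>\<open>Z x\<close> is within L * norm u <= d of the grid point, so its
      coordinates have opposite weak signs on opposite faces of the cube. A common approximate zero
      of the first n coordinates is sought.\<close>
    define Z where "Z x = U (u + V (m + pt x)) - m" for x
    have Zpt: "norm (Z x - pt x) \<le> d" for x
      using lipU[of "u + V (m + pt x)" "V (m + pt x)"] u by (simp add: Z_def UV algebra_simps)
    have Zi: "\<bar>cz (Z x) i - cz (pt x) i\<bar> \<le> d" for x i
      using cz_le_norm[of "Z x - pt x" i] Zpt[of x] by simp
    have ptdist: "norm (pt x - pt y) \<le> 2 * d / real p" if "\<And>j. j < n \<Longrightarrow> y j \<le> x j \<and> x j \<le> y j + 1" for x y
    proof (rule norm_cz_le)
      fix j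
      show "\<bar>cz (pt x - pt y) j\<bar> \<le> 2 * d / real p"
      proof (cases "j < n")
        case True
        have "cz (pt x - pt y) j = (2 * d / real p) * (real (x j) - real (y j))"
          using True p0 by (simp add: pt algebra_simps diff_divide_distrib)
        moreover have "\<bar>real (x j) - real (y j)\<bar> \<le> 1" using that[OF True] by auto
        ultimately show ?thesis using d p0 by (simp add: abs_mult mult_left_le divide_right_mono)
      qed (use d p0 in \<open>simp add: pt\<close>)
    qed
    have Zlip: "\<bar>cz (Z x) i - cz (Z y) i\<bar> \<le> \<eta>" if "\<And>j. j < n \<Longrightarrow> y j \<le> x j \<and> x j \<le> y j + 1" for x y i
    proof -
      have "\<bar>cz (Z x - Z y) i\<bar> \<le> norm (U (u + V (m + pt x)) - U (u + V (m + pt y)))"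
        using cz_le_norm[of "Z x - Z y" i] by (simp add: Z_def)
      also have "\<dots> \<le> L * norm (V (m + pt x) - V (m + pt y))"
        using lipU[of "u + V (m + pt x)" "u + V (m + pt y)"] by simp
      also have "\<dots> \<le> L * (L * norm (pt x - pt y))"
        using lipV[of "m + pt x" "m + pt y"] L1 by (intro mult_left_mono) auto
      also have "\<dots> \<le> L * (L * (2 * d / real p))"
        using ptdist[OF that] L1 by (intro mult_left_mono) auto
      finally show ?thesis using p by (simp add: mult.assoc)
    qed
    \<comment> \<open>Kuhn's lemma prescribes the labels on the faces; \<open>lab0\<close> and
      \<open>lab1\<close> show that they agree with the sign of the coordinate even there.\<close>
    define label where "label x i = (if x i = 0 then 0 else if x i = p then 1 else if cz (Z x) i \<ge> 0 then 1 else (0::nat))" for x i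
    have lab0: "cz (Z x) i \<le> 0" if "label x i = 0" "i < n" for x i
      using that Zi[of x i] by (auto simp: label_def pt split: if_splits)
    have lab1: "0 \<le> cz (Z x) i" if "label x i \<noteq> 0" "i < n" for x i
      using that Zi[of x i] p0 by (auto simp: label_def pt split: if_splits)
    have pn: "0 < p" using p0 by simp
    obtain q where q: "\<forall>i<n. q i < p"
      "\<forall>i<n. \<exists>r s. (\<forall>j<n. q j \<le> r j \<and> r j \<le> q j + 1) \<and> (\<forall>j<n. q j \<le> s j \<and> s j \<le> q j + 1) \<and> label r i \<noteq> label s i"
      by (rule kuhn_lemma[OF pn, of n label]) (use pn in \<open>auto simp: label_def\<close>)
    have small: "\<bar>cz (Z q) i\<bar> \<le> \<eta>" if i: "i < n" for i
    proof -
      obtain r s where rs: "\<forall>j<n. q j \<le> r j \<and> r j \<le> q j + 1" "\<forall>j<n. q j \<le> s j \<and> s j \<le> q j + 1" "label r i \<noteq> label s i"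
        using q(2) i by blast
      have "\<bar>cz (Z r) i - cz (Z q) i\<bar> \<le> \<eta>" "\<bar>cz (Z s) i - cz (Z q) i\<bar> \<le> \<eta>"
        using rs by (intro Zlip; blast)+
      moreover have "cz (Z r) i \<le> 0 \<and> 0 \<le> cz (Z s) i \<or> cz (Z s) i \<le> 0 \<and> 0 \<le> cz (Z r) i"
      proof -
        have "label r i = 0 \<and> label s i \<noteq> 0 \<or> label s i = 0 \<and> label r i \<noteq> 0"
          using rs(3) by (auto simp: label_def split: if_splits)
        then show ?thesis using lab0 lab1 i by blast
      qed
      ultimately show ?thesis by linarith
    qed
    have "norm (pt q) \<le> d"
    proof (rule norm_cz_le)
      fix j
      show "\<bar>cz (pt q) j\<bar> \<le> d"
      proof (cases "j < n")
        case True
        then have "real (q j) \<le> real p" using q(1) by (simp add: less_imp_le)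
        then have "0 \<le> 2 * d * real (q j) / real p" "2 * d * real (q j) / real p \<le> 2 * d"
          using d p0 by (auto simp: field_simps)
        with True show ?thesis by (simp add: pt abs_le_iff)
      qed (use d in \<open>simp add: pt\<close>)
    qed
    then have "norm (Z q) \<le> 2 * d"
      using norm_triangle_ineq2[of "Z q" "pt q"] Zpt[of q] by linarith
    moreover have "V (m + Z q) = u + V (m + pt q)" by (simp add: Z_def VU)
    moreover have "V (m + pt q) \<in> G"
    proof -
      have "pt q = pt (restrict q {..<n})" by (rule cz_eqI) (simp add: pt)
      moreover have "restrict q {..<n} \<in> (\<Pi>\<^sub>E i\<in>{..<n}. {..p})" using q(1) by (auto simp: less_imp_le)
      ultimately show ?thesis unfolding G_def by (metis imageI)
    qed
    ultimately show ?thesis using small by blast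
  qed
  ultimately show ?thesis by (rule that)
qed

text \<open>The unit ball of the dual norm that sends h to the Lipschitz constant of h composed with V.\<close>

definition dball :: "('a \<Rightarrow>\<^sub>L real) set" where
  "dball = {h. \<forall>y y'. \<bar>blinfun_apply h (V y) - blinfun_apply h (V y')\<bar> \<le> norm (y - y')}"

text \<open>\<open>s\<close> is the dual norm of \<open>f\<close>, a supremum of difference
  quotients. Swapping the two points orients an almost optimal pair so that the difference is
  positive; the unit vector \<open>e\<close> shows that there are quotients at all.\<close>

lemma optimal_lipschitz_constant:
  fixes f :: "'a \<Rightarrow>\<^sub>L real"
  obtains s where "0 \<le> s" "\<And>y y'. \<bar>blinfun_apply f (V y) - blinfun_apply f (V y')\<bar> \<le> s * norm (y - y')"
    "\<And>\<eta>. 0 < \<eta> \<Longrightarrow> \<exists>y y'. y \<noteq> y' \<and> (s - \<eta>) * norm (y - y') \<le> blinfun_apply f (V y) - blinfun_apply f (V y')"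
proof -
  define Q where "Q = {\<bar>blinfun_apply f (V y) - blinfun_apply f (V y')\<bar> / norm (y - y') | y y'. y \<noteq> y'}"
  have ub: "q \<le> norm f * L" if qQ: "q \<in> Q" for q
  proof -
    obtain y y' where q: "q = \<bar>blinfun_apply f (V y) - blinfun_apply f (V y')\<bar> / norm (y - y')" "y \<noteq> y'"
      using qQ by (auto simp: Q_def)
    have "\<bar>blinfun_apply f (V y) - blinfun_apply f (V y')\<bar> \<le> norm f * (L * norm (y - y'))"
      using norm_blinfun[of f "V y - V y'"] mult_left_mono[OF lipV[of y y'], of "norm f"] by (simp add: blinfun.diff_right)
    then show ?thesis using q by (simp add: divide_le_eq mult.assoc)
  qed
  have bdd: "bdd_above Q" using ub by (rule bdd_aboveI)
  define e where "e = czs (\<lambda>i. if i < 1 then 1 else 0)"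
  have "cz e 0 = 1" unfolding e_def by (subst cz_czs[OF finite_support_tendsto_0]) simp
  then have "e \<noteq> 0" by auto
  then have ne: "Q \<noteq> {}" by (auto simp: Q_def)
  define s where "s = Sup Q"
  have le: "q \<le> s" if "q \<in> Q" for q unfolding s_def by (rule cSup_upper[OF that bdd])
  have s0: "0 \<le> s"
  proof -
    obtain q where q: "q \<in> Q" using ne by auto
    then have "0 \<le> q" by (auto simp: Q_def)
    with le[OF q] show ?thesis by simp
  qed
  have "\<bar>blinfun_apply f (V y) - blinfun_apply f (V y')\<bar> \<le> s * norm (y - y')" for y y'
  proof (cases "y = y'")
    case False
    then have "\<bar>blinfun_apply f (V y) - blinfun_apply f (V y')\<bar> / norm (y - y') \<le> s" by (intro le) (auto simp: Q_def)
    with False show ?thesis by (simp add: divide_le_eq)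
  qed simp
  moreover have "\<exists>y y'. y \<noteq> y' \<and> (s - \<eta>) * norm (y - y') \<le> blinfun_apply f (V y) - blinfun_apply f (V y')" if \<eta>: "0 < \<eta>" for \<eta>
  proof -
    have "s - \<eta> < Sup Q" using \<eta> by (simp add: s_def)
    then obtain q where "q \<in> Q" "s - \<eta> < q" using less_cSupD[OF ne] by blast
    then obtain y y' where y: "y \<noteq> y'" "s - \<eta> < \<bar>blinfun_apply f (V y) - blinfun_apply f (V y')\<bar> / norm (y - y')"
      by (auto simp: Q_def)
    then have *: "(s - \<eta>) * norm (y - y') \<le> \<bar>blinfun_apply f (V y) - blinfun_apply f (V y')\<bar>"
      by (simp add: less_divide_eq)
    show ?thesis
    proof (cases "0 \<le> blinfun_apply f (V y) - blinfun_apply f (V y')")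
      case True
      then show ?thesis using * y(1) by (intro exI[of _ y] exI[of _ y']) simp
    next
      case False
      then show ?thesis using * y(1) by (intro exI[of _ y'] exI[of _ y]) (simp add: norm_minus_commute)
    qed
  qed
  ultimately show ?thesis using s0 that by blast
qed

text \<open>Between almost optimal points y2 and y1, at distance 2 \<open>\<delta>\<close>, f o V
  gains almost 2 s \<open>\<delta>\<close>. Gorelik's principle gives m + z almost equidistant from
  both, with image a prescribed small u plus an element of a finite set. From y2 to m + z the gain
  is at most about s \<open>\<delta>\<close>, so about s \<open>\<delta>\<close> is left for the
  second half; there \<open>g\<close> adds almost \<open>\<delta>\<close> * norm g / (2 * L) through
  u, while \<open>f + g\<close> can gain only about \<open>\<delta>\<close>.\<close>

lemma dual_kadec_klee:
  fixes f :: "'a \<Rightarrow>\<^sub>L real"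
  assumes s: "0 \<le> s" "s \<le> 1" "\<And>y y'. \<bar>blinfun_apply f (V y) - blinfun_apply f (V y')\<bar> \<le> s * norm (y - y')"
    "\<And>\<eta>. 0 < \<eta> \<Longrightarrow> \<exists>y y'. y \<noteq> y' \<and> (s - \<eta>) * norm (y - y') \<le> blinfun_apply f (V y) - blinfun_apply f (V y')"
    and \<eta>: "0 < \<eta>"
  obtains D :: "'a set" and \<tau> :: real where "finite D" "0 < \<tau>"
    "\<And>g. f + g \<in> dball \<Longrightarrow> (\<forall>x\<in>D. \<bar>blinfun_apply g x\<bar> \<le> \<tau>) \<Longrightarrow> s + norm g / (2 * L) \<le> 1 + \<eta>"
proof -
  \<comment> \<open>Seven errors \<open>\<kappa>\<close> * \<open>\<delta>\<close> add up: two from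
    the optimal pair, one from each of the two distance bounds, three from \<open>g\<close>.\<close>
  define \<kappa> where "\<kappa> = \<eta> / 7"
  have \<kappa>: "0 < \<kappa>" using \<eta> by (simp add: \<kappa>_def)
  obtain y1 y2 where y: "y1 \<noteq> y2" "(s - \<kappa>) * norm (y1 - y2) \<le> blinfun_apply f (V y1) - blinfun_apply f (V y2)"
    using s(4)[OF \<kappa>] by blast
  define m where "m = (1/2) *\<^sub>R (y1 + y2)"
  define E where "E = (1/2) *\<^sub>R (y1 - y2)"
  define \<delta> where "\<delta> = norm E"
  have mE: "m + E = y1" "m - E = y2"
    by (simp_all add: m_def E_def algebra_simps flip: scaleR_add_left)
  have \<delta>: "0 < \<delta>" "norm (y1 - y2) = 2 * \<delta>" using y(1) by (simp_all add: \<delta>_def E_def)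
  have \<kappa>\<delta>: "0 < \<kappa> * \<delta>" using \<kappa> \<delta> by simp
  \<comment> \<open>\<open>E\<close> is negligible from n on and z will be negligible before n; the
    norm being a supremum, E + z and E - z are barely longer than \<open>E\<close>.\<close>
  obtain n where n: "\<And>i. i \<ge> n \<Longrightarrow> \<bar>cz E i\<bar> < \<kappa> * \<delta>"
    using LIMSEQ_D[OF cz_tendsto[of E] \<kappa>\<delta>] by auto
  have "0 < \<delta> / 2" using \<delta> by simp
  then obtain G :: "'a set" where G: "finite G"
    "\<And>u. L * norm u \<le> \<delta> / 2 \<Longrightarrow> \<exists>z g. g \<in> G \<and> V (m + z) = u + g \<and> norm z \<le> 2 * (\<delta> / 2) \<and> (\<forall>i<n. \<bar>cz z i\<bar> \<le> \<kappa> * \<delta>)"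
    using gorelik[OF _ \<kappa>\<delta>, of "\<delta> / 2" m n] by metis
  have L0: "0 < L" using L1 by simp
  show ?thesis
  proof (rule that[of "insert (V y1) G" "\<kappa> * \<delta>"])
    show "finite (insert (V y1) G)" using G by simp
    show "0 < \<kappa> * \<delta>" by (rule \<kappa>\<delta>)
    fix g assume fg: "f + g \<in> dball" and gD: "\<forall>x\<in>insert (V y1) G. \<bar>blinfun_apply g x\<bar> \<le> \<kappa> * \<delta>"
    \<comment> \<open>The largest length of u that Gorelik's principle admits here; it is the source
      of the constant 1 / (2 * L).\<close>
    define b where "b = \<delta> / (2 * L)"
    have b: "0 < b" "L * b = \<delta> / 2" using \<delta> L0 by (auto simp: b_def)
    obtain x where x: "norm x \<le> 1" "norm g - \<kappa> * \<delta> / b \<le> blinfun_apply g x"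
      using blinfun_almost_norming[of "\<kappa> * \<delta> / b" g] b \<kappa>\<delta> by auto
    define u where "u = (- b) *\<^sub>R x"
    have "L * norm u \<le> \<delta> / 2"
    proof -
      have "norm u \<le> b" using x(1) b(1) by (simp add: u_def mult_left_le)
      then show ?thesis using mult_left_mono[of "norm u" b L] L0 b(2) by simp
    qed
    then obtain z k where z: "k \<in> G" "V (m + z) = u + k" "norm z \<le> \<delta>" "\<And>i. i < n \<Longrightarrow> \<bar>cz z i\<bar> \<le> \<kappa> * \<delta>"
      using G(2)[of u] by auto
    have "b * (norm g - \<kappa> * \<delta> / b) \<le> b * blinfun_apply g x" using x(2) b(1) by (intro mult_left_mono) auto
    then have gu: "blinfun_apply g u \<le> - (b * norm g) + \<kappa> * \<delta>"
      using b(1) by (simp add: u_def blinfun.scaleR_right blinfun.minus_right algebra_simps)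
    have Ez: "norm (E - z) \<le> (1 + \<kappa>) * \<delta>" "norm (z + E) \<le> (1 + \<kappa>) * \<delta>"
    proof -
      have "\<bar>cz E i\<bar> + \<bar>cz z i\<bar> \<le> (1 + \<kappa>) * \<delta>" for i
      proof (cases "i < n")
        case True
        then show ?thesis using z(4)[OF True] cz_le_norm[of E i] by (simp add: \<delta>_def algebra_simps)
      next
        case False
        then show ?thesis using n[of i] z(3) cz_le_norm[of z i] by (simp add: algebra_simps)
      qed
      then have *: "\<bar>cz E i - cz z i\<bar> \<le> (1 + \<kappa>) * \<delta>" "\<bar>cz z i + cz E i\<bar> \<le> (1 + \<kappa>) * \<delta>" for i
        by (metis abs_triangle_ineq4 order_trans, metis abs_triangle_ineq add.commute order_trans)
      show "norm (E - z) \<le> (1 + \<kappa>) * \<delta>" "norm (z + E) \<le> (1 + \<kappa>) * \<delta>"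
        by (rule norm_cz_le, simp add: *)+
    qed
    have "blinfun_apply f (V (m + z)) - blinfun_apply f (V y2) \<le> s * norm (z + E)"
      using s(3)[of "m + z" y2] by (simp add: mE(2)[symmetric] algebra_simps)
    also have "\<dots> \<le> s * ((1 + \<kappa>) * \<delta>)" using Ez(2) s(1) by (intro mult_left_mono)
    finally have f1: "blinfun_apply f (V (m + z)) - blinfun_apply f (V y2) \<le> s * ((1 + \<kappa>) * \<delta>)" .
    have f2: "(s - \<kappa>) * (2 * \<delta>) \<le> blinfun_apply f (V y1) - blinfun_apply f (V y2)"
      using y(2) \<delta>(2) by simp
    have "blinfun_apply (f + g) (V y1) - blinfun_apply (f + g) (V (m + z)) \<le> norm (y1 - (m + z))"
      using fg by (auto simp: dball_def abs_le_iff)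
    also have "\<dots> \<le> (1 + \<kappa>) * \<delta>" using Ez(1) by (simp add: mE(1)[symmetric])
    finally have fgu: "blinfun_apply (f + g) (V y1) - blinfun_apply (f + g) (V (m + z)) \<le> (1 + \<kappa>) * \<delta>" .
    have gk: "\<bar>blinfun_apply g k\<bar> \<le> \<kappa> * \<delta>" "\<bar>blinfun_apply g (V y1)\<bar> \<le> \<kappa> * \<delta>" using gD z(1) by auto
    have gz: "blinfun_apply g (V (m + z)) = blinfun_apply g u + blinfun_apply g k" by (simp add: z(2) blinfun.add_right)
    have "(s - \<kappa>) * (2 * \<delta>) - s * ((1 + \<kappa>) * \<delta>) + b * norm g - 3 * (\<kappa> * \<delta>) \<le> (1 + \<kappa>) * \<delta>"
      using f1 f2 fgu gk gu gz by (simp add: blinfun.add_left)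
    moreover have "s * (\<kappa> * \<delta>) \<le> 1 * (\<kappa> * \<delta>)" using s(2) \<kappa>\<delta> by (intro mult_right_mono) auto
    ultimately have "s * \<delta> + b * norm g \<le> \<delta> + 7 * (\<kappa> * \<delta>)" by (simp add: algebra_simps)
    then have "(s + norm g / (2 * L)) * \<delta> \<le> (1 + 7 * \<kappa>) * \<delta>"
      by (simp add: b_def algebra_simps)
    then show "s + norm g / (2 * L) \<le> 1 + \<eta>" using \<delta>(1) by (simp add: \<kappa>_def)
  qed
qed

lemma norm_le_dball: "h \<in> dball \<Longrightarrow> \<bar>blinfun_apply h x\<bar> \<le> L * norm x"
proof -
  assume "h \<in> dball"
  then have "\<bar>blinfun_apply h (V (U x)) - blinfun_apply h (V (U 0))\<bar> \<le> norm (U x - U 0)"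
    unfolding dball_def by blast
  with lipU[of x 0] show ?thesis by (simp add: VU)
qed

text \<open>Alaoglu's theorem for \<open>dball\<close>: a closed subset of a product of intervals.
  It is stated for plain functions, whose type carries the topology of pointwise
  convergence.\<close>

lemma compact_dball_functions:
  "compact {h :: 'a \<Rightarrow> real. linear h \<and> (\<forall>y y'. \<bar>h (V y) - h (V y')\<bar> \<le> norm (y - y'))}" (is "compact ?K")
proof -
  define P where "P = (\<Pi>\<^sub>E x\<in>(UNIV :: 'a set). {- (L * norm x)..L * norm x})"
  have "compactin (product_topology (\<lambda>_. euclidean) UNIV) P"
    unfolding P_def by (subst compactin_PiE) auto
  then have cP: "compact P" by (simp add: euclidean_product_topology)
  have ev: "continuous_on UNIV (\<lambda>h :: 'a \<Rightarrow> real. h x)" for x by simp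
  have "closed {h :: 'a \<Rightarrow> real. (\<forall>x y. h (x + y) = h x + h y) \<and> (\<forall>c x. h (c *\<^sub>R x) = c *\<^sub>R h x) \<and>
      (\<forall>y y'. \<bar>h (V y) - h (V y')\<bar> \<le> norm (y - y'))}"
    by (intro closed_Collect_conj closed_Collect_all closed_Collect_eq closed_Collect_le continuous_intros ev)
  then have cl: "closed ?K" by (simp add: linear_iff)
  have "?K \<subseteq> P"
  proof
    fix h assume h: "h \<in> ?K"
    have "h x \<in> {- (L * norm x)..L * norm x}" for x
    proof -
      have "\<bar>h (V (U x)) - h (V (U 0))\<bar> \<le> norm (U x - U 0)" using h by blast
      moreover have "h 0 = 0" using h linear_0 by blast
      ultimately show ?thesis using lipU[of x 0] by (simp add: VU abs_le_iff)
    qed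
    then show "h \<in> P" by (simp add: P_def PiE_UNIV_domain)
  qed
  then have "?K = P \<inter> ?K" by blast
  then show ?thesis using compact_Int_closed[OF cP cl] by simp
qed

text \<open>By compactness finitely many centres f suffice. For h = f + g near a centre, h (x + z)
  is at most (s + norm g / (2 * L)) * \<open>\<rho>\<close> up to small terms, and the estimate for
  dual perturbations bounds the bracket by 1 + \<open>\<kappa>\<close>. \<open>\<rho>\<close> >= 1
  absorbs g z into the product, and \<open>\<rho>\<close> <= 2 keeps \<open>\<kappa>\<close> *
  \<open>\<rho>\<close> small.\<close>

lemma asymptotic_flatness:
  fixes x :: 'a
  assumes \<eta>: "0 < \<eta>"
  obtains \<Phi> :: "('a \<Rightarrow>\<^sub>L real) set" where "finite \<Phi>"
    "\<And>z \<rho> h. 1 \<le> \<rho> \<Longrightarrow> \<rho> \<le> 2 \<Longrightarrow> (\<And>h. h \<in> dball \<Longrightarrow> blinfun_apply h x \<le> \<rho>) \<Longrightarrow> norm z \<le> 1 / (2 * L) \<Longrightarrow>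
      (\<And>\<phi>. \<phi> \<in> \<Phi> \<Longrightarrow> \<bar>blinfun_apply \<phi> z\<bar> \<le> 1) \<Longrightarrow> h \<in> dball \<Longrightarrow> blinfun_apply h (x + z) \<le> \<rho> + \<eta>"
proof -
  define \<kappa> where "\<kappa> = \<eta> / 4"
  have \<kappa>: "0 < \<kappa>" using \<eta> by (simp add: \<kappa>_def)
  have L0: "0 < L" using L1 by simp
  let ?K = "{h :: 'a \<Rightarrow> real. linear h \<and> (\<forall>y y'. \<bar>h (V y) - h (V y')\<bar> \<le> norm (y - y'))}"
  define Q where "Q f s D \<tau> \<longleftrightarrow> 0 \<le> s \<and> s \<le> 1 \<and> (\<forall>y y'. \<bar>blinfun_apply f (V y) - blinfun_apply f (V y')\<bar> \<le> s * norm (y - y')) \<and>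
      finite D \<and> 0 < \<tau> \<and> (\<forall>g. f + g \<in> dball \<longrightarrow> (\<forall>x\<in>D. \<bar>blinfun_apply g x\<bar> \<le> \<tau>) \<longrightarrow> s + norm g / (2 * L) \<le> 1 + \<kappa>)"
    for f :: "'a \<Rightarrow>\<^sub>L real" and s :: real and D :: "'a set" and \<tau> :: real
  have Qex: "\<exists>s D \<tau>. Q f s D \<tau>"
    if f: "f \<in> dball" for f
  proof -
    obtain s where s: "0 \<le> s" "\<And>y y'. \<bar>blinfun_apply f (V y) - blinfun_apply f (V y')\<bar> \<le> s * norm (y - y')"
      "\<And>\<eta>. 0 < \<eta> \<Longrightarrow> \<exists>y y'. y \<noteq> y' \<and> (s - \<eta>) * norm (y - y') \<le> blinfun_apply f (V y) - blinfun_apply f (V y')"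
      by (rule optimal_lipschitz_constant[of f], rule that)
    have "s \<le> 1"
    proof (rule field_le_epsilon)
      fix e :: real assume "e > 0"
      then obtain y y' where y: "y \<noteq> y'" "(s - e) * norm (y - y') \<le> blinfun_apply f (V y) - blinfun_apply f (V y')"
        using s(3) by blast
      moreover have "blinfun_apply f (V y) - blinfun_apply f (V y') \<le> norm (y - y')"
        using f by (auto simp: dball_def abs_le_iff)
      ultimately have "(s - e) * norm (y - y') \<le> 1 * norm (y - y')" by (simp only: mult_1)
      then have "s - e \<le> 1" by (rule mult_right_le_imp_le) (use y(1) in simp)
      then show "s \<le> 1 + e" by simp
    qed
    obtain D :: "'a set" and \<tau> :: real where "finite D" "0 < \<tau>"
      "\<And>g. f + g \<in> dball \<Longrightarrow> (\<forall>x\<in>D. \<bar>blinfun_apply g x\<bar> \<le> \<tau>) \<Longrightarrow> s + norm g / (2 * L) \<le> 1 + \<kappa>"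
      by (rule dual_kadec_klee[OF s(1) \<open>s \<le> 1\<close> s(2) s(3) \<kappa>], assumption, rule that)
    with s \<open>s \<le> 1\<close> have "Q f s D \<tau>" unfolding Q_def by blast
    then show ?thesis by blast
  qed
  obtain s D \<tau> where "\<And>f. f \<in> dball \<Longrightarrow> Q f (s f) (D f) (\<tau> f)" using Qex by metis
  then have s: "\<And>f. f \<in> dball \<Longrightarrow> 0 \<le> s f" "\<And>f. f \<in> dball \<Longrightarrow> s f \<le> 1"
    "\<And>f y y'. f \<in> dball \<Longrightarrow> \<bar>blinfun_apply f (V y) - blinfun_apply f (V y')\<bar> \<le> s f * norm (y - y')"
    and D: "\<And>f. f \<in> dball \<Longrightarrow> finite (D f)" and \<tau>: "\<And>f. f \<in> dball \<Longrightarrow> 0 < (\<tau> f :: real)"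
    and kk: "\<And>f g. f \<in> dball \<Longrightarrow> f + g \<in> dball \<Longrightarrow> (\<forall>x\<in>D f. \<bar>blinfun_apply g x\<bar> \<le> \<tau> f) \<Longrightarrow> s f + norm g / (2 * L) \<le> 1 + \<kappa>"
    unfolding Q_def by blast+
  define \<theta> where "\<theta> f = min (\<tau> f) \<kappa>" for f
  \<comment> \<open>\<open>x\<close> joins the test vectors of \<open>f\<close> so that g x is small
    as well.\<close>
  define W where "W f = (\<Inter>x'\<in>insert x (D f). {h :: 'a \<Rightarrow> real. \<bar>h x' - blinfun_apply f x'\<bar> < \<theta> f})" for f
  have opW: "open (W f)" if "f \<in> dball" for f
    unfolding W_def
  proof (rule open_INT)
    show "finite (insert x (D f))" using D[OF that] by simp
    show "\<forall>x'\<in>insert x (D f). open {h :: 'a \<Rightarrow> real. \<bar>h x' - blinfun_apply f x'\<bar> < \<theta> f}"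
      by (intro ballI open_Collect_less continuous_intros continuous_on_product_coordinates)
  qed
  have cov: "?K \<subseteq> (\<Union>f\<in>dball. W f)"
  proof
    fix h assume h: "h \<in> ?K"
    have "\<bar>h y\<bar> \<le> L * norm y" for y
    proof -
      have "\<bar>h (V (U y)) - h (V (U 0))\<bar> \<le> norm (U y - U 0)" using h by blast
      moreover have "h 0 = 0" using h linear_0 by blast
      ultimately show ?thesis using lipU[of y 0] by (simp add: VU)
    qed
    then have bl: "bounded_linear h"
      using h by (intro bounded_linear_intro[where K=L]) (auto simp: linear_add linear_cmul mult.commute)
    then have ap: "blinfun_apply (Blinfun h) = h" by (rule bounded_linear_Blinfun_apply)
    then have db: "Blinfun h \<in> dball" using h by (simp add: dball_def)
    have "h \<in> W (Blinfun h)" using \<tau>[OF db] \<kappa> by (simp add: W_def ap \<theta>_def)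
    with db show "h \<in> (\<Union>f\<in>dball. W f)" by blast
  qed
  obtain C where C: "C \<subseteq> dball" "finite C" "?K \<subseteq> (\<Union>f\<in>C. W f)"
    by (rule compactE_image[OF compact_dball_functions, of dball W]) (use opW cov in auto)
  show ?thesis
  \<comment> \<open>Scaling by 1 / \<open>\<kappa>\<close> turns the normalised test into f z of
    size at most \<open>\<kappa>\<close>.\<close>
  proof (rule that[of "(\<lambda>f. (1 / \<kappa>) *\<^sub>R f) ` C"])
    show "finite ((\<lambda>f. (1 / \<kappa>) *\<^sub>R f) ` C)" using C by simp
    fix z \<rho> h
    assume \<rho>: "1 \<le> \<rho>" "\<rho> \<le> 2" and x\<rho>: "\<And>h. h \<in> dball \<Longrightarrow> blinfun_apply h x \<le> \<rho>" and z: "norm z \<le> 1 / (2 * L)"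
      and \<Phi>: "\<And>\<phi>. \<phi> \<in> (\<lambda>f. (1 / \<kappa>) *\<^sub>R f) ` C \<Longrightarrow> \<bar>blinfun_apply \<phi> z\<bar> \<le> 1" and h: "h \<in> dball"
    have "blinfun_apply h \<in> ?K"
      using h by (auto simp: dball_def bounded_linear.linear[OF blinfun.bounded_linear_right])
    then obtain f where f: "f \<in> C" "blinfun_apply h \<in> W f" using C(3) by blast
    have fd: "f \<in> dball" using f C by blast
    define g where "g = h - f"
    have hf: "h = f + g" by (simp add: g_def)
    have gx: "\<bar>blinfun_apply g y\<bar> < \<theta> f" if "y \<in> insert x (D f)" for y
      using f(2) that by (auto simp: W_def g_def blinfun.diff_left)
    have kk': "s f + norm g / (2 * L) \<le> 1 + \<kappa>"
      by (rule kk[OF fd]) (use h hf gx in \<open>auto simp: \<theta>_def less_imp_le\<close>)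
    \<comment> \<open>Dividing \<open>f\<close> by its own dual norm keeps it in
      \<open>dball\<close>, which yields the factor \<open>s f\<close>.\<close>
    have fx: "blinfun_apply f x \<le> s f * \<rho>"
    proof (cases "s f = 0")
      case True
      have "blinfun_apply f x = 0" using s(3)[OF fd, of "U x" "U 0"] by (simp add: True VU)
      with True show ?thesis by simp
    next
      case False
      with s(1)[OF fd] have sp: "0 < s f" by simp
      have "(1 / s f) *\<^sub>R f \<in> dball"
        unfolding dball_def using s(3)[OF fd] sp
        by (simp add: blinfun.scaleR_left flip: diff_divide_distrib) (simp add: field_simps)
      from x\<rho>[OF this] show ?thesis using sp by (simp add: blinfun.scaleR_left field_simps)
    qed
    have "(1 / \<kappa>) *\<^sub>R f \<in> (\<lambda>f. (1 / \<kappa>) *\<^sub>R f) ` C" using f(1) by blast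
    from \<Phi>[OF this] have fz: "\<bar>blinfun_apply f z\<bar> \<le> \<kappa>" using \<kappa> by (simp add: blinfun.scaleR_left)
    have "\<bar>blinfun_apply g z\<bar> \<le> norm g * (1 / (2 * L))"
      using norm_blinfun[of g z] mult_left_mono[OF z, of "norm g"] by simp
    also have "\<dots> \<le> (norm g / (2 * L)) * \<rho>"
      using mult_left_mono[OF \<rho>(1), of "norm g / (2 * L)"] L0 by simp
    finally have gz: "\<bar>blinfun_apply g z\<bar> \<le> (norm g / (2 * L)) * \<rho>" .
    have "blinfun_apply h (x + z) = blinfun_apply f x + blinfun_apply g x + blinfun_apply f z + blinfun_apply g z"
      by (simp add: hf blinfun.add_left blinfun.add_right)
    also have "\<dots> \<le> s f * \<rho> + \<kappa> + \<kappa> + (norm g / (2 * L)) * \<rho>"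
      using fx gx[of x] fz gz by (auto simp: \<theta>_def)
    also have "\<dots> = (s f + norm g / (2 * L)) * \<rho> + 2 * \<kappa>" by (simp add: algebra_simps)
    also have "\<dots> \<le> (1 + \<kappa>) * \<rho> + 2 * \<kappa>" using kk' \<rho> by (intro add_right_mono mult_right_mono) auto
    also have "\<dots> \<le> \<rho> + 4 * \<kappa>" using mult_left_mono[OF \<rho>(2), of \<kappa>] \<kappa> by (simp add: algebra_simps)
    finally show "blinfun_apply h (x + z) \<le> \<rho> + \<eta>" by (simp add: \<kappa>_def)
  qed
qed

text \<open>A functional norming \<open>x\<close>, divided by \<open>L\<close>, belongs to
  \<open>dball\<close>.\<close>

lemma norm_le_of_dball:
  assumes "\<And>h. h \<in> dball \<Longrightarrow> blinfun_apply h x \<le> \<rho>"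
  shows "norm x \<le> L * \<rho>"
proof -
  obtain f :: "'a \<Rightarrow>\<^sub>L real" where f: "norm f \<le> 1" "blinfun_apply f x = norm x" by (rule norming_functional)
  have L0: "0 < L" using L1 by simp
  have "\<bar>blinfun_apply f (V y) - blinfun_apply f (V y')\<bar> \<le> L * norm (y - y')" for y y'
    using norm_blinfun[of f "V y - V y'"] mult_right_mono[OF f(1) norm_ge_zero[of "V y - V y'"]] lipV[of y y']
    by (simp add: blinfun.diff_right)
  then have "(1 / L) *\<^sub>R f \<in> dball"
    unfolding dball_def using L0 by (simp add: blinfun.scaleR_left flip: diff_divide_distrib) (simp add: field_simps)
  from assms[OF this] show ?thesis using L0 f(2) by (simp add: blinfun.scaleR_left field_simps)
qed

end

section \<open>Factoring the identity through null sequences\<close>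

text \<open>The bound on all coefficient choices makes a tail of the series at most \<open>C\<close>
  times its largest coefficient, and these tend to 0.\<close>

lemma c0_synthesis:
  fixes v :: "nat \<Rightarrow> 'a::banach"
  assumes bnd: "\<And>n t. (\<And>i. i < n \<Longrightarrow> \<bar>t i\<bar> \<le> (1::real)) \<Longrightarrow> norm (\<Sum>i<n. t i *\<^sub>R v i) \<le> C"
  obtains S where "bounded_linear S" "\<And>z. (\<lambda>i. cz z i *\<^sub>R v i) sums S z"
proof -
  have C0: "0 \<le> C" using bnd[of 0 "\<lambda>_. 0"] by simp
  have bnd': "norm (\<Sum>i<n. t i *\<^sub>R v i) \<le> C * c" if c: "0 < c" "\<And>i. i < n \<Longrightarrow> \<bar>t i\<bar> \<le> c" for n t c
  proof -
    have "norm (\<Sum>i<n. (t i / c) *\<^sub>R v i) \<le> C" using c by (intro bnd) (auto simp: field_simps)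
    moreover have "(\<Sum>i<n. t i *\<^sub>R v i) = c *\<^sub>R (\<Sum>i<n. (t i / c) *\<^sub>R v i)" using c by (simp add: scaleR_sum_right)
    ultimately show ?thesis using c by (simp add: mult.commute mult_left_mono)
  qed
  have sm: "summable (\<lambda>i. cz z i *\<^sub>R v i)" for z
  proof -
    have "Cauchy (\<lambda>n. \<Sum>i<n. cz z i *\<^sub>R v i)"
    proof (rule CauchyI')
      fix e :: real assume e: "e > 0"
      define e' where "e' = e / (C + 1)"
      have e': "e' > 0" "C * e' < e" using e C0 by (auto simp: e'_def field_simps)
      obtain N where N: "\<And>i. i \<ge> N \<Longrightarrow> \<bar>cz z i\<bar> < e'" using LIMSEQ_D[OF cz_tendsto e'(1)] by auto
      have "norm ((\<Sum>i<m. cz z i *\<^sub>R v i) - (\<Sum>i<n. cz z i *\<^sub>R v i)) < e" if "N \<le> m" "m < n" for m n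
      proof -
        have "(\<Sum>i<n. cz z i *\<^sub>R v i) - (\<Sum>i<m. cz z i *\<^sub>R v i) = (\<Sum>i\<in>{..<n} - {..<m}. cz z i *\<^sub>R v i)"
          using that by (intro sum_diff[symmetric]) auto
        also have "\<dots> = (\<Sum>i<n. (if i < m then 0 else cz z i) *\<^sub>R v i)"
          by (rule sum.mono_neutral_cong_left) auto
        also have "norm \<dots> \<le> C * e'"
          using that N e'(1) by (intro bnd') (auto simp: not_less less_imp_le)
        finally show ?thesis using e'(2) by (simp add: norm_minus_commute)
      qed
      then show "\<exists>M. \<forall>m\<ge>M. \<forall>n>m. dist (\<Sum>i<m. cz z i *\<^sub>R v i) (\<Sum>i<n. cz z i *\<^sub>R v i) < e"
        by (auto simp: dist_norm)
    qed
    then show ?thesis by (simp add: summable_iff_convergent Cauchy_convergent)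
  qed
  define S where "S z = (\<Sum>i. cz z i *\<^sub>R v i)" for z
  have S: "(\<lambda>i. cz z i *\<^sub>R v i) sums S z" for z unfolding S_def using sm by (rule summable_sums)
  have "bounded_linear S"
  proof (rule bounded_linear_intro[where K=C])
    show "S (z + w) = S z + S w" for z w
      using sums_add[OF S S, of z w] S[of "z + w"] by (auto simp: scaleR_left_distrib intro: sums_unique2)
    show "S (c *\<^sub>R z) = c *\<^sub>R S z" for c z
      using sums_scaleR_right[OF S, of c z] S[of "c *\<^sub>R z"] by (auto intro: sums_unique2)
    show "norm (S z) \<le> norm z * C" for z
    proof (cases "z = 0")
      case True
      have "S 0 = 0" by (simp add: S_def)
      with True show ?thesis by simp
    next
      case False
      have "norm (\<Sum>i<n. cz z i *\<^sub>R v i) \<le> C * norm z" for n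
        using False by (intro bnd') (auto simp: cz_le_norm)
      then show ?thesis
        using LIMSEQ_le_const2[OF tendsto_norm[OF S[of z, unfolded sums_def]], of "C * norm z"] by (auto simp: mult.commute)
    qed
  qed
  with S show ?thesis using that by blast
qed

lemma tendsto_0_of_finite_levels:
  fixes g :: "nat \<Rightarrow> real"
  assumes "\<And>e. 0 < e \<Longrightarrow> finite {n. e \<le> \<bar>g n\<bar>}"
  shows "g \<longlonglongrightarrow> 0"
proof (rule LIMSEQ_I)
  fix e :: real assume e: "0 < e"
  obtain N where "\<And>n. n \<in> {n. e \<le> \<bar>g n\<bar>} \<Longrightarrow> n < N" using finite_nat_bounded[OF assms[OF e]] by (auto simp: subset_iff)
  then have "\<forall>n\<ge>N. norm (g n - 0) < e" by (auto simp: not_le[symmetric])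
  then show "\<exists>N. \<forall>n\<ge>N. norm (g n - 0) < e" by blast
qed

lemma sum_lessThan_mult_4: "(\<Sum>i<4 * q. g i) = (\<Sum>r<4. \<Sum>k<q. g (4 * k + r))" for g :: "nat \<Rightarrow> 'b::comm_monoid_add"
proof (induction q)
  case (Suc q)
  have "4 * Suc q = Suc (Suc (Suc (Suc (4 * q))))" by simp
  then have "(\<Sum>i<4 * Suc q. g i) = (\<Sum>i<4 * q. g i) + (\<Sum>r<4. g (4 * q + r))"
    by (simp add: eval_nat_numeral algebra_simps)
  then show ?case by (simp add: Suc sum.distrib)
qed simp

context lip_c0
begin

text \<open>Adding the vectors b k i to \<open>E\<close> and the functionals a k i to
  \<open>F\<close> makes the new operator nearly fix each earlier one under composition from either
  side.\<close>

lemma finite_rank_approximation: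
  fixes E :: "'a set" and F :: "('a \<Rightarrow>\<^sub>L real) set"
  assumes K: "1 \<le> K"
    and appr: "\<And>(E :: 'a set) (F :: ('a \<Rightarrow>\<^sub>L real) set) \<epsilon>. finite E \<Longrightarrow> finite F \<Longrightarrow> 0 < \<epsilon> \<Longrightarrow>
      \<exists>I a b T. fac K I a b T \<and> (\<forall>e\<in>E. norm (blinfun_apply T e - e) \<le> \<epsilon>) \<and> (\<forall>f\<in>F. norm ((f o\<^sub>L T) - f) \<le> \<epsilon>)"
    and A: "finite A" and fac: "\<And>k. k \<in> A \<Longrightarrow> fac K (I k) (a k) (b k) (T k)"
    and E: "finite E" and F: "finite F" and \<epsilon>: "0 < \<epsilon>"
  shows "\<exists>I' a' b' (T' :: 'a \<Rightarrow>\<^sub>L 'a). fac K I' a' b' T' \<and> (\<forall>e\<in>E. norm (blinfun_apply T' e - e) \<le> \<epsilon>) \<and>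
    (\<forall>f\<in>F. norm ((f o\<^sub>L T') - f) \<le> \<epsilon>) \<and>
    (\<forall>k\<in>A. norm ((T' o\<^sub>L T k) - T k) \<le> \<epsilon> \<and> norm ((T k o\<^sub>L T') - T k) \<le> \<epsilon>)"
proof -
  define N where "N = (\<Sum>k\<in>A. real (card (I k)))"
  have N0: "0 \<le> N" unfolding N_def by (intro sum_nonneg) auto
  have Nk: "real (card (I k)) \<le> N" if "k \<in> A" for k
    unfolding N_def using A that by (intro member_le_sum) auto
  \<comment> \<open>Composition from the left is estimated term by term and costs the number of
    terms; composition from the right uses the sup-norm bound and costs only
    \<open>K\<close>.\<close>
  define \<epsilon>' where "\<epsilon>' = \<epsilon> / (K * (1 + N))"
  have KN: "1 \<le> K * (1 + N)" using mult_mono[of 1 K 1 "1 + N"] K N0 by simp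
  have \<epsilon>': "0 < \<epsilon>'" "\<epsilon>' \<le> \<epsilon>" "K * (1 + N) * \<epsilon>' = \<epsilon>" using \<epsilon> KN by (auto simp: \<epsilon>'_def divide_le_eq mult_le_cancel_left1)
  define E' where "E' = E \<union> (\<Union>k\<in>A. b k ` I k)"
  define F' where "F' = F \<union> (\<Union>k\<in>A. a k ` I k)"
  have "finite E'" "finite F'" using E F A facD(1)[OF fac] by (auto simp: E'_def F'_def)
  then obtain I' a' b' and T' :: "'a \<Rightarrow>\<^sub>L 'a" where T': "fac K I' a' b' T'"
    "\<And>e. e \<in> E' \<Longrightarrow> norm (blinfun_apply T' e - e) \<le> \<epsilon>'" "\<And>f. f \<in> F' \<Longrightarrow> norm ((f o\<^sub>L T') - f) \<le> \<epsilon>'"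
    using appr[of E' F', OF _ _ \<epsilon>'(1)] by metis
  have "norm ((T' o\<^sub>L T k) - T k) \<le> \<epsilon>" if k: "k \<in> A" for k
  proof (rule norm_blinfun_bound)
    fix x
    have "blinfun_apply ((T' o\<^sub>L T k) - T k) x = (\<Sum>i\<in>I k. blinfun_apply (a k i) x *\<^sub>R (blinfun_apply T' (b k i) - b k i))"
      by (simp add: blinfun.diff_left facD(4)[OF fac[OF k]] blinfun.sum_right blinfun.scaleR_right scaleR_diff_right sum_subtractf)
    also have "norm \<dots> \<le> real (card (I k)) * (K * norm x * \<epsilon>')"
    proof (rule sum_norm_bound)
      fix i assume i: "i \<in> I k"
      have "\<bar>blinfun_apply (a k i) x\<bar> \<le> K * norm x"
        using norm_blinfun[of "a k i" x] mult_right_mono[OF facD(2)[OF fac[OF k] i] norm_ge_zero[of x]] by simp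
      moreover have "norm (blinfun_apply T' (b k i) - b k i) \<le> \<epsilon>'" using i k by (intro T'(2)) (auto simp: E'_def)
      ultimately show "norm (blinfun_apply (a k i) x *\<^sub>R (blinfun_apply T' (b k i) - b k i)) \<le> K * norm x * \<epsilon>'"
        using K by (auto intro!: mult_mono)
    qed
    also have "\<dots> \<le> (1 + N) * (K * norm x * \<epsilon>')"
      using Nk[OF k] K \<epsilon>' by (intro mult_right_mono) auto
    also have "\<dots> = (K * (1 + N) * \<epsilon>') * norm x" by (simp add: mult_ac)
    finally show "norm (blinfun_apply ((T' o\<^sub>L T k) - T k) x) \<le> \<epsilon> * norm x" by (simp only: \<epsilon>'(3))
  qed (use \<epsilon> in simp)
  moreover have "norm ((T k o\<^sub>L T') - T k) \<le> \<epsilon>" if k: "k \<in> A" for k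
  proof (rule norm_blinfun_bound)
    fix x
    have "blinfun_apply ((T k o\<^sub>L T') - T k) x = (\<Sum>i\<in>I k. blinfun_apply ((a k i o\<^sub>L T') - a k i) x *\<^sub>R b k i)"
      by (simp add: blinfun.diff_left facD(4)[OF fac[OF k]] scaleR_diff_left sum_subtractf)
    also have "norm \<dots> \<le> K * (\<epsilon>' * norm x)"
    proof (rule fac_sum_bound[OF fac[OF k]])
      fix i assume i: "i \<in> I k"
      have "norm ((a k i o\<^sub>L T') - a k i) \<le> \<epsilon>'" using i k by (intro T'(3)) (auto simp: F'_def)
      then show "\<bar>blinfun_apply ((a k i o\<^sub>L T') - a k i) x\<bar> \<le> \<epsilon>' * norm x"
        using norm_blinfun[of "(a k i o\<^sub>L T') - a k i" x] mult_right_mono[of "norm ((a k i o\<^sub>L T') - a k i)" \<epsilon>' "norm x"] by simp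
    qed (use \<epsilon>' in simp)
    also have "\<dots> = K * 1 * \<epsilon>' * norm x" by simp
    also have "\<dots> \<le> K * (1 + N) * \<epsilon>' * norm x"
      using K N0 \<epsilon>' by (intro mult_right_mono mult_left_mono) auto
    finally show "norm (blinfun_apply ((T k o\<^sub>L T') - T k) x) \<le> \<epsilon> * norm x" by (simp only: \<epsilon>'(3))
  qed (use \<epsilon> in simp)
  moreover have "\<forall>e\<in>E. norm (blinfun_apply T' e - e) \<le> \<epsilon>" "\<forall>f\<in>F. norm ((f o\<^sub>L T') - f) \<le> \<epsilon>"
    using T'(2,3) \<epsilon>'(2) by (force simp: E'_def F'_def)+
  ultimately show ?thesis using T'(1) by blast
qed

end

text \<open>With R i = T (i + 2) - T (i + 1), so that the R i sum up to the identity, the operators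
  (T (i + 3) - T i) T (i + 3) R i are summably close to R i. Sandwiching the factored operator
  T (i + 3) in this way makes the vectors on the left nearly vanish on functionals fixed before
  step i, and makes the coefficients on the right tend to 0.\<close>

definition block_vec :: "(nat \<Rightarrow> nat \<Rightarrow> 'a::real_normed_vector) \<Rightarrow> (nat \<Rightarrow> 'a \<Rightarrow>\<^sub>L 'a) \<Rightarrow> nat \<Rightarrow> nat \<Rightarrow> 'a" where
  "block_vec b T i j = blinfun_apply (T (i + 3) - T i) (b (i + 3) j)"

text \<open>Block i uses the operator T (i + 3), so these are the blocks already determined at stage
  \<open>k\<close>.\<close>

definition block_index :: "(nat \<Rightarrow> nat set) \<Rightarrow> nat \<Rightarrow> (nat \<times> nat) set" where
  "block_index I k = Sigma {i. i + 3 \<le> k} (\<lambda>i. I (i + 3))"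

text \<open>The coefficient 0 allows one residue class of blocks to be singled out; extensional
  functions keep the set finite.\<close>

definition block_sums :: "real \<Rightarrow> (nat \<Rightarrow> nat set) \<Rightarrow> (nat \<Rightarrow> nat \<Rightarrow> 'a::real_normed_vector) \<Rightarrow> (nat \<Rightarrow> 'a \<Rightarrow>\<^sub>L 'a) \<Rightarrow> nat \<Rightarrow> 'a set" where
  "block_sums \<kappa> I b T k = (\<lambda>e. \<Sum>p\<in>block_index I k. e p *\<^sub>R \<kappa> *\<^sub>R block_vec b T (fst p) (snd p)) `
    (\<Pi>\<^sub>E p\<in>block_index I k. {-1, 0, 1})"

lemma finite_block_index: "(\<And>i. i \<le> k \<Longrightarrow> finite (I i)) \<Longrightarrow> finite (block_index I k)"
  unfolding block_index_def
proof (rule finite_SigmaI)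
  show "finite {i. i + 3 \<le> k}" by (rule finite_subset[of _ "{..k}"]) auto
qed auto

lemma finite_block_sums: "(\<And>i. i \<le> k \<Longrightarrow> finite (I i)) \<Longrightarrow> finite (block_sums \<kappa> I b T k)"
  unfolding block_sums_def by (intro finite_imageI finite_PiE finite_block_index) auto

text \<open>Only data up to stage \<open>k\<close> enter, which is what makes the recursive choice
  of later stages legitimate.\<close>

lemma block_sums_cong:
  assumes "\<And>i. i \<le> k \<Longrightarrow> I i = I' i" "\<And>i. i \<le> k \<Longrightarrow> b i = b' i" "\<And>i. i \<le> k \<Longrightarrow> T i = T' i"
  shows "block_sums \<kappa> I b T k = block_sums \<kappa> I' b' T' k"
proof -
  have idx: "block_index I k = block_index I' k" using assms(1) by (auto simp: block_index_def)
  have "block_vec b T i j = block_vec b' T' i j" if "i + 3 \<le> k" for i j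
    using assms(2)[of "i + 3"] assms(3)[of "i + 3"] assms(3)[of i] that by (simp add: block_vec_def)
  then show ?thesis unfolding block_sums_def idx
    by (intro image_cong refl sum.cong) (auto simp: block_index_def)
qed

section \<open>Recursive choice of the operators\<close>

context lip_c0
begin

text \<open>At stage n the earlier block sums are finitely many, so the functionals in their sets
  \<open>\<Phi>\<close> form a finite set that the new operator may be required to nearly preserve.
  The stages 0 and 1 are zero, so that later differences telescope from 0.\<close>

lemma approximating_sequence:
  fixes \<Phi> :: "nat \<Rightarrow> 'a \<Rightarrow> ('a \<Rightarrow>\<^sub>L real) set"
  assumes K: "1 \<le> K"
    and appr: "\<And>(E :: 'a set) (F :: ('a \<Rightarrow>\<^sub>L real) set) \<epsilon>. finite E \<Longrightarrow> finite F \<Longrightarrow> 0 < \<epsilon> \<Longrightarrow>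
      \<exists>I a b T. fac K I a b T \<and> (\<forall>e\<in>E. norm (blinfun_apply T e - e) \<le> \<epsilon>) \<and> (\<forall>f\<in>F. norm ((f o\<^sub>L T) - f) \<le> \<epsilon>)"
    and \<Phi>: "\<And>k x. finite (\<Phi> k x)" and \<epsilon>: "0 < \<epsilon>\<^sub>1" "0 < \<epsilon>\<^sub>2"
  obtains I a b and T :: "nat \<Rightarrow> 'a \<Rightarrow>\<^sub>L 'a" where
    "\<And>n. fac K (I n) (a n) (b n) (T n)" "T 0 = 0" "T 1 = 0" "\<And>x. (\<lambda>n. blinfun_apply (T n) x) \<longlonglongrightarrow> x"
    "\<And>k n. k < n \<Longrightarrow> norm ((T n o\<^sub>L T k) - T k) \<le> \<epsilon>\<^sub>1 * (1/2)^n \<and> norm ((T k o\<^sub>L T n) - T k) \<le> \<epsilon>\<^sub>1 * (1/2)^n"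
    "\<And>k n x \<phi>. k < n \<Longrightarrow> 2 \<le> n \<Longrightarrow> x \<in> block_sums \<kappa> I b T k \<Longrightarrow> \<phi> \<in> \<Phi> k x \<Longrightarrow> norm ((\<phi> o\<^sub>L T n) - \<phi>) \<le> \<epsilon>\<^sub>2"
proof -
  obtain d :: "nat \<Rightarrow> 'a" where d: "\<And>x e. e > 0 \<Longrightarrow> \<exists>n. norm (d n - x) < e"
    using dense_sequence by blast
  define Is where "Is s n = fst (s n)" for s :: "nat \<Rightarrow> nat set \<times> (nat \<Rightarrow> 'a \<Rightarrow>\<^sub>L real) \<times> (nat \<Rightarrow> 'a) \<times> ('a \<Rightarrow>\<^sub>L 'a)" and n
  define As where "As s n = fst (snd (s n))" for s :: "nat \<Rightarrow> nat set \<times> (nat \<Rightarrow> 'a \<Rightarrow>\<^sub>L real) \<times> (nat \<Rightarrow> 'a) \<times> ('a \<Rightarrow>\<^sub>L 'a)" and n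
  define Bs where "Bs s n = fst (snd (snd (s n)))" for s :: "nat \<Rightarrow> nat set \<times> (nat \<Rightarrow> 'a \<Rightarrow>\<^sub>L real) \<times> (nat \<Rightarrow> 'a) \<times> ('a \<Rightarrow>\<^sub>L 'a)" and n
  define Ts where "Ts s n = snd (snd (snd (s n)))" for s :: "nat \<Rightarrow> nat set \<times> (nat \<Rightarrow> 'a \<Rightarrow>\<^sub>L real) \<times> (nat \<Rightarrow> 'a) \<times> ('a \<Rightarrow>\<^sub>L 'a)" and n
  note defs = Is_def As_def Bs_def Ts_def
  define good where "good s n I a b T \<longleftrightarrow> fac K I a b T \<and>
      (\<forall>k<n. norm ((T o\<^sub>L Ts s k) - Ts s k) \<le> \<epsilon>\<^sub>1 * (1/2)^n \<and> norm ((Ts s k o\<^sub>L T) - Ts s k) \<le> \<epsilon>\<^sub>1 * (1/2)^n) \<and>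
      (\<forall>k<n. norm (blinfun_apply T (d k) - d k) \<le> (1/2)^n) \<and>
      (\<forall>k<n. \<forall>x\<in>block_sums \<kappa> (Is s) (Bs s) (Ts s) k. \<forall>\<phi>\<in>\<Phi> k x. norm ((\<phi> o\<^sub>L T) - \<phi>) \<le> \<epsilon>\<^sub>2)"
    for s n I a b T
  define P where "P s n r \<longleftrightarrow> (if n < 2 then r = ({}, \<lambda>_. 0, \<lambda>_. 0, 0)
      else good s n (fst r) (fst (snd r)) (fst (snd (snd r))) (snd (snd (snd r))))" for s n r
  have zfac: "fac K {} (\<lambda>_. 0) (\<lambda>_. 0) (0 :: 'a \<Rightarrow>\<^sub>L 'a)" using K by (simp add: fac_def)
  have Pfac: "fac K (Is s n) (As s n) (Bs s n) (Ts s n)" if "P s n (s n)" for s :: "nat \<Rightarrow> nat set \<times> (nat \<Rightarrow> 'a \<Rightarrow>\<^sub>L real) \<times> (nat \<Rightarrow> 'a) \<times> ('a \<Rightarrow>\<^sub>L 'a)" and n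
    using that zfac by (auto simp: P_def good_def defs split: if_splits)
  have "\<exists>s. \<forall>n. P s n (s n)"
  proof (rule dependent_wellorder_choice)
    fix r n and s s' :: "nat \<Rightarrow> nat set \<times> (nat \<Rightarrow> 'a \<Rightarrow>\<^sub>L real) \<times> (nat \<Rightarrow> 'a) \<times> ('a \<Rightarrow>\<^sub>L 'a)" assume eq: "\<And>y. y < n \<Longrightarrow> s y = s' y"
    \<comment> \<open>First obligation of the recursion: the condition at stage n depends on the
      earlier stages only.\<close>
    have bs: "block_sums \<kappa> (Is s) (Bs s) (Ts s) k = block_sums \<kappa> (Is s') (Bs s') (Ts s') k" if "k < n" for k
      by (rule block_sums_cong) (use eq that in \<open>auto simp: defs\<close>)
    have "good s n I a b T = good s' n I a b T" for I a b T
      unfolding good_def using eq bs by (simp add: defs cong: conj_cong)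
    then show "P s n r = P s' n r" by (simp add: P_def)
  next
    fix n and s :: "nat \<Rightarrow> nat set \<times> (nat \<Rightarrow> 'a \<Rightarrow>\<^sub>L real) \<times> (nat \<Rightarrow> 'a) \<times> ('a \<Rightarrow>\<^sub>L 'a)" assume prev: "\<And>y. y < n \<Longrightarrow> P s y (s y)"
    show "\<exists>r. P s n r"
    proof (cases "n < 2")
      case True
      then show ?thesis by (auto simp: P_def)
    next
      case False
      have fac: "fac K (Is s k) (As s k) (Bs s k) (Ts s k)" if "k \<in> {..<n}" for k
        using that prev by (intro Pfac) auto
      define F where "F = (\<Union>k\<in>{..<n}. \<Union>x\<in>block_sums \<kappa> (Is s) (Bs s) (Ts s) k. \<Phi> k x)"
      have "finite F" unfolding F_def using facD(1)[OF fac] \<Phi>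
        by (intro finite_UN_I finite_block_sums) auto
      define \<epsilon>' where "\<epsilon>' = min (min (\<epsilon>\<^sub>1 * (1/2)^n) ((1/2)^n)) \<epsilon>\<^sub>2"
      have \<epsilon>': "0 < \<epsilon>'" "\<epsilon>' \<le> \<epsilon>\<^sub>1 * (1/2)^n" "\<epsilon>' \<le> (1/2)^n" "\<epsilon>' \<le> \<epsilon>\<^sub>2" using \<epsilon> by (auto simp: \<epsilon>'_def)
      have "\<exists>I a b T. fac K I a b T \<and> (\<forall>e\<in>d ` {..<n}. norm (blinfun_apply T e - e) \<le> \<epsilon>') \<and>
          (\<forall>f\<in>F. norm ((f o\<^sub>L T) - f) \<le> \<epsilon>') \<and>
          (\<forall>k\<in>{..<n}. norm ((T o\<^sub>L Ts s k) - Ts s k) \<le> \<epsilon>' \<and> norm ((Ts s k o\<^sub>L T) - Ts s k) \<le> \<epsilon>')"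
        by (rule finite_rank_approximation[OF K appr, where I="Is s" and a="As s" and b="Bs s"])
           (use fac \<open>finite F\<close> \<epsilon>'(1) in auto)
      then obtain I a b T where T: "fac K I a b T" "\<forall>e\<in>d ` {..<n}. norm (blinfun_apply T e - e) \<le> \<epsilon>'"
        "\<forall>f\<in>F. norm ((f o\<^sub>L T) - f) \<le> \<epsilon>'"
        "\<forall>k\<in>{..<n}. norm ((T o\<^sub>L Ts s k) - Ts s k) \<le> \<epsilon>' \<and> norm ((Ts s k o\<^sub>L T) - Ts s k) \<le> \<epsilon>'"
        by blast
      have "good s n I a b T"
        unfolding good_def
      proof (intro conjI allI impI ballI)
        show "fac K I a b T" by (rule T(1))
        fix k assume k: "k < n"
        show "norm ((T o\<^sub>L Ts s k) - Ts s k) \<le> \<epsilon>\<^sub>1 * (1/2)^n" "norm ((Ts s k o\<^sub>L T) - Ts s k) \<le> \<epsilon>\<^sub>1 * (1/2)^n"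
          using T(4) k \<epsilon>'(2) by (meson lessThan_iff order_trans)+
        show "norm (blinfun_apply T (d k) - d k) \<le> (1/2)^n"
          using T(2) k \<epsilon>'(3) by (meson imageI lessThan_iff order_trans)
        fix x \<phi> assume "x \<in> block_sums \<kappa> (Is s) (Bs s) (Ts s) k" "\<phi> \<in> \<Phi> k x"
        then have "\<phi> \<in> F" using k by (auto simp: F_def)
        then show "norm ((\<phi> o\<^sub>L T) - \<phi>) \<le> \<epsilon>\<^sub>2" using T(3) \<epsilon>'(4) by (meson order_trans)
      qed
      then have "P s n (I, a, b, T)" using False by (simp add: P_def)
      then show ?thesis by blast
    qed
  qed
  then obtain s where s: "\<And>n. P s n (s n)" by blast
  have zero: "Ts s n = 0" if "n < 2" for n using s[of n] that by (simp add: P_def defs)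
  have gd: "good s n (Is s n) (As s n) (Bs s n) (Ts s n)" if "2 \<le> n" for n
    using s[of n] that by (simp add: P_def defs)
  have fac: "fac K (Is s n) (As s n) (Bs s n) (Ts s n)" for n by (rule Pfac[OF s])
  have est: "norm ((Ts s n o\<^sub>L Ts s k) - Ts s k) \<le> \<epsilon>\<^sub>1 * (1/2)^n \<and> norm ((Ts s k o\<^sub>L Ts s n) - Ts s k) \<le> \<epsilon>\<^sub>1 * (1/2)^n"
    if "k < n" for k n
  proof (cases "2 \<le> n")
    case True
    then show ?thesis using gd[OF True] that by (simp add: good_def)
  next
    case False
    have "Ts s k = 0" using that False by (intro zero) simp
    then have "(Ts s n o\<^sub>L Ts s k) - Ts s k = 0" "(Ts s k o\<^sub>L Ts s n) - Ts s k = 0"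
      by (auto intro!: blinfun_eqI simp: blinfun.diff_left blinfun.zero_right)
    then show ?thesis using \<epsilon> by simp
  qed
  have lim: "(\<lambda>n. blinfun_apply (Ts s n) x) \<longlonglongrightarrow> x" for x
  proof (rule tendsto_identity_of_dense[OF d fac_norm[OF fac]])
    fix m
    show "(\<lambda>n. blinfun_apply (Ts s n) (d m) - d m) \<longlonglongrightarrow> 0"
    proof (rule Lim_null_comparison)
      show "\<forall>\<^sub>F n in sequentially. norm (blinfun_apply (Ts s n) (d m) - d m) \<le> (1/2)^n"
        unfolding eventually_sequentially using gd by (intro exI[of _ "m + 2"]) (auto simp: good_def)
      show "(\<lambda>n. (1/2)^n :: real) \<longlonglongrightarrow> 0" by (rule LIMSEQ_realpow_zero) auto
    qed
  qed
  have \<phi>: "norm ((\<phi> o\<^sub>L Ts s n) - \<phi>) \<le> \<epsilon>\<^sub>2" if "k < n" "2 \<le> n" "x \<in> block_sums \<kappa> (Is s) (Bs s) (Ts s) k" "\<phi> \<in> \<Phi> k x" for k n x \<phi>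
    using gd[OF that(2)] that unfolding good_def by blast
  have z01: "Ts s 0 = 0" "Ts s 1 = 0" by (auto intro: zero)
  show ?thesis by (rule that[of "Is s" "As s" "Bs s" "Ts s", OF fac z01 lim est \<phi>])
qed

end

section \<open>Unconditional boundedness of the blocks and the factorisation\<close>

context lip_c0
begin

text \<open>Within a residue class modulo 4, the blocks preceding block i involve only operators
  before T i. Flatness at their sum applies to block i, because T i and T (i + 3) nearly preserve
  the functionals belonging to that sum. So the q-th step raises the gauge by at most 1/2^(q+1), and
  it stays below 2; the four classes together give 8 * L.\<close>

lemma block_unconditional:
  fixes \<Phi> :: "nat \<Rightarrow> 'a \<Rightarrow> ('a \<Rightarrow>\<^sub>L real) set" and T :: "nat \<Rightarrow> 'a \<Rightarrow>\<^sub>L 'a"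
  assumes K: "1 \<le> K" and fac: "\<And>n. fac K (I n) (a n) (b n) (T n)"
    and \<kappa>: "\<kappa> = 1 / (4 * L * (K * K * K))"
    and \<Phi>: "\<And>k x z \<rho> h. 1 \<le> \<rho> \<Longrightarrow> \<rho> \<le> 2 \<Longrightarrow> (\<forall>h\<in>dball. blinfun_apply h x \<le> \<rho>) \<Longrightarrow> norm z \<le> 1 / (2 * L) \<Longrightarrow>
      (\<forall>\<phi>\<in>\<Phi> k x. \<bar>blinfun_apply \<phi> z\<bar> \<le> 1) \<Longrightarrow> h \<in> dball \<Longrightarrow> blinfun_apply h (x + z) \<le> \<rho> + (1/2)^(k + 1)"
    and small: "\<And>k n x \<phi>. k < n \<Longrightarrow> 2 \<le> n \<Longrightarrow> x \<in> block_sums \<kappa> I b T k \<Longrightarrow> \<phi> \<in> \<Phi> k x \<Longrightarrow> norm ((\<phi> o\<^sub>L T n) - \<phi>) \<le> 1 / (2 * K)"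
    and t: "\<And>i j. i < 4 * q \<Longrightarrow> j \<in> I (i + 3) \<Longrightarrow> \<bar>t i j\<bar> \<le> (1::real)"
  shows "norm (\<Sum>i<4 * q. \<Sum>j\<in>I (i + 3). t i j *\<^sub>R \<kappa> *\<^sub>R block_vec b T i j) \<le> 8 * L"
proof -
  have K0: "0 < K" "0 < K * K * K" using K by auto
  have L0: "0 < L" using L1 by simp
  have \<kappa>0: "0 < \<kappa>" using K0 L0 by (simp add: \<kappa>)
  have K3: "1 \<le> K * K * K" using mult_mono[of 1 "K * K" 1 K] mult_mono[of 1 K 1 K] K by simp
  \<comment> \<open>\<open>\<kappa>\<close> is chosen so that a block, of norm at most 2 * (K * K) *
    K before scaling, shrinks to the size 1 / (2 * L) that flatness admits.\<close>
  have \<kappa>1: "\<kappa> \<le> 1" "\<kappa> * (2 * (K * K) * K) = 1 / (2 * L)"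
    using K3 L1 K0 mult_mono[of 1 L 1 "K * K * K"] by (auto simp: \<kappa> divide_le_eq_1 field_simps)
  have finI: "finite (I n)" for n by (rule facD(1)[OF fac])
  define G where "G e i = (\<Sum>j\<in>I (i + 3). e i j *\<^sub>R \<kappa> *\<^sub>R block_vec b T i j)" for e i
  have Geq: "G e i = \<kappa> *\<^sub>R blinfun_apply (T (i + 3) - T i) (\<Sum>j\<in>I (i + 3). e i j *\<^sub>R b (i + 3) j)" for e i
    by (simp add: G_def block_vec_def blinfun.sum_right blinfun.scaleR_right scaleR_sum_right mult.commute)
  have Tn: "norm (T n) \<le> K * K" for n by (rule fac_norm[OF fac])
  have sumb: "norm (\<Sum>j\<in>I (i + 3). e i j *\<^sub>R b (i + 3) j) \<le> K" if "\<And>j. \<bar>e i j\<bar> \<le> 1" for e i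
    using that by (intro facD(3)[OF fac]) auto
  have Gn: "norm (G e i) \<le> 1 / (2 * L)" if e: "\<And>j. \<bar>e i j\<bar> \<le> 1" for e i
  proof -
    have "norm (T (i + 3) - T i) \<le> 2 * (K * K)" using norm_triangle_ineq4[of "T (i + 3)" "T i"] Tn[of "i + 3"] Tn[of i] by linarith
    then have "norm (blinfun_apply (T (i + 3) - T i) (\<Sum>j\<in>I (i + 3). e i j *\<^sub>R b (i + 3) j)) \<le> 2 * (K * K) * K"
      using sumb[of e i, OF e] by (intro order_trans[OF norm_blinfun] mult_mono) auto
    then have "norm (G e i) \<le> \<kappa> * (2 * (K * K) * K)" unfolding Geq using \<kappa>0 by (simp add: mult_left_mono)
    then show ?thesis using \<kappa>1(2) by simp
  qed
  have signs: "norm (\<Sum>k<q. G e (4 * k + r)) \<le> 2 * L"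
    if e: "\<And>i j. e i j = 1 \<or> e i j = (-1::real)" and r: "r < 4" for e r q
  proof -
    have e1: "\<bar>e i j\<bar> \<le> 1" for i j using e[of i j] by auto
    have "\<forall>h\<in>dball. blinfun_apply h (\<Sum>k<q. G e (4 * k + r)) \<le> 2 - (1/2)^q" for q
    proof (induction q)
      case 0
      then show ?case by (simp add: blinfun.zero_right)
    next
      case (Suc q)
      define x where "x = (\<Sum>k<q. G e (4 * k + r))"
      define i where "i = 4 * q + r"
      have zn: "norm (G e i) \<le> 1 / (2 * L)" by (rule Gn[of e i]) (rule e1)
      show ?case
      proof (cases "q = 0")
        \<comment> \<open>The first block of a class may have no stage before it, but its size alone
          bounds its gauge by 1/2.\<close>
        case True
        show ?thesis
        proof
          fix h assume h: "h \<in> dball"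
          have "blinfun_apply h (G e r) \<le> L * norm (G e r)" using norm_le_dball[OF h, of "G e r"] by (simp add: abs_le_iff)
          also have "\<dots> \<le> L * (1 / (2 * L))" using zn True L0 by (intro mult_left_mono) (auto simp: i_def)
          also have "\<dots> = 1 / 2" using L0 by simp
          finally show "blinfun_apply h (\<Sum>k<Suc q. G e (4 * k + r)) \<le> 2 - (1/2)^Suc q" using True by simp
        qed
      next
        case False
        \<comment> \<open>The last stage before T i; the preceding block of the class, i - 4, ends
          exactly there with T (i - 1).\<close>
        define k where "k = i - 1"
        have k: "k < i" "k + 1 = i" "2 \<le> i" "q + 1 \<le> k + 1" using False by (auto simp: k_def i_def)
        have xS: "x \<in> block_sums \<kappa> I b T k"
        proof -
          define e' where "e' p = (if \<exists>m<q. fst p = 4 * m + r then e (fst p) (snd p) else 0)" for p :: "nat \<times> nat"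
          have inj: "inj_on (\<lambda>m. 4 * m + r) {..<q}" by (auto simp: inj_on_def)
          have "(\<Sum>p\<in>block_index I k. e' p *\<^sub>R \<kappa> *\<^sub>R block_vec b T (fst p) (snd p))
              = (\<Sum>i'\<in>{i'. i' + 3 \<le> k}. \<Sum>j\<in>I (i' + 3). e' (i', j) *\<^sub>R \<kappa> *\<^sub>R block_vec b T i' j)"
          proof -
            have "finite {i'. i' + 3 \<le> k}" by (rule finite_subset[of _ "{..k}"]) auto
            then show ?thesis unfolding block_index_def using finI by (subst sum.Sigma) (auto simp: case_prod_beta)
          qed
          also have "\<dots> = (\<Sum>i'\<in>(\<lambda>m. 4 * m + r) ` {..<q}. G e i')"
          proof (rule sum.mono_neutral_cong_right)
            show "finite {i'. i' + 3 \<le> k}" by (rule finite_subset[of _ "{..k}"]) auto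
            show "(\<lambda>m. 4 * m + r) ` {..<q} \<subseteq> {i'. i' + 3 \<le> k}" by (auto simp: k_def i_def)
            show "\<forall>i'\<in>{i'. i' + 3 \<le> k} - (\<lambda>m. 4 * m + r) ` {..<q}. (\<Sum>j\<in>I (i' + 3). e' (i', j) *\<^sub>R \<kappa> *\<^sub>R block_vec b T i' j) = 0"
              by (auto simp: e'_def intro!: sum.neutral)
            show "(\<Sum>j\<in>I (i' + 3). e' (i', j) *\<^sub>R \<kappa> *\<^sub>R block_vec b T i' j) = G e i'" if "i' \<in> (\<lambda>m. 4 * m + r) ` {..<q}" for i'
              using that by (auto simp: G_def e'_def intro!: sum.cong)
          qed
          also have "\<dots> = x" using inj by (simp add: x_def sum.reindex)
          finally have eq: "(\<Sum>p\<in>block_index I k. e' p *\<^sub>R \<kappa> *\<^sub>R block_vec b T (fst p) (snd p)) = x" .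
          have "e' p \<in> {-1, 0, 1}" for p
            using e[of "fst p" "snd p"] by (simp add: e'_def) blast
          then have "restrict e' (block_index I k) \<in> (\<Pi>\<^sub>E p\<in>block_index I k. {-1, 0, 1})" by simp
          moreover have "(\<Sum>p\<in>block_index I k. restrict e' (block_index I k) p *\<^sub>R \<kappa> *\<^sub>R block_vec b T (fst p) (snd p)) = x"
            using eq by simp
          ultimately show ?thesis unfolding block_sums_def by blast
        qed
        have \<phi>: "\<bar>blinfun_apply \<phi> (G e i)\<bar> \<le> 1" if \<phi>: "\<phi> \<in> \<Phi> k x" for \<phi>
        proof -
          have 1: "norm ((\<phi> o\<^sub>L T (i + 3)) - \<phi>) \<le> 1 / (2 * K)" "norm ((\<phi> o\<^sub>L T i) - \<phi>) \<le> 1 / (2 * K)"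
            using k by (intro small[OF _ _ xS \<phi>]; simp)+
          define y where "y = (\<Sum>j\<in>I (i + 3). e i j *\<^sub>R b (i + 3) j)"
          have yn: "norm y \<le> K" unfolding y_def by (rule sumb[of e i]) (rule e1)
          \<comment> \<open>Inserting \<open>\<phi>\<close> y splits the difference of operators
            into two adjoint errors, each at most 1 / (2 * K) on a vector of norm at most
            \<open>K\<close>.\<close>
          have "blinfun_apply \<phi> (G e i) = \<kappa> * (blinfun_apply ((\<phi> o\<^sub>L T (i + 3)) - \<phi>) y - blinfun_apply ((\<phi> o\<^sub>L T i) - \<phi>) y)"
            by (simp add: Geq y_def blinfun.scaleR_right blinfun.diff_left blinfun.diff_right)
          also have "\<bar>\<dots>\<bar> \<le> 1 * (1 / 2 + 1 / 2)"
            unfolding abs_mult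
          proof (rule mult_mono)
            have "\<bar>blinfun_apply g y\<bar> \<le> 1 / 2" if "norm g \<le> 1 / (2 * K)" for g :: "'a \<Rightarrow>\<^sub>L real"
            proof -
              have "\<bar>blinfun_apply g y\<bar> \<le> 1 / (2 * K) * K"
                using norm_blinfun[of g y] mult_mono[OF that yn] K0 by simp
              then show ?thesis using K0 by simp
            qed
            from this[OF 1(1)] this[OF 1(2)]
            show "\<bar>blinfun_apply ((\<phi> o\<^sub>L T (i + 3)) - \<phi>) y - blinfun_apply ((\<phi> o\<^sub>L T i) - \<phi>) y\<bar> \<le> 1 / 2 + 1 / 2"
              by linarith
          qed (use \<kappa>0 \<kappa>1 in auto)
          finally show ?thesis by simp
        qed
        show ?thesis
        proof
          fix h assume h: "h \<in> dball"
          have "(1/2::real)^q \<le> 1" by (simp add: power_le_one)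
          then have \<rho>: "1 \<le> 2 - (1/2::real)^q" "2 - (1/2::real)^q \<le> 2" by auto
          have "blinfun_apply h (x + G e i) \<le> 2 - (1/2)^q + (1/2)^(k + 1)"
            by (rule \<Phi>[OF \<rho> _ zn _ h]) (use Suc \<phi> in \<open>auto simp: x_def\<close>)
          also have "(1/2::real)^(k + 1) \<le> (1/2)^(q + 1)" using k(4) by (intro power_decreasing) auto
          finally have "blinfun_apply h (x + G e i) \<le> 2 - (1/2)^q + (1/2)^(q + 1)" by simp
          also have "\<dots> = 2 - (1/2)^Suc q" by simp
          finally show "blinfun_apply h (\<Sum>k<Suc q. G e (4 * k + r)) \<le> 2 - (1/2)^Suc q" by (simp add: x_def i_def)
        qed
      qed
    qed
    then have b2: "blinfun_apply h (\<Sum>k<q. G e (4 * k + r)) \<le> 2 - (1/2)^q" if "h \<in> dball" for h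
      using that by blast
    have "blinfun_apply h (\<Sum>k<q. G e (4 * k + r)) \<le> 2" if "h \<in> dball" for h
      by (rule order_trans[OF b2[OF that]]) simp
    from norm_le_of_dball[OF this] show ?thesis by (simp add: mult.commute)
  qed
  have real_case: "norm (\<Sum>k<q. G t (4 * k + r)) \<le> 2 * L" if r: "r < 4" for r
  proof -
    define A where "A = Sigma {..<q} (\<lambda>k. I (4 * k + r + 3))"
    have finA: "finite A" using finI by (simp add: A_def)
    have sumA: "(\<Sum>k<q. G e (4 * k + r)) = (\<Sum>p\<in>A. e (4 * fst p + r) (snd p) *\<^sub>R \<kappa> *\<^sub>R block_vec b T (4 * fst p + r) (snd p))" for e
      unfolding A_def G_def using finI by (subst sum.Sigma) (auto simp: case_prod_beta)
    show ?thesis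
      unfolding sumA
    proof (rule norm_sum_scaleR_le_of_signs[OF finA])
      fix p assume "p \<in> A"
      then show "\<bar>t (4 * fst p + r) (snd p)\<bar> \<le> 1" using r by (intro t) (auto simp: A_def)
    next
      fix e :: "nat \<times> nat \<Rightarrow> real" assume e: "\<And>p. p \<in> A \<Longrightarrow> e p = 1 \<or> e p = -1"
      \<comment> \<open>Since r < 4, division by 4 recovers the position within the class; signs off
        \<open>A\<close> are filled with 1.\<close>
      define e' where "e' i j = (if (i div 4, j) \<in> A then e (i div 4, j) else 1)" for i j
      have "norm (\<Sum>k<q. G e' (4 * k + r)) \<le> 2 * L" by (rule signs) (use e r in \<open>auto simp: e'_def\<close>)
      then show "norm (\<Sum>p\<in>A. e p *\<^sub>R \<kappa> *\<^sub>R block_vec b T (4 * fst p + r) (snd p)) \<le> 2 * L"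
        unfolding sumA using r by (simp add: e'_def cong: sum.cong)
    qed
  qed
  have "(\<Sum>i<4 * q. \<Sum>j\<in>I (i + 3). t i j *\<^sub>R \<kappa> *\<^sub>R block_vec b T i j) = (\<Sum>r<4. \<Sum>k<q. G t (4 * k + r))"
    by (simp only: G_def sum_lessThan_mult_4)
  also have "norm \<dots> \<le> of_nat (card {..<4::nat}) * (2 * L)"
    by (rule sum_norm_bound) (use real_case in auto)
  finally show ?thesis by simp
qed

text \<open>\<open>J\<close> lists the coefficients of the vectors R i x in the factorisations of T
  (i + 3), and \<open>S\<close> sums the block vectors. S o J is then the sum of the
  \<open>W i\<close>, within 1/2 of the sum of the \<open>R i\<close>, which is the
  identity.\<close>

lemma near_factorization:
  obtains S :: "czero \<Rightarrow> 'a" and J :: "'a \<Rightarrow> czero" where "bounded_linear S" "bounded_linear J"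
    "\<And>x. norm (S (J x) - x) \<le> norm x / 2"
proof -
  obtain K where K: "1 \<le> K" and appr: "\<And>(E :: 'a set) (F :: ('a \<Rightarrow>\<^sub>L real) set) \<epsilon>. finite E \<Longrightarrow> finite F \<Longrightarrow> 0 < \<epsilon> \<Longrightarrow>
      \<exists>I a b T. fac K I a b T \<and> (\<forall>e\<in>E. norm (blinfun_apply T e - e) \<le> \<epsilon>) \<and> (\<forall>f\<in>F. norm ((f o\<^sub>L T) - f) \<le> \<epsilon>)"
    by (rule two_sided_approximation, rule that)
  have K0: "0 < K" using K by simp
  have L0: "0 < L" using L1 by simp
  define flat where "flat k x \<Phi> \<longleftrightarrow> finite \<Phi> \<and> (\<forall>z \<rho> h. 1 \<le> \<rho> \<longrightarrow> \<rho> \<le> 2 \<longrightarrow> (\<forall>h\<in>dball. blinfun_apply h x \<le> \<rho>) \<longrightarrow> norm z \<le> 1 / (2 * L) \<longrightarrow>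
      (\<forall>\<phi>\<in>\<Phi>. \<bar>blinfun_apply \<phi> z\<bar> \<le> 1) \<longrightarrow> h \<in> dball \<longrightarrow> blinfun_apply h (x + z) \<le> \<rho> + (1/2)^(k + 1))"
    for k :: nat and x :: 'a and \<Phi> :: "('a \<Rightarrow>\<^sub>L real) set"
  have "\<exists>\<Phi>. flat k x \<Phi>" for k x
  proof -
    have "0 < (1/2::real)^(k + 1)" by simp
    then obtain \<Phi> :: "('a \<Rightarrow>\<^sub>L real) set" where \<Phi>: "finite \<Phi>"
      "\<And>z \<rho> h. 1 \<le> \<rho> \<Longrightarrow> \<rho> \<le> 2 \<Longrightarrow> (\<And>h. h \<in> dball \<Longrightarrow> blinfun_apply h x \<le> \<rho>) \<Longrightarrow> norm z \<le> 1 / (2 * L) \<Longrightarrow>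
      (\<And>\<phi>. \<phi> \<in> \<Phi> \<Longrightarrow> \<bar>blinfun_apply \<phi> z\<bar> \<le> 1) \<Longrightarrow> h \<in> dball \<Longrightarrow> blinfun_apply h (x + z) \<le> \<rho> + (1/2)^(k + 1)"
      using asymptotic_flatness[of "(1/2::real)^(k + 1)" x] by metis
    then have "flat k x \<Phi>" unfolding flat_def by blast
    then show ?thesis by blast
  qed
  then obtain \<Phi> where flat: "\<And>k x. flat k x (\<Phi> k x)" by metis
  have fin\<Phi>: "finite (\<Phi> k x)" for k x using flat[of k x] by (simp add: flat_def)
  have \<Phi>: "blinfun_apply h (x + z) \<le> \<rho> + (1/2)^(k + 1)"
    if "1 \<le> \<rho>" "\<rho> \<le> 2" "\<forall>h\<in>dball. blinfun_apply h x \<le> \<rho>" "norm z \<le> 1 / (2 * L)"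
      "\<forall>\<phi>\<in>\<Phi> k x. \<bar>blinfun_apply \<phi> z\<bar> \<le> 1" "h \<in> dball" for k x z \<rho> h
    using flat[of k x] that unfolding flat_def by blast
  define \<kappa> where "\<kappa> = 1 / (4 * L * (K * K * K))"
  have \<kappa>0: "0 < \<kappa>" using K0 L0 by (simp add: \<kappa>_def)
  \<comment> \<open>Matched to the bound \<open>WR\<close>, where the factor 4 * (K * K) + 4
    appears.\<close>
  define \<epsilon>1 where "\<epsilon>1 = 1 / (8 * (K * K) + 8)"
  have KK8: "0 < 8 * (K * K) + 8" using K0 by (simp add: add_pos_pos)
  have \<epsilon>1: "0 < \<epsilon>1" "(4 * (K * K) + 4) * \<epsilon>1 = 1 / 2" using KK8 by (auto simp: \<epsilon>1_def field_simps)
  have \<epsilon>2: "0 < 1 / (2 * K)" using K0 by simp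
  obtain I a b and T :: "nat \<Rightarrow> 'a \<Rightarrow>\<^sub>L 'a" where
    fac: "\<And>n. fac K (I n) (a n) (b n) (T n)" and T01: "T 0 = 0" "T 1 = 0"
    and Tlim: "\<And>x. (\<lambda>n. blinfun_apply (T n) x) \<longlonglongrightarrow> x"
    and est: "\<And>k n. k < n \<Longrightarrow> norm ((T n o\<^sub>L T k) - T k) \<le> \<epsilon>1 * (1/2)^n \<and> norm ((T k o\<^sub>L T n) - T k) \<le> \<epsilon>1 * (1/2)^n"
    and small: "\<And>k n x \<phi>. k < n \<Longrightarrow> 2 \<le> n \<Longrightarrow> x \<in> block_sums \<kappa> I b T k \<Longrightarrow> \<phi> \<in> \<Phi> k x \<Longrightarrow> norm ((\<phi> o\<^sub>L T n) - \<phi>) \<le> 1 / (2 * K)"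
    by (rule approximating_sequence[of K \<Phi> \<epsilon>1 "1 / (2 * K)" \<kappa>, OF K appr fin\<Phi> \<epsilon>1(1) \<epsilon>2], assumption+, rule that)
  have finI: "finite (I n)" for n by (rule facD(1)[OF fac])
  have ub: "norm (\<Sum>i<4 * q. \<Sum>j\<in>I (i + 3). t i j *\<^sub>R \<kappa> *\<^sub>R block_vec b T i j) \<le> 8 * L"
    if "\<And>i j. i < 4 * q \<Longrightarrow> j \<in> I (i + 3) \<Longrightarrow> \<bar>t i j\<bar> \<le> (1::real)" for q t
    by (rule block_unconditional[OF K fac \<kappa>_def \<Phi> small that])
  define blk where "blk n = fst (prod_decode n)" for n
  define pos where "pos n = snd (prod_decode n)" for n
  have dec: "blk (prod_encode (i, j)) = i" "pos (prod_encode (i, j)) = j" for i j by (simp_all add: blk_def pos_def)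
  have enc: "prod_encode (blk n, pos n) = n" for n by (simp add: blk_def pos_def)
  \<comment> \<open>Codes of pairs outside the index sets carry the zero vector, so that the
    enumeration runs over all of nat.\<close>
  define v where "v n = (if pos n \<in> I (blk n + 3) then \<kappa> *\<^sub>R block_vec b T (blk n) (pos n) else 0)" for n
  have enc_sum: "(\<Sum>n\<in>prod_encode ` Sigma {..<q} (\<lambda>i. I (i + 3)). g n *\<^sub>R v n)
      = (\<Sum>i<q. \<Sum>j\<in>I (i + 3). g (prod_encode (i, j)) *\<^sub>R \<kappa> *\<^sub>R block_vec b T i j)" for q g
  proof -
    have "(\<Sum>n\<in>prod_encode ` Sigma {..<q} (\<lambda>i. I (i + 3)). g n *\<^sub>R v n)
        = (\<Sum>p\<in>Sigma {..<q} (\<lambda>i. I (i + 3)). g (prod_encode p) *\<^sub>R v (prod_encode p))"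
      by (rule sum.reindex_cong[OF inj_prod_encode refl refl])
    also have "\<dots> = (\<Sum>(i, j)\<in>Sigma {..<q} (\<lambda>i. I (i + 3)). g (prod_encode (i, j)) *\<^sub>R \<kappa> *\<^sub>R block_vec b T i j)"
      by (rule sum.cong) (auto simp: v_def dec)
    also have "\<dots> = (\<Sum>i<q. \<Sum>j\<in>I (i + 3). g (prod_encode (i, j)) *\<^sub>R \<kappa> *\<^sub>R block_vec b T i j)"
      using finI by (subst sum.Sigma) auto
    finally show ?thesis .
  qed
  have vbound: "norm (\<Sum>n<N. t n *\<^sub>R v n) \<le> 8 * L" if t: "\<And>n. n < N \<Longrightarrow> \<bar>t n\<bar> \<le> (1::real)" for N t
  proof -
    \<comment> \<open>As blk n <= n, the first N codes lie in the first N blocks; 4 * N gives a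
      number of blocks divisible by 4, as \<open>ub\<close> requires.\<close>
    define A where "A = prod_encode ` Sigma {..<4 * N} (\<lambda>i. I (i + 3))"
    have finA: "finite A" using finI by (simp add: A_def)
    have out: "v n = 0" if n: "n < N" "n \<notin> A" for n
    proof (rule ccontr)
      assume "v n \<noteq> 0"
      then have "pos n \<in> I (blk n + 3)" by (auto simp: v_def split: if_splits)
      moreover have "blk n \<le> n" using le_prod_encode_1[of "blk n" "pos n"] by (simp add: enc)
      ultimately have "prod_encode (blk n, pos n) \<in> A" unfolding A_def using n(1) by (intro imageI) auto
      with n(2) show False by (simp add: enc)
    qed
    have "(\<Sum>n<N. t n *\<^sub>R v n) = (\<Sum>n\<in>A. (if n < N then t n else 0) *\<^sub>R v n)"
      by (rule sum.mono_neutral_cong[OF finA]) (auto simp: out)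
    also have "\<dots> = (\<Sum>i<4 * N. \<Sum>j\<in>I (i + 3). (if prod_encode (i, j) < N then t (prod_encode (i, j)) else 0) *\<^sub>R \<kappa> *\<^sub>R block_vec b T i j)"
      unfolding A_def by (rule enc_sum)
    also have "norm \<dots> \<le> 8 * L" by (rule ub) (use t in auto)
    finally show ?thesis .
  qed
  obtain S where S: "bounded_linear S" "\<And>z. (\<lambda>n. cz z n *\<^sub>R v n) sums S z"
    by (rule c0_synthesis[OF vbound], assumption, rule that)
  define R where "R i = T (i + 2) - T (i + 1)" for i
  have Tn: "norm (T n) \<le> K * K" for n by (rule fac_norm[OF fac])
  have Rn: "norm (R i) \<le> 2 * (K * K)" for i
    unfolding R_def using norm_triangle_ineq4[of "T (i + 2)" "T (i + 1)"] Tn[of "i + 2"] Tn[of "i + 1"] by linarith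
  have Rlim: "(\<lambda>i. norm (blinfun_apply (R i) x)) \<longlonglongrightarrow> 0" for x
  proof -
    have "(\<lambda>i. blinfun_apply (T (i + 2)) x - blinfun_apply (T (i + 1)) x) \<longlonglongrightarrow> x - x"
      by (intro tendsto_diff LIMSEQ_ignore_initial_segment Tlim)
    then show ?thesis by (simp add: R_def blinfun.diff_left tendsto_norm_zero)
  qed
  \<comment> \<open>Division by \<open>\<kappa>\<close> cancels the scaling in
    \<open>v\<close>.\<close>
  define c where "c x n = (if pos n \<in> I (blk n + 3) then blinfun_apply (a (blk n + 3) (pos n)) (blinfun_apply (R (blk n)) x) / \<kappa> else 0)" for x n
  have cb: "\<bar>c x n\<bar> \<le> (K / \<kappa>) * norm (blinfun_apply (R (blk n)) x)" for x n
  proof (cases "pos n \<in> I (blk n + 3)")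
    case True
    have "\<bar>blinfun_apply (a (blk n + 3) (pos n)) (blinfun_apply (R (blk n)) x)\<bar> \<le> K * norm (blinfun_apply (R (blk n)) x)"
      using norm_blinfun[of "a (blk n + 3) (pos n)" "blinfun_apply (R (blk n)) x"]
        mult_right_mono[OF facD(2)[OF fac True] norm_ge_zero[of "blinfun_apply (R (blk n)) x"]] by simp
    then show ?thesis using True \<kappa>0 by (simp add: c_def divide_right_mono)
  next
    case False
    then show ?thesis using K0 \<kappa>0 by (simp add: c_def)
  qed
  \<comment> \<open>R i x tends to 0 with i, and each block contributes only finitely many
    coefficients.\<close>
  have clim: "c x \<longlonglongrightarrow> 0" for x
  proof (rule tendsto_0_of_finite_levels)
    fix e :: real assume e: "0 < e"
    have "0 < e * \<kappa> / K" using e \<kappa>0 K0 by simp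
    then obtain N where N: "\<And>i. i \<ge> N \<Longrightarrow> norm (blinfun_apply (R i) x) < e * \<kappa> / K"
      using LIMSEQ_D[OF Rlim[of x]] by fastforce
    have "{n. e \<le> \<bar>c x n\<bar>} \<subseteq> prod_encode ` Sigma {..<N} (\<lambda>i. I (i + 3))"
    proof
      fix n assume "n \<in> {n. e \<le> \<bar>c x n\<bar>}"
      then have n: "e \<le> \<bar>c x n\<bar>" by simp
      then have p: "pos n \<in> I (blk n + 3)" using e by (auto simp: c_def split: if_splits)
      have "e \<le> (K / \<kappa>) * norm (blinfun_apply (R (blk n)) x)" using n cb[of x n] by linarith
      then have "e * \<kappa> / K \<le> norm (blinfun_apply (R (blk n)) x)" using K0 \<kappa>0 by (simp add: field_simps)
      then have "blk n < N" using N[of "blk n"] by (meson not_le)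
      with p have "prod_encode (blk n, pos n) \<in> prod_encode ` Sigma {..<N} (\<lambda>i. I (i + 3))" by (intro imageI) auto
      then show "n \<in> prod_encode ` Sigma {..<N} (\<lambda>i. I (i + 3))" by (simp add: enc)
    qed
    then show "finite {n. e \<le> \<bar>c x n\<bar>}" by (rule finite_subset) (use finI in auto)
  qed
  define J where "J x = czs (c x)" for x
  have J: "cz (J x) n = c x n" for x n unfolding J_def by (rule cz_czs[OF clim])
  have blJ: "bounded_linear J"
  proof (rule bounded_linear_intro[where K="(K / \<kappa>) * (2 * (K * K))"])
    show "J (x + y) = J x + J y" for x y
      by (rule cz_eqI) (simp add: J c_def blinfun.add_right add_divide_distrib)
    show "J (r *\<^sub>R x) = r *\<^sub>R J x" for r x
      by (rule cz_eqI) (simp add: J c_def blinfun.scaleR_right)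
    show "norm (J x) \<le> norm x * ((K / \<kappa>) * (2 * (K * K)))" for x
    proof (rule norm_cz_le)
      fix n
      have "norm (blinfun_apply (R (blk n)) x) \<le> 2 * (K * K) * norm x"
        using norm_blinfun[of "R (blk n)" x] mult_right_mono[OF Rn[of "blk n"] norm_ge_zero[of x]] by linarith
      then have "(K / \<kappa>) * norm (blinfun_apply (R (blk n)) x) \<le> (K / \<kappa>) * (2 * (K * K) * norm x)"
        using K0 \<kappa>0 by (intro mult_left_mono) auto
      then have "\<bar>c x n\<bar> \<le> (K / \<kappa>) * (2 * (K * K) * norm x)" using cb[of x n] by linarith
      also have "\<dots> = norm x * ((K / \<kappa>) * (2 * (K * K)))" by simp
      finally show "\<bar>cz (J x) n\<bar> \<le> norm x * ((K / \<kappa>) * (2 * (K * K)))" by (simp only: J)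
    qed
  qed
  define W where "W i = (T (i + 3) - T i) o\<^sub>L (T (i + 3) o\<^sub>L R i)" for i
  have WR: "norm (W i - R i) \<le> (1/2) * (1/2)^(i + 1)" for i
  proof -
    have half: "\<epsilon>1 * (1/2)^n \<le> \<epsilon>1 * (1/2)^(i + 1)" if "i + 1 \<le> n" for n
      using that \<epsilon>1(1) by (intro mult_left_mono power_decreasing) auto
    define \<delta> where "\<delta> = \<epsilon>1 * (1/2)^(i + 1)"
    \<comment> \<open>T (i + 3) fixes \<open>R i\<close> up to \<open>e1\<close>, and T i nearly
      annihilates it; so the sandwich \<open>W i\<close> differs little from
      \<open>R i\<close>.\<close>
    define e1 where "e1 = (T (i + 3) o\<^sub>L R i) - R i"
    have e1: "norm e1 \<le> 2 * \<delta>"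
    proof -
      have "e1 = ((T (i + 3) o\<^sub>L T (i + 2)) - T (i + 2)) - ((T (i + 3) o\<^sub>L T (i + 1)) - T (i + 1))"
        by (rule blinfun_eqI) (simp add: e1_def R_def blinfun.diff_left blinfun.diff_right)
      also have "norm \<dots> \<le> \<delta> + \<delta>"
        unfolding \<delta>_def
        by (intro norm_triangle_le_diff add_mono order_trans[OF conjunct1[OF est] half]) auto
      finally show ?thesis by simp
    qed
    have e2: "norm (T i o\<^sub>L R i) \<le> 2 * \<delta>"
    proof -
      have "T i o\<^sub>L R i = ((T i o\<^sub>L T (i + 2)) - T i) - ((T i o\<^sub>L T (i + 1)) - T i)"
        by (rule blinfun_eqI) (simp add: R_def blinfun.diff_left blinfun.diff_right)
      also have "norm \<dots> \<le> \<delta> + \<delta>"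
        unfolding \<delta>_def
        by (intro norm_triangle_le_diff add_mono order_trans[OF conjunct2[OF est] half]) auto
      finally show ?thesis by simp
    qed
    have Tt: "norm (T (i + 3) - T i) \<le> 2 * (K * K)"
      using norm_triangle_ineq4[of "T (i + 3)" "T i"] Tn[of "i + 3"] Tn[of i] by linarith
    have "W i - R i = ((T (i + 3) - T i) o\<^sub>L e1) + e1 - (T i o\<^sub>L R i)"
      by (rule blinfun_eqI) (simp add: W_def e1_def blinfun.diff_left blinfun.diff_right blinfun.add_left)
    also have "norm \<dots> \<le> (2 * (K * K) * (2 * \<delta>) + 2 * \<delta>) + 2 * \<delta>"
    proof (intro norm_triangle_le_diff add_mono norm_triangle_mono e1 e2)
      show "norm ((T (i + 3) - T i) o\<^sub>L e1) \<le> 2 * (K * K) * (2 * \<delta>)"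
        using Tt e1 by (intro order_trans[OF norm_blinfun_compose] mult_mono) auto
    qed
    also have "\<dots> = ((4 * (K * K) + 4) * \<epsilon>1) * (1/2)^(i + 1)" by (simp add: \<delta>_def algebra_simps)
    finally show ?thesis by (simp only: \<epsilon>1(2))
  qed
  have SJ: "(\<lambda>q. \<Sum>i<q. blinfun_apply (W i) x) \<longlonglongrightarrow> S (J x)" for x
  proof -
    \<comment> \<open>\<open>S\<close> sums in the order of the codes, not block by block.
      Truncating J x to whole blocks and using continuity of \<open>S\<close> gives the sum over
      blocks.\<close>
    define zq where "zq q = czs (\<lambda>n. if blk n < q then c x n else 0)" for q
    have lim: "(\<lambda>n. if blk n < q then c x n else 0) \<longlonglongrightarrow> 0" for q
      by (rule Lim_null_comparison[OF _ tendsto_rabs_zero[OF clim[of x]]]) auto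
    have zq: "cz (zq q) n = (if blk n < q then c x n else 0)" for q n
      unfolding zq_def by (rule cz_czs[OF lim])
    have Szq: "S (zq q) = (\<Sum>i<q. blinfun_apply (W i) x)" for q
    proof -
      have "(\<lambda>n. cz (zq q) n *\<^sub>R v n) sums (\<Sum>n\<in>prod_encode ` Sigma {..<q} (\<lambda>i. I (i + 3)). cz (zq q) n *\<^sub>R v n)"
      proof (rule sums_finite)
        show "finite (prod_encode ` Sigma {..<q} (\<lambda>i. I (i + 3)))" using finI by simp
        fix n assume n: "n \<notin> prod_encode ` Sigma {..<q} (\<lambda>i. I (i + 3))"
        show "cz (zq q) n *\<^sub>R v n = 0"
        proof (rule ccontr)
          assume "cz (zq q) n *\<^sub>R v n \<noteq> 0"
          then have "blk n < q" "pos n \<in> I (blk n + 3)" by (auto simp: zq v_def split: if_splits)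
          then have "prod_encode (blk n, pos n) \<in> prod_encode ` Sigma {..<q} (\<lambda>i. I (i + 3))" by (intro imageI) auto
          with n show False by (simp add: enc)
        qed
      qed
      then have "S (zq q) = (\<Sum>n\<in>prod_encode ` Sigma {..<q} (\<lambda>i. I (i + 3)). cz (zq q) n *\<^sub>R v n)"
        using S(2) sums_unique2 by blast
      also have "\<dots> = (\<Sum>i<q. \<Sum>j\<in>I (i + 3). cz (zq q) (prod_encode (i, j)) *\<^sub>R \<kappa> *\<^sub>R block_vec b T i j)"
        by (rule enc_sum)
      also have "\<dots> = (\<Sum>i<q. blinfun_apply (W i) x)"
      proof (rule sum.cong[OF refl])
        fix i assume "i \<in> {..<q}"
        then have "(\<Sum>j\<in>I (i + 3). cz (zq q) (prod_encode (i, j)) *\<^sub>R \<kappa> *\<^sub>R block_vec b T i j)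
          = (\<Sum>j\<in>I (i + 3). blinfun_apply (a (i + 3) j) (blinfun_apply (R i) x) *\<^sub>R block_vec b T i j)"
          using \<kappa>0 by (intro sum.cong) (auto simp: zq dec c_def)
        also have "\<dots> = blinfun_apply (T (i + 3) - T i) (blinfun_apply (T (i + 3)) (blinfun_apply (R i) x))"
          unfolding facD(4)[OF fac[of "i + 3"], of "blinfun_apply (R i) x"]
          by (simp only: block_vec_def blinfun.sum_right blinfun.scaleR_right)
        finally show "(\<Sum>j\<in>I (i + 3). cz (zq q) (prod_encode (i, j)) *\<^sub>R \<kappa> *\<^sub>R block_vec b T i j) = blinfun_apply (W i) x"
          by (simp add: W_def)
      qed
      finally show ?thesis .
    qed
    have "zq \<longlonglongrightarrow> J x"
    proof (rule LIMSEQ_I)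
      fix e :: real assume e: "0 < e"
      have "0 < e / 2 * \<kappa> / K" using e \<kappa>0 K0 by simp
      then obtain N where N: "\<And>i. i \<ge> N \<Longrightarrow> norm (blinfun_apply (R i) x) < e / 2 * \<kappa> / K"
        using LIMSEQ_D[OF Rlim[of x]] by fastforce
      have "norm (zq q - J x) < e" if q: "q \<ge> N" for q
      proof -
        have "norm (zq q - J x) \<le> e / 2"
        proof (rule norm_cz_le)
          fix n
          show "\<bar>cz (zq q - J x) n\<bar> \<le> e / 2"
          proof (cases "blk n < q")
            case False
            then have "norm (blinfun_apply (R (blk n)) x) \<le> e / 2 * \<kappa> / K" using N[of "blk n"] q by simp
            then have "(K / \<kappa>) * norm (blinfun_apply (R (blk n)) x) \<le> (K / \<kappa>) * (e / 2 * \<kappa> / K)"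
              using K0 \<kappa>0 by (intro mult_left_mono) auto
            with cb[of x n] have "\<bar>c x n\<bar> \<le> (K / \<kappa>) * (e / 2 * \<kappa> / K)" by (rule order_trans)
            then show ?thesis using False K0 \<kappa>0 by (simp add: zq J)
          qed (use e in \<open>simp add: zq J\<close>)
        qed
        then show ?thesis using e by simp
      qed
      then show "\<exists>no. \<forall>n\<ge>no. norm (zq n - J x) < e" by blast
    qed
    from bounded_linear.tendsto[OF S(1) this] show ?thesis by (simp only: Szq)
  qed
  have "norm (S (J x) - x) \<le> norm x / 2" for x
  proof -
    have tel: "(\<Sum>i<q. blinfun_apply (R i) x) = blinfun_apply (T (q + 1)) x" for q
      by (induction q) (simp_all add: R_def blinfun.diff_left T01(2)[simplified])
    have lim: "(\<lambda>q. (\<Sum>i<q. blinfun_apply (W i) x) - (\<Sum>i<q. blinfun_apply (R i) x)) \<longlonglongrightarrow> S (J x) - x"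
      unfolding tel by (intro tendsto_diff SJ LIMSEQ_ignore_initial_segment Tlim)
    have "norm ((\<Sum>i<q. blinfun_apply (W i) x) - (\<Sum>i<q. blinfun_apply (R i) x)) \<le> norm x / 2" for q
    proof -
      have "(\<Sum>i<q. blinfun_apply (W i) x) - (\<Sum>i<q. blinfun_apply (R i) x) = (\<Sum>i<q. blinfun_apply (W i - R i) x)"
        by (simp add: sum_subtractf blinfun.diff_left)
      also have "norm \<dots> \<le> (\<Sum>i<q. (1/2) * (1/2)^(i + 1) * norm x)"
        by (rule sum_norm_le) (rule order_trans[OF norm_blinfun mult_right_mono[OF WR norm_ge_zero]])
      also have "\<dots> = (1/2) * norm x * (\<Sum>i<q. (1/2)^(i + 1))"
        by (simp add: sum_distrib_left mult_ac)
      also have "\<dots> \<le> (1/2) * norm x * 1"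
      proof (rule mult_left_mono)
        have "(\<Sum>i<q. (1/2::real)^(i + 1)) = 1 - (1/2)^q" by (induction q) auto
        then show "(\<Sum>i<q. (1/2::real)^(i + 1)) \<le> 1" by simp
      qed simp
      finally show ?thesis by simp
    qed
    then show ?thesis using LIMSEQ_le_const2[OF tendsto_norm[OF lim]] by blast
  qed
  with S(1) blJ show ?thesis using that by blast
qed

end

section \<open>The decomposition method\<close>

lemma czero_norm_attained:
  assumes "norm z = 1"
  obtains k where "\<bar>cz z k\<bar> = 1"
proof -
  obtain N where N: "\<And>i. i \<ge> N \<Longrightarrow> \<bar>cz z i\<bar> < 1 / 2"
    using LIMSEQ_D[OF cz_tendsto[of z], of "1 / 2"] by auto
  have "\<exists>k. \<bar>cz z k\<bar> = 1"
  proof (rule ccontr)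
    assume ne: "\<nexists>k. \<bar>cz z k\<bar> = 1"
    have lt: "\<bar>cz z k\<bar> < 1" for k using cz_le_norm[of z k] assms ne by (metis order_le_less)
    define M where "M = Max (insert (1 / 2) ((\<lambda>i. \<bar>cz z i\<bar>) ` {..<N}))"
    have "M < 1" unfolding M_def using lt by (subst Max_less_iff) auto
    moreover have "norm z \<le> M"
    proof (rule norm_cz_le)
      fix n
      show "\<bar>cz z n\<bar> \<le> M"
      proof (cases "n < N")
        case True
        then show ?thesis unfolding M_def by (intro Max_ge) auto
      next
        case False
        then have "\<bar>cz z n\<bar> \<le> 1 / 2" using N[of n] by simp
        also have "1 / 2 \<le> M" unfolding M_def by (intro Max_ge) auto
        finally show ?thesis .
      qed
    qed
    ultimately show False using assms by simp
  qed
  then show ?thesis using that by blast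
qed

context lip_c0
begin

text \<open>Otherwise a separating family of least size has a dual basis in which every vector
  expands. Then the bounded sequence of the V (e n) has a convergent subsequence, although
  \<open>U\<close> keeps its members at distance at least 1 / L.\<close>

lemma common_kernel:
  fixes F :: "('a \<Rightarrow>\<^sub>L real) set"
  assumes "finite F"
  obtains x where "x \<noteq> 0" "\<And>f. f \<in> F \<Longrightarrow> blinfun_apply f x = 0"
proof -
  have "\<exists>x. x \<noteq> 0 \<and> (\<forall>f\<in>F. blinfun_apply f x = 0)"
  proof (rule ccontr)
    assume no: "\<not> ?thesis"
    define sep where "sep F \<longleftrightarrow> finite F \<and> (\<forall>x. (\<forall>f\<in>F. blinfun_apply f x = 0) \<longrightarrow> x = 0)" for F :: "('a \<Rightarrow>\<^sub>L real) set"
    have "sep F" using no assms by (auto simp: sep_def)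
    then obtain G where G: "sep G" and min: "\<And>H. sep H \<Longrightarrow> card G \<le> card H"
      using ex_has_least_nat[of sep F card] by blast
    have finG: "finite G" using G by (simp add: sep_def)
    have "\<exists>x. blinfun_apply f x = 1 \<and> (\<forall>g\<in>G - {f}. blinfun_apply g x = 0)" if f: "f \<in> G" for f
    proof -
      have "card (G - {f}) < card G" by (rule card_Diff1_less[OF finG f])
      then have "\<not> sep (G - {f})" using min[of "G - {f}"] by auto
      then obtain x where x: "x \<noteq> 0" "\<forall>g\<in>G - {f}. blinfun_apply g x = 0" using finG by (auto simp: sep_def)
      have "blinfun_apply f x \<noteq> 0" using G x unfolding sep_def by blast
      then show ?thesis using x(2)
        by (intro exI[of _ "(1 / blinfun_apply f x) *\<^sub>R x"]) (simp add: blinfun.scaleR_right)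
    qed
    then obtain u where u: "\<And>f. f \<in> G \<Longrightarrow> blinfun_apply f (u f) = 1"
      "\<And>f g. f \<in> G \<Longrightarrow> g \<in> G \<Longrightarrow> g \<noteq> f \<Longrightarrow> blinfun_apply g (u f) = 0" by (metis Diff_iff singletonD)
    have expand: "x = (\<Sum>f\<in>G. blinfun_apply f x *\<^sub>R u f)" for x
    proof -
      have "blinfun_apply g (x - (\<Sum>f\<in>G. blinfun_apply f x *\<^sub>R u f)) = 0" if g: "g \<in> G" for g
      proof -
        have "(\<Sum>f\<in>G. blinfun_apply f x * blinfun_apply g (u f)) = (\<Sum>f\<in>G. if f = g then blinfun_apply g x else 0)"
          by (rule sum.cong) (use u g in auto)
        then show ?thesis using finG g by (simp add: blinfun.diff_right blinfun.sum_right blinfun.scaleR_right)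
      qed
      then have "x - (\<Sum>f\<in>G. blinfun_apply f x *\<^sub>R u f) = 0" using G unfolding sep_def by blast
      then show ?thesis by simp
    qed
    define e where "e n = czs (\<lambda>i. if i < Suc n then (if i = n then 1 else 0) else 0)" for n
    have e: "cz (e n) i = (if i = n then 1 else 0)" for n i
      unfolding e_def by (subst cz_czs[OF finite_support_tendsto_0]) auto
    have en: "norm (e n) \<le> 1" for n by (rule norm_cz_le) (simp add: e)
    have edist: "1 \<le> norm (e n - e m)" if "n \<noteq> m" for n m
      using cz_le_norm[of "e n - e m" n] that by (simp add: e)
    define y where "y n = V (e n)" for n
    have yb: "norm (y n) \<le> norm (V 0) + L" for n
    proof -
      have "norm (y n - V 0) \<le> L * norm (e n)" using lipV[of "e n" 0] by (simp add: y_def)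
      also have "\<dots> \<le> L * 1" using en L1 by (intro mult_left_mono) auto
      finally show ?thesis using norm_triangle_ineq2[of "y n" "V 0"] by simp
    qed
    have ydist: "1 \<le> L * norm (y n - y m)" if "n \<noteq> m" for n m
      using edist[OF that] lipU[of "y n" "y m"] by (simp add: y_def UV)
    define B where "B = (\<Sum>f\<in>G. norm f) * (norm (V 0) + L)"
    have "norm (blinfun_apply f (y n)) \<le> B" if f: "f \<in> G" for f n
    proof -
      have "norm (blinfun_apply f (y n)) \<le> norm f * norm (y n)" by (rule norm_blinfun)
      also have "\<dots> \<le> B" unfolding B_def using yb[of n] finG f
        by (intro mult_mono member_le_sum sum_nonneg) auto
      finally show ?thesis .
    qed
    then have fb: "norm ((\<lambda>n f. blinfun_apply f (y n)) n f) \<le> B" if "f \<in> G" for f n using that by simp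
    obtain r :: "nat \<Rightarrow> nat" where r: "strict_mono r" "\<And>f. f \<in> G \<Longrightarrow> \<exists>l. (\<lambda>n. blinfun_apply f (y (r n))) \<longlonglongrightarrow> l"
      by (rule function_convergent_subsequence[OF countable_finite[OF finG] fb], assumption, rule that)
    then obtain l where l: "\<And>f. f \<in> G \<Longrightarrow> (\<lambda>n. blinfun_apply f (y (r n))) \<longlonglongrightarrow> l f" by metis
    have "(\<lambda>n. \<Sum>f\<in>G. blinfun_apply f (y (r n)) *\<^sub>R u f) \<longlonglongrightarrow> (\<Sum>f\<in>G. l f *\<^sub>R u f)"
      by (intro tendsto_sum tendsto_scaleR l tendsto_const)
    then have lim: "(\<lambda>n. y (r n)) \<longlonglongrightarrow> (\<Sum>f\<in>G. l f *\<^sub>R u f)" by (simp only: expand[symmetric])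
    have "Cauchy (\<lambda>n. y (r n))" using lim by (rule LIMSEQ_imp_Cauchy)
    then obtain N where "\<And>m n. m \<ge> N \<Longrightarrow> n \<ge> N \<Longrightarrow> norm (y (r m) - y (r n)) < 1 / L"
      using CauchyD[of "\<lambda>n. y (r n)" "1 / L"] L1 by force
    from this[of N "Suc N"] have "norm (y (r N) - y (r (Suc N))) < 1 / L" by simp
    moreover have "r N \<noteq> r (Suc N)" using r(1) by (metis lessI order_less_irrefl strict_monoD)
    ultimately show False using ydist[of "r N" "r (Suc N)"] L1 by (simp add: field_simps)
  qed
  then show ?thesis using that by blast
qed

text \<open>Gliding hump: the images y n = J (x n) vanish before N n, peak at k n and are tiny from
  the next N on. The matrix of the values of y m at k n is triangular with diagonal entries 1 or -1
  and off-diagonal row sums at most 1/2, so reading off the peaks almost inverts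
  \<open>S'\<close>.\<close>

lemma c0_complemented:
  fixes S :: "czero \<Rightarrow> 'a" and J :: "'a \<Rightarrow> czero"
  assumes S: "bounded_linear S" and J: "bounded_linear J" and SJ: "\<And>x. S (J x) = x"
  obtains S' :: "czero \<Rightarrow> 'a" and \<Phi> :: "'a \<Rightarrow> czero" where "bounded_linear S'" "bounded_linear \<Phi>" "\<And>z. \<Phi> (S' z) = z"
proof -
  interpret J: bounded_linear J by (rule J)
  obtain C where C: "\<And>z. norm (S z) \<le> norm z * C" "0 < C" using bounded_linear.pos_bounded[OF S] by blast
  \<comment> \<open>Exact vanishing on the first coordinates is available because finitely many
    coordinate functionals of \<open>J\<close> have a common kernel vector.\<close>
  have hump: "\<exists>x k. norm (J x) = 1 \<and> (\<forall>i<N. cz (J x) i = 0) \<and> \<bar>cz (J x) k\<bar> = 1" for N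
  proof -
    have bl: "bounded_linear (\<lambda>x. cz (J x) i)" for i
      by (rule bounded_linear_compose[OF bounded_linear_cz J])
    have fin: "finite ((\<lambda>i. Blinfun (\<lambda>x. cz (J x) i)) ` {..<N})" by simp
    obtain x where x: "x \<noteq> 0" "\<And>f. f \<in> (\<lambda>i. Blinfun (\<lambda>x. cz (J x) i)) ` {..<N} \<Longrightarrow> blinfun_apply f x = 0"
      by (rule common_kernel[OF fin], rule that)
    have x0: "cz (J x) i = 0" if "i < N" for i
      using x(2)[of "Blinfun (\<lambda>x. cz (J x) i)"] that by (simp add: bounded_linear_Blinfun_apply[OF bl])
    have "J x \<noteq> 0" using x(1) SJ[of x] linear_0[OF bounded_linear.linear[OF S]] by auto
    then have n1: "norm (J ((1 / norm (J x)) *\<^sub>R x)) = 1" by (simp add: J.scaleR)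
    obtain k where "\<bar>cz (J ((1 / norm (J x)) *\<^sub>R x)) k\<bar> = 1" by (rule czero_norm_attained[OF n1])
    then show ?thesis using n1 x0
      by (intro exI[of _ "(1 / norm (J x)) *\<^sub>R x"] exI[of _ k]) (simp add: J.scaleR)
  qed
  \<comment> \<open>\<open>k m < N\<close> makes every later hump vanish at the earlier peak; from
    \<open>N\<close> on the earlier humps are below powers of 1/4, whose sum is at most 1/2.\<close>
  define P where "P s n r \<longleftrightarrow> (case r of (x, k, N) \<Rightarrow> norm (J x) = 1 \<and> (\<forall>i<N. cz (J x) i = 0) \<and> \<bar>cz (J x) k\<bar> = 1 \<and>
      (\<forall>m<n. fst (snd (s m)) < N \<and> snd (snd (s m)) \<le> N \<and> (\<forall>i\<ge>N. \<bar>cz (J (fst (s m))) i\<bar> \<le> (1/4)^(m + 1))))"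
    for s :: "nat \<Rightarrow> 'a \<times> nat \<times> nat" and n and r :: "'a \<times> nat \<times> nat"
  have "\<exists>s. \<forall>n. P s n (s n)"
  proof (rule dependent_wellorder_choice)
    fix r n and s s' :: "nat \<Rightarrow> 'a \<times> nat \<times> nat" assume "\<And>y. y < n \<Longrightarrow> s y = s' y"
    then show "P s n r = P s' n r" unfolding P_def by (simp cong: conj_cong split: prod.splits)
  next
    fix n and s :: "nat \<Rightarrow> 'a \<times> nat \<times> nat"
    have "\<forall>\<^sub>F N in sequentially. \<forall>m\<in>{..<n}. fst (snd (s m)) < N \<and> snd (snd (s m)) \<le> N \<and> (\<forall>i\<ge>N. \<bar>cz (J (fst (s m))) i\<bar> \<le> (1/4)^(m + 1))"
    proof (rule eventually_ball_finite, simp, intro ballI eventually_conj)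
      fix m
      show "\<forall>\<^sub>F N in sequentially. fst (snd (s m)) < N" by (rule eventually_gt_at_top)
      show "\<forall>\<^sub>F N in sequentially. snd (snd (s m)) \<le> N" by (rule eventually_ge_at_top)
      have "0 < (1/4::real)^(m + 1)" by simp
      then obtain N0 where "\<And>i. i \<ge> N0 \<Longrightarrow> \<bar>cz (J (fst (s m))) i\<bar> < (1/4)^(m + 1)"
        using LIMSEQ_D[OF cz_tendsto[of "J (fst (s m))"], of "(1/4)^(m + 1)"] by auto
      then show "\<forall>\<^sub>F N in sequentially. \<forall>i\<ge>N. \<bar>cz (J (fst (s m))) i\<bar> \<le> (1/4)^(m + 1)"
        unfolding eventually_sequentially by (meson less_imp_le order_trans)
    qed
    then obtain N where N: "\<forall>m\<in>{..<n}. fst (snd (s m)) < N \<and> snd (snd (s m)) \<le> N \<and> (\<forall>i\<ge>N. \<bar>cz (J (fst (s m))) i\<bar> \<le> (1/4)^(m + 1))"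
      by (auto simp: eventually_sequentially)
    obtain x k where "norm (J x) = 1" "\<forall>i<N. cz (J x) i = 0" "\<bar>cz (J x) k\<bar> = 1" using hump by blast
    with N have "P s n (x, k, N)" unfolding P_def by auto
    then show "\<exists>r. P s n r" by blast
  qed
  then obtain s where s: "\<And>n. P s n (s n)" by blast
  define x where "x n = fst (s n)" for n
  define k where "k n = fst (snd (s n))" for n
  define N where "N n = snd (snd (s n))" for n
  define y where "y n = J (x n)" for n
  have sn: "s n = (x n, k n, N n)" for n by (simp add: x_def k_def N_def)
  have y1: "norm (y n) = 1" and y0: "\<And>i. i < N n \<Longrightarrow> cz (y n) i = 0" and yk: "\<bar>cz (y n) (k n)\<bar> = 1" for n
    using s[of n] by (auto simp: P_def sn y_def)
  have mn: "k m < N n" "\<And>i. i \<ge> N n \<Longrightarrow> \<bar>cz (y m) i\<bar> \<le> (1/4)^(m + 1)" if "m < n" for m n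
    using s[of n] that by (auto simp: P_def sn y_def)
  have kN: "N n \<le> k n" for n
  proof (rule ccontr)
    assume "\<not> N n \<le> k n"
    then show False using y0[of "k n" n] yk[of n] by simp
  qed
  have kmono: "strict_mono k"
    using mn(1) kN by (auto simp: strict_mono_def intro: less_le_trans)
  have quart: "(\<Sum>m<n. (1/4::real)^(m + 1)) \<le> 1 / 2" for n
  proof -
    have "(\<Sum>m<n. (1/4::real)^(m + 1)) = 1 / 3 - (1/4)^n / 3" by (induction n) auto
    moreover have "0 \<le> (1/4::real)^n" by simp
    ultimately show ?thesis by linarith
  qed
  have ysum: "(\<Sum>m<n. \<bar>cz (y m) i\<bar>) \<le> 2" for n i
  proof -
    \<comment> \<open>Humps starting after i vanish at i; of the others, all but the last are
      already in their small tails.\<close>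
    define A where "A = {m. m < n \<and> N m \<le> i}"
    have finA: "finite A" by (simp add: A_def)
    have "(\<Sum>m<n. \<bar>cz (y m) i\<bar>) = (\<Sum>m\<in>A. \<bar>cz (y m) i\<bar>)"
      by (rule sum.mono_neutral_right) (auto simp: A_def y0 not_le)
    also have "\<dots> \<le> 2"
    proof (cases "A = {}")
      case False
      define m0 where "m0 = Max A"
      have m0: "m0 \<in> A" unfolding m0_def by (rule Max_in[OF finA False])
      have "(\<Sum>m\<in>A - {m0}. \<bar>cz (y m) i\<bar>) \<le> (\<Sum>m\<in>A - {m0}. (1/4)^(m + 1))"
      proof (rule sum_mono)
        fix m assume m: "m \<in> A - {m0}"
        then have "m < m0" using Max_ge[OF finA, of m] by (auto simp: m0_def order_less_le)
        then show "\<bar>cz (y m) i\<bar> \<le> (1/4)^(m + 1)" using m0 by (intro mn(2)) (auto simp: A_def)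
      qed
      also have "\<dots> \<le> (\<Sum>m<n. (1/4)^(m + 1))" by (rule sum_mono2) (auto simp: A_def)
      also have "\<dots> \<le> 1 / 2" by (rule quart)
      finally have "(\<Sum>m\<in>A - {m0}. \<bar>cz (y m) i\<bar>) \<le> 1 / 2" .
      then show ?thesis using sum.remove[OF finA m0, of "\<lambda>m. \<bar>cz (y m) i\<bar>"] cz_le_norm[of "y m0" i] y1[of m0] by linarith
    qed simp
    finally show ?thesis .
  qed
  \<comment> \<open>The bound is proved for the \<open>y i\<close> in c0 and carried back to X by
    \<open>S\<close>, a left inverse of \<open>J\<close>.\<close>
  have xbound: "norm (\<Sum>i<n. t i *\<^sub>R x i) \<le> 2 * C" if t: "\<And>i. i < n \<Longrightarrow> \<bar>t i\<bar> \<le> (1::real)" for n t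
  proof -
    have "norm (\<Sum>i<n. t i *\<^sub>R y i) \<le> 2"
    proof (rule norm_cz_le)
      fix j
      have "\<bar>\<Sum>i<n. t i * cz (y i) j\<bar> \<le> (\<Sum>i<n. \<bar>cz (y i) j\<bar>)"
      proof (rule order_trans[OF sum_abs sum_mono])
        fix i assume "i \<in> {..<n}"
        then show "\<bar>t i * cz (y i) j\<bar> \<le> \<bar>cz (y i) j\<bar>" using t[of i] by (simp add: abs_mult mult_left_le_one_le)
      qed
      with ysum[of j n] show "\<bar>cz (\<Sum>i<n. t i *\<^sub>R y i) j\<bar> \<le> 2" by (simp add: cz_sum)
    qed
    moreover have "J (\<Sum>i<n. t i *\<^sub>R x i) = (\<Sum>i<n. t i *\<^sub>R y i)" by (simp add: J.sum J.scaleR y_def)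
    ultimately have n2: "norm (J (\<Sum>i<n. t i *\<^sub>R x i)) \<le> 2" by simp
    have "norm (S (J (\<Sum>i<n. t i *\<^sub>R x i))) \<le> norm (J (\<Sum>i<n. t i *\<^sub>R x i)) * C" by (rule C(1))
    also have "\<dots> \<le> 2 * C" using n2 C(2) by (intro mult_right_mono) auto
    finally show ?thesis by (simp add: SJ)
  qed
  obtain S' where S': "bounded_linear S'" "\<And>z. (\<lambda>i. cz z i *\<^sub>R x i) sums S' z"
    by (rule c0_synthesis[OF xbound], assumption, rule that)
  \<comment> \<open>The sign of the peak value, used to turn the diagonal into 1.\<close>
  define \<sigma> where "\<sigma> n = cz (y n) (k n)" for n
  have \<sigma>: "\<bar>\<sigma> n\<bar> = 1" "\<sigma> n * \<sigma> n = 1" for n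
    using yk[of n] abs_mult_self[of "\<sigma> n"] by (simp_all add: \<sigma>_def)
  have lim: "(\<lambda>n. \<sigma> n * cz (J w) (k n)) \<longlonglongrightarrow> 0" for w
  proof (rule Lim_null_comparison)
    show "\<forall>\<^sub>F n in sequentially. norm (\<sigma> n * cz (J w) (k n)) \<le> \<bar>cz (J w) (k n)\<bar>" by (simp add: abs_mult \<sigma>)
    show "(\<lambda>n. \<bar>cz (J w) (k n)\<bar>) \<longlonglongrightarrow> 0"
      using LIMSEQ_subseq_LIMSEQ[OF cz_tendsto kmono] by (intro tendsto_rabs_zero) (simp add: o_def)
  qed
  define \<Phi> where "\<Phi> w = czs (\<lambda>n. \<sigma> n * cz (J w) (k n))" for w
  have \<Phi>: "cz (\<Phi> w) n = \<sigma> n * cz (J w) (k n)" for w n unfolding \<Phi>_def by (rule cz_czs[OF lim])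
  obtain B where B: "\<And>w. norm (J w) \<le> norm w * B" using J.bounded by blast
  have bl\<Phi>: "bounded_linear \<Phi>"
  proof (rule bounded_linear_intro[where K=B])
    show "\<Phi> (u + w) = \<Phi> u + \<Phi> w" for u w by (rule cz_eqI) (simp add: \<Phi> J.add algebra_simps)
    show "\<Phi> (c *\<^sub>R w) = c *\<^sub>R \<Phi> w" for c w by (rule cz_eqI) (simp add: \<Phi> J.scaleR)
    show "norm (\<Phi> w) \<le> norm w * B" for w
      by (rule norm_cz_le) (simp add: \<Phi> abs_mult \<sigma> order_trans[OF cz_le_norm B])
  qed
  have near: "norm (\<Phi> (S' z) - z) \<le> norm z / 2" for z
  proof (rule norm_cz_le)
    fix n
    have "(\<lambda>m. cz (J (cz z m *\<^sub>R x m)) (k n)) sums cz (J (S' z)) (k n)"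
      by (rule bounded_linear.sums[OF bounded_linear_compose[OF bounded_linear_cz J] S'(2)])
    then have 1: "(\<lambda>m. cz z m * cz (y m) (k n)) sums cz (J (S' z)) (k n)" by (simp add: J.scaleR y_def)
    have "(\<lambda>m. cz z m * cz (y m) (k n)) sums (\<Sum>m<Suc n. cz z m * cz (y m) (k n))"
    proof (rule sums_finite)
      fix m assume "m \<notin> {..<Suc n}"
      then show "cz z m * cz (y m) (k n) = 0" using y0[OF mn(1)[of n m]] by simp
    qed simp
    then have "cz (J (S' z)) (k n) = (\<Sum>m<n. cz z m * cz (y m) (k n)) + cz z n * \<sigma> n"
      using sums_unique2[OF 1] by (simp add: \<sigma>_def)
    then have "cz (\<Phi> (S' z) - z) n = \<sigma> n * (\<Sum>m<n. cz z m * cz (y m) (k n)) + cz z n * (\<sigma> n * \<sigma> n) - cz z n"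
      by (simp add: \<Phi> algebra_simps)
    then have "\<bar>cz (\<Phi> (S' z) - z) n\<bar> = \<bar>\<Sum>m<n. cz z m * cz (y m) (k n)\<bar>"
      by (simp only: \<sigma>(2)) (simp add: abs_mult \<sigma>)
    also have "\<dots> \<le> (\<Sum>m<n. norm z * (1/4)^(m + 1))"
    proof (rule order_trans[OF sum_abs sum_mono])
      fix m assume "m \<in> {..<n}"
      then show "\<bar>cz z m * cz (y m) (k n)\<bar> \<le> norm z * (1/4)^(m + 1)"
        unfolding abs_mult using kN[of n] by (intro mult_mono cz_le_norm mn(2)) auto
    qed
    also have "\<dots> = norm z * (\<Sum>m<n. (1/4)^(m + 1))" by (simp only: sum_distrib_left)
    also have "\<dots> \<le> norm z * (1 / 2)" by (intro mult_left_mono quart) simp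
    finally show "\<bar>cz (\<Phi> (S' z) - z) n\<bar> \<le> norm z / 2" by simp
  qed
  have blM: "bounded_linear (\<lambda>z. \<Phi> (S' z))" by (rule bounded_linear_compose[OF bl\<Phi> S'(1)])
  obtain M' where M': "bounded_linear M'" "\<And>z. \<Phi> (S' (M' z)) = z" "\<And>z. M' (\<Phi> (S' z)) = z"
    by (rule near_identity_inverse[OF blM near], rule that)
  show ?thesis
    by (rule that[of S' "\<lambda>w. M' (\<Phi> w)", OF S'(1) bounded_linear_compose[OF M'(1) bl\<Phi>] M'(3)])
qed

end

section \<open>c0 as the space of null sequences in c0\<close>

definition crow :: "nat \<Rightarrow> czero \<Rightarrow> czero" where
  "crow i z = czs (\<lambda>j. cz z (prod_encode (i, j)))"

text \<open>Inverse of taking rows; it has the intended entries when the norms of the rows tend to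
  0.\<close>

definition stack :: "(nat \<Rightarrow> czero) \<Rightarrow> czero" where
  "stack w = czs (\<lambda>n. cz (w (fst (prod_decode n))) (snd (prod_decode n)))"

lemma cz_crow: "cz (crow i z) j = cz z (prod_encode (i, j))"
proof -
  have "strict_mono (\<lambda>j. prod_encode (i, j))"
    by (auto simp: strict_mono_Suc_iff prod_encode_def triangle_def)
  then have "(\<lambda>j. cz z (prod_encode (i, j))) \<longlonglongrightarrow> 0"
    using LIMSEQ_subseq_LIMSEQ[OF cz_tendsto] by (fastforce simp: o_def)
  then show ?thesis unfolding crow_def by (rule cz_czs)
qed

lemma norm_crow: "norm (crow i z) \<le> norm z"
  by (rule norm_cz_le) (simp add: cz_crow cz_le_norm)

lemma crow_linear: "crow i (x + y) = crow i x + crow i y" "crow i (c *\<^sub>R x) = c *\<^sub>R crow i x"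
  by (rule cz_eqI; simp add: cz_crow)+

lemma norm_crow_tendsto: "(\<lambda>i. norm (crow i z)) \<longlonglongrightarrow> 0"
proof (rule LIMSEQ_I)
  fix e :: real assume e: "0 < e"
  then obtain N where N: "\<And>n. n \<ge> N \<Longrightarrow> \<bar>cz z n\<bar> < e / 2" using LIMSEQ_D[OF cz_tendsto[of z], of "e / 2"] by auto
  have "norm (crow i z) \<le> e / 2" if "i \<ge> N" for i
  proof (rule norm_cz_le)
    fix n
    have "N \<le> prod_encode (i, n)" using le_prod_encode_1[of i n] that by simp
    then show "\<bar>cz (crow i z) n\<bar> \<le> e / 2" using N[of "prod_encode (i, n)"] by (simp add: cz_crow)
  qed
  then show "\<exists>no. \<forall>i\<ge>no. norm (norm (crow i z) - 0) < e" using e by (intro exI[of _ N]) force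
qed

lemma cz_stack:
  assumes "(\<lambda>i. norm (w i)) \<longlonglongrightarrow> 0"
  shows "cz (stack w) n = cz (w (fst (prod_decode n))) (snd (prod_decode n))"
proof -
  have "(\<lambda>n. cz (w (fst (prod_decode n))) (snd (prod_decode n))) \<longlonglongrightarrow> 0"
  proof (rule tendsto_0_of_finite_levels)
    fix e :: real assume e: "0 < e"
    obtain N where N: "\<And>i. i \<ge> N \<Longrightarrow> norm (w i) < e" using LIMSEQ_D[OF assms e] by auto
    have fin: "finite {j. e \<le> \<bar>cz (w i) j\<bar>}" for i
    proof -
      obtain M where "\<And>j. j \<ge> M \<Longrightarrow> \<bar>cz (w i) j\<bar> < e" using LIMSEQ_D[OF cz_tendsto e] by auto
      then have "{j. e \<le> \<bar>cz (w i) j\<bar>} \<subseteq> {..<M}" by (auto simp: not_le[symmetric])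
      then show ?thesis by (rule finite_subset) simp
    qed
    have "{n. e \<le> \<bar>cz (w (fst (prod_decode n))) (snd (prod_decode n))\<bar>} \<subseteq> prod_encode ` Sigma {..<N} (\<lambda>i. {j. e \<le> \<bar>cz (w i) j\<bar>})"
    proof
      fix n assume "n \<in> {n. e \<le> \<bar>cz (w (fst (prod_decode n))) (snd (prod_decode n))\<bar>}"
      then have n: "e \<le> \<bar>cz (w (fst (prod_decode n))) (snd (prod_decode n))\<bar>" by simp
      then have "e \<le> norm (w (fst (prod_decode n)))" using cz_le_norm order_trans by blast
      then have "fst (prod_decode n) < N" using N by (meson not_le)
      with n have "prod_encode (fst (prod_decode n), snd (prod_decode n)) \<in> prod_encode ` Sigma {..<N} (\<lambda>i. {j. e \<le> \<bar>cz (w i) j\<bar>})"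
        by (intro imageI SigmaI) auto
      then show "n \<in> prod_encode ` Sigma {..<N} (\<lambda>i. {j. e \<le> \<bar>cz (w i) j\<bar>})" by simp
    qed
    then show "finite {n. e \<le> \<bar>cz (w (fst (prod_decode n))) (snd (prod_decode n))\<bar>}"
      by (rule finite_subset) (use fin in auto)
  qed
  then show ?thesis unfolding stack_def by (rule cz_czs)
qed

lemma crow_stack: "(\<lambda>i. norm (w i)) \<longlonglongrightarrow> 0 \<Longrightarrow> crow i (stack w) = w i"
  by (rule cz_eqI) (simp add: cz_crow cz_stack)

lemma czero_crow_eqI: "(\<And>i. crow i z = crow i w) \<Longrightarrow> z = w"
proof (rule cz_eqI)
  fix n assume "\<And>i. crow i z = crow i w"
  then have "cz (crow (fst (prod_decode n)) z) (snd (prod_decode n)) = cz (crow (fst (prod_decode n)) w) (snd (prod_decode n))" by simp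
  then show "cz z n = cz w n" by (simp add: cz_crow)
qed

lemma norm_le_crows:
  assumes "\<And>i. norm (crow i z) \<le> C"
  shows "norm z \<le> C"
proof (rule norm_cz_le)
  fix n
  have "\<bar>cz (crow (fst (prod_decode n)) z) (snd (prod_decode n))\<bar> \<le> C" using cz_le_norm assms order_trans by blast
  then show "\<bar>cz z n\<bar> \<le> C" by (simp add: cz_crow)
qed

text \<open>Pelczynski's decomposition method: the first isomorphism shifts the components of the rows
  in the range of the projection by one crow, the second absorbs a copy of c0.\<close>

lemma pelczynski_shift:
  fixes S :: "czero \<Rightarrow> 'a::real_normed_vector" and J :: "'a \<Rightarrow> czero"
  assumes S: "bounded_linear S" and J: "bounded_linear J" and SJ: "\<And>x. S (J x) = x"
  obtains A :: "'a \<times> czero \<Rightarrow> czero" and A' :: "czero \<Rightarrow> 'a \<times> czero"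
  where "bounded_linear A" "bounded_linear A'" "\<And>p. A' (A p) = p" "\<And>w. A (A' w) = w"
proof -
  interpret S: bounded_linear S by (rule S)
  interpret J: bounded_linear J by (rule J)
  define P where "P z = J (S z)" for z
  have blP: "bounded_linear P" unfolding P_def by (rule bounded_linear_compose[OF J S])
  interpret P: bounded_linear P by (rule blP)
  have PJ: "P (J x) = J x" and SP: "S (P z) = S z" and PP: "P (P z) = P z" for x z by (simp_all add: P_def SJ)
  obtain B where B: "\<And>z. norm (P z) \<le> norm z * B" "0 < B" using P.pos_bounded by blast
  obtain BS where BS: "\<And>z. norm (S z) \<le> norm z * BS" "0 < BS" using S.pos_bounded by blast
  obtain BJ where BJ: "\<And>z. norm (J z) \<le> norm z * BJ" "0 < BJ" using J.pos_bounded by blast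
  have comp: "norm (P u + (v - P v)) \<le> B * norm u + (1 + B) * norm v" for u v
    using norm_triangle_ineq[of "P u" "v - P v"] norm_triangle_ineq4[of v "P v"] B(1)[of u] B(1)[of v]
    by (simp add: algebra_simps)
  \<comment> \<open>The \<open>P\<close> part of row i moves to row i + 1 while the complementary
    part stays; the X component fills the vacancy in row 0 through \<open>J\<close>.\<close>
  define r where "r p i = (case i of 0 \<Rightarrow> J (fst p) + (crow 0 (snd p) - P (crow 0 (snd p)))
      | Suc i \<Rightarrow> P (crow i (snd p)) + (crow (Suc i) (snd p) - P (crow (Suc i) (snd p))))" for p :: "'a \<times> czero" and i
  have rlim: "(\<lambda>i. norm (r p i)) \<longlonglongrightarrow> 0" for p
  proof -
    have "(\<lambda>i. B * norm (crow i (snd p)) + (1 + B) * norm (crow (Suc i) (snd p))) \<longlonglongrightarrow> B * 0 + (1 + B) * 0"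
      by (intro tendsto_add tendsto_mult tendsto_const norm_crow_tendsto LIMSEQ_Suc)
    then have z: "(\<lambda>i. B * norm (crow i (snd p)) + (1 + B) * norm (crow (Suc i) (snd p))) \<longlonglongrightarrow> 0" by simp
    have "(\<lambda>i. norm (r p (Suc i))) \<longlonglongrightarrow> 0"
      by (rule Lim_null_comparison[OF _ z]) (simp add: r_def comp)
    then show ?thesis by (rule LIMSEQ_imp_Suc)
  qed
  define A where "A p = stack (r p)" for p
  have rowA: "crow i (A p) = r p i" for i p unfolding A_def by (rule crow_stack[OF rlim])
  define q where "q w i = P (crow (Suc i) w) + (crow i w - P (crow i w))" for w i
  have qlim: "(\<lambda>i. norm (q w i)) \<longlonglongrightarrow> 0" for w
  proof -
    have "(\<lambda>i. B * norm (crow (Suc i) w) + (1 + B) * norm (crow i w)) \<longlonglongrightarrow> B * 0 + (1 + B) * 0"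
      by (intro tendsto_add tendsto_mult tendsto_const norm_crow_tendsto LIMSEQ_Suc)
    then have z: "(\<lambda>i. B * norm (crow (Suc i) w) + (1 + B) * norm (crow i w)) \<longlonglongrightarrow> 0" by simp
    show ?thesis by (rule Lim_null_comparison[OF _ z]) (simp add: q_def comp)
  qed
  define A2 where "A2 w = stack (q w)" for w
  have rowA2: "crow i (A2 w) = q w i" for i w unfolding A2_def by (rule crow_stack[OF qlim])
  define A' where "A' w = (S (crow 0 w), A2 w)" for w
  have "bounded_linear A"
  proof (rule bounded_linear_intro[where K="BJ + B + (1 + B)"])
    show "A (p + p') = A p + A p'" for p p'
      by (rule czero_crow_eqI) (simp add: rowA crow_linear r_def J.add P.add algebra_simps split: nat.splits)
    show "A (c *\<^sub>R p) = c *\<^sub>R A p" for c p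
      by (rule czero_crow_eqI) (simp add: rowA crow_linear r_def J.scaleR P.scaleR algebra_simps split: nat.splits)
    show "norm (A p) \<le> norm p * (BJ + B + (1 + B))" for p
    proof (rule norm_le_crows)
      fix i
      have f: "norm (fst p) \<le> norm p" "norm (snd p) \<le> norm p" by (cases p; simp add: norm_fst_le norm_snd_le)+
      have rw: "norm (crow i (snd p)) \<le> norm p" for i using norm_crow[of i "snd p"] f(2) by linarith
      have "norm (J (fst p) + (crow 0 (snd p) - P (crow 0 (snd p)))) \<le> norm p * BJ + (1 + B) * norm p"
      proof (rule norm_triangle_mono)
        show "norm (J (fst p)) \<le> norm p * BJ" using BJ(1)[of "fst p"] mult_right_mono[OF f(1), of BJ] BJ(2) by linarith
        show "norm (crow 0 (snd p) - P (crow 0 (snd p))) \<le> (1 + B) * norm p"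
          by (rule order_trans[OF _ mult_left_mono[OF rw[of 0]]]) (use comp[of 0 "crow 0 (snd p)"] B(2) in \<open>auto simp: P.zero\<close>)
      qed
      also have "\<dots> \<le> norm p * (BJ + B + (1 + B))" using B(2) by (simp add: algebra_simps)
      finally have 0: "norm (J (fst p) + (crow 0 (snd p) - P (crow 0 (snd p)))) \<le> norm p * (BJ + B + (1 + B))" .
      have "norm (P (crow i (snd p)) + (crow (Suc i) (snd p) - P (crow (Suc i) (snd p)))) \<le> B * norm p + (1 + B) * norm p" for i
        using comp[of "crow i (snd p)" "crow (Suc i) (snd p)"] mult_left_mono[OF rw[of i], of B]
          mult_left_mono[OF rw[of "Suc i"], of "1 + B"] B(2) by linarith
      moreover have "B * norm p + (1 + B) * norm p \<le> norm p * (BJ + B + (1 + B))" using BJ(2) by (simp add: algebra_simps)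
      ultimately have 1: "norm (P (crow i (snd p)) + (crow (Suc i) (snd p) - P (crow (Suc i) (snd p)))) \<le> norm p * (BJ + B + (1 + B))" for i
        using order_trans by blast
      show "norm (crow i (A p)) \<le> norm p * (BJ + B + (1 + B))" unfolding rowA r_def by (cases i) (use 0 1 in auto)
    qed
  qed
  moreover have "bounded_linear A'"
    unfolding A'_def
  proof (rule bounded_linear_Pair)
    show "bounded_linear (\<lambda>w. S (crow 0 w))"
    proof (rule bounded_linear_compose[OF S])
      show "bounded_linear (crow 0)" by (rule bounded_linear_intro[where K=1]) (auto simp: crow_linear norm_crow)
    qed
    show "bounded_linear A2"
    proof (rule bounded_linear_intro[where K="B + (1 + B)"])
      show "A2 (w + w') = A2 w + A2 w'" for w w'
        by (rule czero_crow_eqI) (simp add: rowA2 crow_linear q_def P.add algebra_simps)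
      show "A2 (c *\<^sub>R w) = c *\<^sub>R A2 w" for c w
        by (rule czero_crow_eqI) (simp add: rowA2 crow_linear q_def P.scaleR algebra_simps)
      show "norm (A2 w) \<le> norm w * (B + (1 + B))" for w
      proof (rule norm_le_crows)
        fix i
        have "norm (q w i) \<le> B * norm (crow (Suc i) w) + (1 + B) * norm (crow i w)" unfolding q_def by (rule comp)
        also have "\<dots> \<le> B * norm w + (1 + B) * norm w"
          using B(2) by (intro add_mono mult_left_mono norm_crow) auto
        finally show "norm (crow i (A2 w)) \<le> norm w * (B + (1 + B))" by (simp add: rowA2 algebra_simps)
      qed
    qed
  qed
  moreover have "A' (A p) = p" for p
  proof -
    have "A2 (A p) = snd p"
      by (rule czero_crow_eqI) (simp add: rowA2 rowA q_def r_def P.add P.diff PP PJ split: nat.splits)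
    moreover have "S (crow 0 (A p)) = fst p" by (simp add: rowA r_def S.add S.diff SP SJ)
    ultimately show ?thesis by (simp add: A'_def)
  qed
  moreover have "A (A' w) = w" for w
    by (rule czero_crow_eqI) (simp add: rowA A'_def r_def rowA2 q_def P.add P.diff PP split: nat.splits, simp add: P_def)
  ultimately show ?thesis using that by blast
qed

text \<open>X contains the copy S c0 of c0, complemented by the projection S o
  \<open>\<Phi>\<close>. Splitting this copy into even and odd coordinates frees one c0, and the
  other takes the place of the whole.\<close>

lemma pelczynski_absorb:
  fixes S :: "czero \<Rightarrow> 'a::real_normed_vector" and \<Phi> :: "'a \<Rightarrow> czero"
  assumes S: "bounded_linear S" and \<Phi>: "bounded_linear \<Phi>" and \<Phi>S: "\<And>z. \<Phi> (S z) = z"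
  obtains C :: "'a \<Rightarrow> 'a \<times> czero" and C' :: "'a \<times> czero \<Rightarrow> 'a"
  where "bounded_linear C" "bounded_linear C'" "\<And>x. C' (C x) = x" "\<And>p. C (C' p) = p"
proof -
  interpret S: bounded_linear S by (rule S)
  interpret \<Phi>: bounded_linear \<Phi> by (rule \<Phi>)
  define ev where "ev z = czs (\<lambda>n. cz z (2 * n))" for z
  define od where "od z = czs (\<lambda>n. cz z (Suc (2 * n)))" for z
  define mg where "mg z w = czs (\<lambda>n. if even n then cz z (n div 2) else cz w (n div 2))" for z w
  have "(\<lambda>n. cz z (2 * n)) \<longlonglongrightarrow> 0" "(\<lambda>n. cz z (Suc (2 * n))) \<longlonglongrightarrow> 0" for z
    using LIMSEQ_subseq_LIMSEQ[OF cz_tendsto[of z], of "\<lambda>n. 2 * n"] LIMSEQ_subseq_LIMSEQ[OF cz_tendsto[of z], of "\<lambda>n. Suc (2 * n)"]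
    by (auto simp: strict_mono_def o_def)
  then have ev: "cz (ev z) n = cz z (2 * n)" and od: "cz (od z) n = cz z (Suc (2 * n))" for z n
    unfolding ev_def od_def by (simp_all add: cz_czs)
  have "(\<lambda>n. if even n then cz z (n div 2) else cz w (n div 2)) \<longlonglongrightarrow> 0" for z w
  proof (rule LIMSEQ_I)
    fix e :: real assume e: "0 < e"
    obtain N where N: "\<And>n. n \<ge> N \<Longrightarrow> \<bar>cz z n\<bar> < e" using LIMSEQ_D[OF cz_tendsto e] by auto
    obtain M where M: "\<And>n. n \<ge> M \<Longrightarrow> \<bar>cz w n\<bar> < e" using LIMSEQ_D[OF cz_tendsto e] by auto
    have "norm ((if even n then cz z (n div 2) else cz w (n div 2)) - 0) < e" if "n \<ge> 2 * (N + M)" for n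
      using that N[of "n div 2"] M[of "n div 2"] by auto
    then show "\<exists>no. \<forall>n\<ge>no. norm ((if even n then cz z (n div 2) else cz w (n div 2)) - 0) < e" by blast
  qed
  then have mg: "cz (mg z w) n = (if even n then cz z (n div 2) else cz w (n div 2))" for z w n
    unfolding mg_def by (rule cz_czs)
  have evmg: "ev (mg z w) = z" "od (mg z w) = w" for z w by (rule cz_eqI, simp add: ev od mg)+
  have mgev: "mg (ev z) (od z) = z" for z
    by (rule cz_eqI) (auto simp: mg ev od elim!: evenE oddE)
  have bev: "bounded_linear ev" "bounded_linear od"
    by (rule bounded_linear_intro[where K=1]; (rule cz_eqI | rule norm_cz_le); simp add: ev od cz_le_norm)+
  have bmg: "bounded_linear (\<lambda>p. mg (fst p) (snd p))"
  proof (rule bounded_linear_intro[where K=1])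
    show "mg (fst (p + p')) (snd (p + p')) = mg (fst p) (snd p) + mg (fst p') (snd p')" for p p' by (rule cz_eqI) (simp add: mg)
    show "mg (fst (c *\<^sub>R p)) (snd (c *\<^sub>R p)) = c *\<^sub>R mg (fst p) (snd p)" for c p by (rule cz_eqI) (simp add: mg)
    show "norm (mg (fst p) (snd p)) \<le> norm p * 1" for p
    proof (rule norm_cz_le)
      fix n
      show "\<bar>cz (mg (fst p) (snd p)) n\<bar> \<le> norm p * 1"
        using order_trans[OF cz_le_norm norm_fst_le, of "fst p" "n div 2" "snd p"] order_trans[OF cz_le_norm norm_snd_le, of "snd p" "n div 2" "fst p"]
        by (simp add: mg)
    qed
  qed
  define C where "C x = (S (od (\<Phi> x)) + (x - S (\<Phi> x)), ev (\<Phi> x))" for x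
  define C' where "C' p = S (mg (snd p) (\<Phi> (fst p))) + (fst p - S (\<Phi> (fst p)))" for p
  have "bounded_linear C" unfolding C_def
    by (intro bounded_linear_Pair bounded_linear_add bounded_linear_sub bounded_linear_ident
        bounded_linear_compose[OF S] bounded_linear_compose[OF bev(1)] bounded_linear_compose[OF bev(2)] \<Phi>)
  moreover have "bounded_linear C'"
  proof -
    have 1: "bounded_linear (\<lambda>p. (snd p, \<Phi> (fst p)))"
      by (intro bounded_linear_Pair bounded_linear_snd bounded_linear_compose[OF \<Phi> bounded_linear_fst])
    have 2: "bounded_linear (\<lambda>p. mg (snd p) (\<Phi> (fst p)))"
      using bounded_linear_compose[OF bmg 1] by simp
    show ?thesis unfolding C'_def
      by (intro bounded_linear_add bounded_linear_sub bounded_linear_fst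
          bounded_linear_compose[OF S 2] bounded_linear_compose[OF S bounded_linear_compose[OF \<Phi> bounded_linear_fst]])
  qed
  moreover have "C' (C x) = x" for x by (simp add: C_def C'_def \<Phi>.add \<Phi>.diff \<Phi>S mgev)
  moreover have "C (C' p) = p" for p by (simp add: C_def C'_def \<Phi>.add \<Phi>.diff \<Phi>S evmg)
  ultimately show ?thesis using that by blast
qed

text \<open>X is isomorphic to X x c0 by absorption, and X x c0 to c0 by the shift.\<close>

lemma (in lip_c0) linear_isomorphism:
  obtains T :: "'a \<Rightarrow> czero" and T' :: "czero \<Rightarrow> 'a"
  where "bounded_linear T" "bounded_linear T'" "\<And>x. T' (T x) = x" "\<And>z. T (T' z) = z"
proof -
  obtain S :: "czero \<Rightarrow> 'a" and J0 :: "'a \<Rightarrow> czero" where S: "bounded_linear S" and J0: "bounded_linear J0"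
    and near: "\<And>x. norm (S (J0 x) - x) \<le> norm x / 2" by (rule near_factorization, rule that)
  obtain M' where M': "bounded_linear M'" "\<And>x. S (J0 (M' x)) = x" "\<And>x. M' (S (J0 x)) = x"
    by (rule near_identity_inverse[OF bounded_linear_compose[OF S J0] near], rule that)
  have J: "bounded_linear (\<lambda>x. J0 (M' x))" by (rule bounded_linear_compose[OF J0 M'(1)])
  obtain S' :: "czero \<Rightarrow> 'a" and \<Phi> :: "'a \<Rightarrow> czero" where S': "bounded_linear S'" "bounded_linear \<Phi>" "\<And>z. \<Phi> (S' z) = z"
    by (rule c0_complemented[OF S J M'(2)], rule that)
  obtain A :: "'a \<times> czero \<Rightarrow> czero" and A' where A: "bounded_linear A" "bounded_linear A'" "\<And>p. A' (A p) = p" "\<And>w. A (A' w) = w"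
    by (rule pelczynski_shift[OF S J M'(2)], rule that)
  obtain C :: "'a \<Rightarrow> 'a \<times> czero" and C' where C: "bounded_linear C" "bounded_linear C'" "\<And>x. C' (C x) = x" "\<And>p. C (C' p) = p"
    by (rule pelczynski_absorb[OF S'], rule that)
  show ?thesis
    by (rule that[of "\<lambda>x. A (C x)" "\<lambda>w. C' (A' w)"])
       (simp_all add: A C bounded_linear_compose[OF A(1) C(1)] bounded_linear_compose[OF C(2) A(2)])
qed

theorem theorem2p2:
  fixes X_witness :: "'a::banach itself"
  shows "(\<exists>T :: 'a \<Rightarrow> (nat, real) bcontfun. lin_iso_c0 T) \<longleftrightarrow>
         (\<exists>U :: 'a \<Rightarrow> (nat, real) bcontfun. lip_iso_c0 U)"
proof
  assume "\<exists>T :: 'a \<Rightarrow> (nat, real) bcontfun. lin_iso_c0 T"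
  then obtain T :: "'a \<Rightarrow> (nat, real) bcontfun" and K where T: "bounded_linear T" "bij_betw T UNIV c0" "\<And>x. norm x \<le> K * norm (T x)"
    by (auto simp: lin_iso_c0_def)
  interpret T: bounded_linear T by (rule T(1))
  obtain B where B: "\<And>x. norm (T x) \<le> norm x * B" "0 < B" using T.pos_bounded by blast
  have "B-lipschitz_on UNIV T"
    by (rule lipschitz_onI) (use B in \<open>auto simp: dist_norm mult.commute simp flip: T.diff\<close>)
  \<comment> \<open>A Lipschitz constant must be nonnegative, hence the absolute value.\<close>
  moreover have "\<bar>K\<bar>-lipschitz_on c0 (inv_into UNIV T)"
  proof (rule lipschitz_onI)
    fix z w assume zw: "z \<in> c0" "w \<in> c0"
    define x where "x = inv_into UNIV T z"
    define y where "y = inv_into UNIV T w"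
    have xy: "T x = z" "T y = w" using zw T(2) by (auto simp: x_def y_def bij_betw_inv_into_right)
    have "norm (x - y) \<le> K * norm (z - w)" using T(3)[of "x - y"] by (simp add: T.diff xy)
    also have "\<dots> \<le> \<bar>K\<bar> * norm (z - w)" by (intro mult_right_mono) auto
    finally show "dist (inv_into UNIV T z) (inv_into UNIV T w) \<le> \<bar>K\<bar> * dist z w" by (simp add: dist_norm x_def y_def)
  qed simp
  ultimately have "lip_iso_c0 T" using T(2) by (auto simp: lip_iso_c0_def)
  then show "\<exists>U :: 'a \<Rightarrow> (nat, real) bcontfun. lip_iso_c0 U" by blast
next
  assume "\<exists>U :: 'a \<Rightarrow> (nat, real) bcontfun. lip_iso_c0 U"
  then obtain U :: "'a \<Rightarrow> (nat, real) bcontfun" and L1 L2 where U: "bij_betw U UNIV c0"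
    "L1-lipschitz_on UNIV U" "L2-lipschitz_on c0 (inv_into UNIV U)" by (auto simp: lip_iso_c0_def)
  \<comment> \<open>One constant for both directions, at least 1 as the locale demands.\<close>
  define L where "L = max 1 (max L1 L2)"
  define U' where "U' x = of_bcf (U x)" for x
  define V where "V z = inv_into UNIV U (to_bcf z)" for z
  have Uc: "U x \<in> c0" for x using U(1) by (auto simp: bij_betw_def)
  have tU: "to_bcf (U' x) = U x" for x unfolding U'_def by (rule of_bcf_inverse[OF Uc])
  interpret lip_c0 U' V L
  proof
    show "U' (V z) = z" for z
      using bij_betw_inv_into_right[OF U(1) to_bcf[of z]] by (simp add: U'_def V_def to_bcf_inverse)
    show "V (U' x) = x" for x
      using bij_betw_inv_into_left[OF U(1), of x] by (simp add: V_def tU)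
    show "1 \<le> L" by (simp add: L_def)
    show "norm (U' x - U' y) \<le> L * norm (x - y)" for x y
    proof -
      have "norm (U' x - U' y) = dist (U x) (U y)" by (simp add: norm_czero_def to_bcf_simps tU dist_norm)
      also have "\<dots> \<le> L1 * dist x y" by (rule lipschitz_onD[OF U(2)]) auto
      also have "\<dots> \<le> L * norm (x - y)" unfolding dist_norm by (intro mult_right_mono) (auto simp: L_def)
      finally show ?thesis .
    qed
    show "norm (V z - V w) \<le> L * norm (z - w)" for z w
    proof -
      have "norm (V z - V w) \<le> L2 * dist (to_bcf z) (to_bcf w)"
        unfolding V_def dist_norm[symmetric] by (rule lipschitz_onD[OF U(3) to_bcf to_bcf])
      also have "\<dots> = L2 * norm (z - w)" by (simp add: dist_norm norm_czero_def to_bcf_simps)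
      also have "\<dots> \<le> L * norm (z - w)" by (intro mult_right_mono) (auto simp: L_def)
      finally show ?thesis .
    qed
  qed
  obtain T :: "'a \<Rightarrow> czero" and T' where T: "bounded_linear T" "bounded_linear T'" "\<And>x. T' (T x) = x" "\<And>z. T (T' z) = z"
    by (rule linear_isomorphism, rule that)
  have bl: "bounded_linear (\<lambda>x. to_bcf (T x))"
  proof (rule bounded_linear_compose[OF _ T(1)])
    show "bounded_linear to_bcf" by (rule bounded_linear_intro[where K=1]) (auto simp: to_bcf_simps norm_czero_def)
  qed
  have bij: "bij_betw (\<lambda>x. to_bcf (T x)) UNIV c0"
  proof (rule bij_betw_imageI)
    show "inj (\<lambda>x. to_bcf (T x))" by (rule injI) (metis T(3) to_bcf_inject)
    show "range (\<lambda>x. to_bcf (T x)) = c0"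
    proof
      show "c0 \<subseteq> range (\<lambda>x. to_bcf (T x))"
      proof
        fix f assume "f \<in> c0"
        then have "f = to_bcf (T (T' (of_bcf f)))" by (simp add: T(4) of_bcf_inverse)
        then show "f \<in> range (\<lambda>x. to_bcf (T x))" by blast
      qed
    qed (use to_bcf in auto)
  qed
  obtain B where B: "\<And>z. norm (T' z) \<le> norm z * B" using bounded_linear.bounded[OF T(2)] by blast
  have "norm x \<le> B * norm (to_bcf (T x))" for x
    using B[of "T x"] by (simp add: T(3) norm_czero_def mult.commute)
  with bl bij have "lin_iso_c0 (\<lambda>x. to_bcf (T x))" by (auto simp: lin_iso_c0_def)
  then show "\<exists>T :: 'a \<Rightarrow> (nat, real) bcontfun. lin_iso_c0 T" by blast
qed

end
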